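(* The Wadge hierarchy of the class $\mathbf{r}\text{-}\mathbf{BCL}(4)_\omega$ is equal to the Wadge hierarchy of the class $\mathbf{r}\text{-}\mathbf{CL}(1)_\omega$. That is: for every finite alphabet $\Sigma$ and every Borel set $L\subseteq\Sigma^\omega$ in $\mathbf{r}\text{-}\mathbf{CL}(1)_\omega$ there is an $\omega$-language $L'$ (over some finite alphabet) in $\mathbf{r}\text{-}\mathbf{BCL}(4)_\omega$ with $L\equiv_W L'$; and conversely, for every Borel $\omega$-language $L$ in $\mathbf{r}\text{-}\mathbf{BCL}(4)_\omega$ there is an $\omega$-language $L'$ in $\mathbf{r}\text{-}\mathbf{CL}(1)_\omega$ with $L\equiv_W L'$.
   Context: A real-time $k$-counter Büchi automaton is a tuple $\mathcal{M}=(K,\Sigma,\Delta,q_0,F)$ with a finite set of states $K$, finite alphabet $\Sigma$, initial state $q_0\in K$, accepting states $F\subseteq K$ and transition relation $\Delta\subseteq K\times\Sigma\times\{0,1\}^k\times K\times\{-1,0,1\}^k$, where no transition has $i_m=0$ together with $j_m=-1$. A configuration is $(q,c_1,\dots,c_k)\in K\times\mathbb{N}^k$. Reading a letter $a$, from $(q,c)$ the automaton may go to $(q',c+j)$ whenever $(q,a,i,q',j)\in\Delta$ with $i_m=0$ iff $c_m=0$ for every $m$. A run on an $\omega$-word $a_1a_2\cdots$ is an infinite sequence of configurations starting in $(q_0,0,\dots,0)$, consecutive ones related via the successive letters (no $\epsilon$-moves); it is accepting if some state of $F$ occurs infinitely often, and $\mathrm{L}(\mathcal{M})$ is the set of $\omega$-words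 having an accepting run. The counters are blind if whenever $(q,a,i,q',j)\in\Delta$ with $i_m=0$, the tuple obtained by replacing $i_m$ by $1$ is also in $\Delta$ (so zero tests are impossible). $\mathbf{r}\text{-}\mathbf{CL}(1)_\omega$ is the class of $\omega$-languages accepted by real-time 1-counter Büchi automata (zero tests allowed); $\mathbf{r}\text{-}\mathbf{BCL}(4)_\omega$ is the class of $\omega$-languages accepted by real-time 4-blind-counter Büchi automata (these model Petri nets). $\Sigma^\omega$ carries the Cantor (prefix-metric) topology. For $L\subseteq X^\omega$, $L'\subseteq Y^\omega$, $L\le_W L'$ iff there is a continuous $f:X^\omega\to Y^\omega$ with $L=f^{-1}(L')$; $L\equiv_W L'$ iff $L\le_W L'$ and $L'\le_W L$. *)

theory Defs
  imports "HOL-Analysis.Analysis"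
begin

text \<open>Alphabets and state sets are finite sets of natural numbers (so that one can
quantify over alphabets inside a formula). An omega-word is a function nat => nat.\<close>

definition omega_words :: "nat set \<Rightarrow> (nat \<Rightarrow> nat) set" where
  "omega_words \<Sigma> = {w. \<forall>n. w n \<in> \<Sigma>}"

definition cantor_open :: "nat set \<Rightarrow> (nat \<Rightarrow> nat) set \<Rightarrow> bool" where
  "cantor_open \<Sigma> U \<longleftrightarrow> U \<subseteq> omega_words \<Sigma> \<and>
     (\<forall>x\<in>U. \<exists>n. \<forall>y\<in>omega_words \<Sigma>. (\<forall>i<n. y i = x i) \<longrightarrow> y \<in> U)"

definition cantor_borel :: "nat set \<Rightarrow> (nat \<Rightarrow> nat) set set" where
  "cantor_borel \<Sigma> = sigma_sets (omega_words \<Sigma>) {U. cantor_open \<Sigma> U}"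

definition cantor_continuous :: "nat set \<Rightarrow> nat set \<Rightarrow> ((nat \<Rightarrow> nat) \<Rightarrow> (nat \<Rightarrow> nat)) \<Rightarrow> bool" where
  "cantor_continuous \<Sigma> \<Gamma> f \<longleftrightarrow>
     (\<forall>x\<in>omega_words \<Sigma>. f x \<in> omega_words \<Gamma>) \<and>
     (\<forall>x\<in>omega_words \<Sigma>. \<forall>n. \<exists>m. \<forall>y\<in>omega_words \<Sigma>.
        (\<forall>i<m. y i = x i) \<longrightarrow> (\<forall>i<n. f y i = f x i))"

definition wadge_le :: "nat set \<Rightarrow> (nat \<Rightarrow> nat) set \<Rightarrow> nat set \<Rightarrow> (nat \<Rightarrow> nat) set \<Rightarrow> bool" where
  "wadge_le \<Sigma> L \<Gamma> L' \<longleftrightarrow> (\<exists>f. cantor_continuous \<Sigma> \<Gamma> f \<and>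
      (\<forall>x\<in>omega_words \<Sigma>. x \<in> L \<longleftrightarrow> f x \<in> L'))"

definition wadge_eq :: "nat set \<Rightarrow> (nat \<Rightarrow> nat) set \<Rightarrow> nat set \<Rightarrow> (nat \<Rightarrow> nat) set \<Rightarrow> bool" where
  "wadge_eq \<Sigma> L \<Gamma> L' \<longleftrightarrow> wadge_le \<Sigma> L \<Gamma> L' \<and> wadge_le \<Gamma> L' \<Sigma> L"

text \<open>Real-time k-counter Buchi automata (K, Sigma, Delta, q0, F).
A transition (q, a, i, q', j): i is the zero-test vector (True = 1 = nonzero),
j the counter update vector with entries in {-1,0,1}; both lists of length k.\<close>

record cautomaton =
  states :: "nat set"
  alph :: "nat set"
  trans :: "(nat \<times> nat \<times> bool list \<times> nat \<times> int list) set"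
  init :: nat
  final :: "nat set"

definition valid_ca :: "nat \<Rightarrow> cautomaton \<Rightarrow> bool" where
  "valid_ca k M \<longleftrightarrow> finite (states M) \<and> finite (alph M) \<and> init M \<in> states M \<and>
     final M \<subseteq> states M \<and>
     (\<forall>(q, a, i, q', j) \<in> trans M. q \<in> states M \<and> a \<in> alph M \<and> length i = k \<and>
        q' \<in> states M \<and> length j = k \<and> set j \<subseteq> {-1, 0, 1} \<and>
        (\<forall>m<k. \<not> (i ! m = False \<and> j ! m = -1)))"

definition blind_ca :: "nat \<Rightarrow> cautomaton \<Rightarrow> bool" where
  "blind_ca k M \<longleftrightarrow> (\<forall>(q, a, i, q', j) \<in> trans M. \<forall>m<k.
      i ! m = False \<longrightarrow> (q, a, i[m := True], q', j) \<in> trans M)"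

definition ca_step :: "nat \<Rightarrow> cautomaton \<Rightarrow> nat \<times> nat list \<Rightarrow> nat \<Rightarrow> nat \<times> nat list \<Rightarrow> bool" where
  "ca_step k M cf a cf' \<longleftrightarrow> (\<exists>i j. (fst cf, a, i, fst cf', j) \<in> trans M \<and>
      length (snd cf) = k \<and> length (snd cf') = k \<and>
      (\<forall>m<k. (i ! m \<longleftrightarrow> snd cf ! m \<noteq> 0)) \<and>
      (\<forall>m<k. int (snd cf' ! m) = int (snd cf ! m) + j ! m))"

definition ca_run :: "nat \<Rightarrow> cautomaton \<Rightarrow> (nat \<Rightarrow> nat) \<Rightarrow> (nat \<Rightarrow> nat \<times> nat list) \<Rightarrow> bool" where
  "ca_run k M w \<rho> \<longleftrightarrow> \<rho> 0 = (init M, replicate k 0) \<and>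
     (\<forall>n. ca_step k M (\<rho> n) (w n) (\<rho> (Suc n)))"

definition ca_lang :: "nat \<Rightarrow> cautomaton \<Rightarrow> (nat \<Rightarrow> nat) set" where
  "ca_lang k M = {w \<in> omega_words (alph M). \<exists>\<rho>. ca_run k M w \<rho> \<and>
      (\<exists>\<^sub>\<infinity>n. fst (\<rho> n) \<in> final M)}"

definition rCL1 :: "nat set \<Rightarrow> (nat \<Rightarrow> nat) set \<Rightarrow> bool" where
  "rCL1 \<Sigma> L \<longleftrightarrow> (\<exists>M. valid_ca 1 M \<and> alph M = \<Sigma> \<and> L = ca_lang 1 M)"

definition rBCL4 :: "nat set \<Rightarrow> (nat \<Rightarrow> nat) set \<Rightarrow> bool" where
  "rBCL4 \<Sigma> L \<longleftrightarrow> (\<exists>M. valid_ca 4 M \<and> blind_ca 4 M \<and> alph M = \<Sigma> \<and> L = ca_lang 4 M)"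

end

theory Submission
  imports Defs "HOL-Library.Countable" "HOL-Library.Nat_Bijection" "HOL-Computational_Algebra.Primes"
begin

text \<open>Both directions encode a word x as a word in which the letters of x are separated by blocks of
  prescribed lengths, so that an automaton with other counters can simulate the given one along correct
  codes. On a word that is not a code, membership in the new language is an open condition (a
  blind automaton can detect a block which is too short, but gets stuck in a block which is too long).
  Hence the new language differs from the given L by a bounded number of additional changes
  between acceptance and rejection. If the alternating closures of Hausdorff's difference hierarchy
  never become empty for L, a player in the Wadge game for L can afford any finite
  number of additional changes of mind, and the two languages are Wadge equivalent. Otherwise L is
  a finite difference of closed sets, and is equivalent to the language of a finite automaton
  which does not use its counters.\<close>

section \<open>The alternation strategy\<close>

text \<open>Inserting the padding reduces L to the new language; the work lies in the converse
  reduction, an explicit strategy. While the input looks like a code and every finite level of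
  \<open>alt\<close> is available, decoded letters are copied. When this first fails, only finitely
  many letters are committed and any finite number of alternations is available beyond them, so the
  rest of the play can follow a decreasing natural number whose parity is the current verdict.
  Leaving the code costs two extra values, 1 to reject and 0 to accept after entering the open set.
  If the levels of L run out, these two may be unaffordable; hence complete sets are used there.
  Without zero tests, the blind simulation relies on counting: a pair of counters holds as many
  tokens as the block has letters, so a run that leaves one component untouched survives the block
  only if that component is 0. In the other direction four counters become exponents of 2, 3, 5, 7.
  A single counter loses its value when it is run down, so the block length acts as a second store:
  the letters that remain carry the value.\<close>

text \<open>The cone of the prefix of x of length k meets the n-th of the closed sets starting with X in which
  each is the closure of the part of its predecessor inside L or outside L, alternately.\<close>

primrec alt :: "(nat \<Rightarrow> nat) set \<Rightarrow> (nat \<Rightarrow> nat) set \<Rightarrow> bool \<Rightarrow> nat \<Rightarrow> (nat \<Rightarrow> nat) \<Rightarrow> nat \<Rightarrow> bool" where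
  "alt X L c 0 x k \<longleftrightarrow> (\<exists>x'\<in>X. \<forall>i<k. x' i = x i)"
| "alt X L c (Suc n) x k \<longleftrightarrow>
     (\<exists>x'\<in>X. (\<forall>i<k. x' i = x i) \<and> (x' \<in> L \<longleftrightarrow> (even n \<longleftrightarrow> c)) \<and> (\<forall>j. alt X L c n x' j))"

lemma alt_cong: "\<forall>i<k. x' i = x i \<Longrightarrow> alt X L c n x' k = alt X L c n x k"
  by (cases n) auto

lemma alt_shorter:
  assumes "alt X L c n x k" "j \<le> k"
  shows "alt X L c n x j"
proof (cases n)
  case 0
  then show ?thesis using assms by (auto intro: less_le_trans)
next
  case (Suc m)
  then obtain x' where "x' \<in> X" "\<forall>i<k. x' i = x i" "x' \<in> L \<longleftrightarrow> (even m \<longleftrightarrow> c)" "\<forall>j. alt X L c m x' j"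
    using assms(1) by auto
  then show ?thesis using Suc assms(2) by (auto intro!: bexI[of _ x'])
qed

lemma alt_SucD: "alt X L c (Suc n) x k \<Longrightarrow> alt X L c n x k"
proof -
  assume "alt X L c (Suc n) x k"
  then obtain x' where "\<forall>i<k. x' i = x i" "\<forall>j. alt X L c n x' j" by auto
  then show ?thesis using alt_cong by blast
qed

lemma alt_antimono: "alt X L c n x k \<Longrightarrow> m \<le> n \<Longrightarrow> alt X L c m x k"
  by (induction n) (auto simp: le_Suc_eq simp del: alt.simps dest: alt_SucD)

text \<open>The colours are counted from the innermost level, so discarding that level flips every
  parity and with it the colour.\<close>

lemma alt_Suc_shift: "alt X L c (Suc n) x k \<Longrightarrow> alt X L (\<not> c) n x k"
proof (induction n arbitrary: x k)
  case 0
  then show ?case by auto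
next
  case (Suc n)
  then obtain x' where "x' \<in> X" "\<forall>i<k. x' i = x i" "x' \<in> L \<longleftrightarrow> (even (Suc n) \<longleftrightarrow> c)" "\<forall>j. alt X L c (Suc n) x' j"
    using alt.simps(2)[of X L c "Suc n" x k] by blast
  then show ?case using Suc.IH by (auto simp del: alt.simps(2) simp: alt.simps(2)[of X L "\<not> c" n x k] intro!: bexI[of _ x'])
qed

text \<open>Mostly used in contrapositive form: a point of the n-th closed set that has a cone
  missed by the next one must have the opposite membership. This is how a stabilised index decides
  membership in L.\<close>

lemma alt_self:
  assumes "x \<in> X" "\<forall>k. alt X L c n x k" "x \<in> L \<longleftrightarrow> (even n \<longleftrightarrow> c)"
  shows "alt X L c (Suc n) x k"
  using assms by auto

lemma antimono_nat_stabilises: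
  fixes q :: "nat \<Rightarrow> nat"
  assumes "\<And>k. k \<ge> k0 \<Longrightarrow> q (Suc k) \<le> q k"
  obtains k where "k \<ge> k0" "\<And>j. j \<ge> k \<Longrightarrow> q j = q k"
proof -
  define k where "k = (ARG_MIN q k. k \<ge> k0)"
  have k: "k \<ge> k0" "\<And>j. j \<ge> k0 \<Longrightarrow> q k \<le> q j"
    using arg_min_nat_lemma[of "\<lambda>k. k \<ge> k0" k0 q] unfolding k_def by auto
  have "q j \<le> q k" if "j \<ge> k" for j
    using that
  proof (induction j rule: dec_induct)
    case (step n)
    then show ?case using assms[of n] k(1) by auto
  qed simp
  then show thesis using that k by (meson le_antisym le_trans)
qed

text \<open>A player who must end up in or out of L: as long as good holds, he copies the word g y;
  afterwards he follows a target word, and changes it only when the index p drops.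
  At stage k, the first m k letters are committed.\<close>

primrec play ::
  "(nat \<Rightarrow> nat) set \<Rightarrow> (nat \<Rightarrow> nat) set \<Rightarrow> bool \<Rightarrow> ((nat \<Rightarrow> nat) \<Rightarrow> nat \<Rightarrow> bool) \<Rightarrow>
   ((nat \<Rightarrow> nat) \<Rightarrow> nat \<Rightarrow> nat) \<Rightarrow> ((nat \<Rightarrow> nat) \<Rightarrow> nat \<Rightarrow> nat) \<Rightarrow> (nat \<Rightarrow> nat) \<Rightarrow> (nat \<Rightarrow> nat) \<Rightarrow> nat \<Rightarrow> nat \<Rightarrow> nat"
where
  "play X L c good p g m y 0 = g y"
| "play X L c good p g m y (Suc k) =
     (if good y (Suc k) then g y
      else if \<not> good y k \<and> p y (Suc k) = p y k then play X L c good p g m y k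
      else SOME x. x \<in> X \<and> (\<forall>i<m k. x i = play X L c good p g m y k i) \<and>
             (x \<in> L \<longleftrightarrow> (even (p y (Suc k)) \<longleftrightarrow> c)) \<and> (\<forall>j. alt X L c (p y (Suc k)) x j))"

text \<open>\<open>good\<close> describes the copying phase, \<open>p\<close> the number of changes
  still planned, its parity the current verdict, and \<open>m k\<close> the number of output letters
  committed after k input letters. Alternations are demanded only by \<open>start\<close>, when
  copying ends; every later drop of \<open>p\<close> is paid for by the level to which the current
  target belongs.\<close>

lemma alternation_strategy:
  assumes good_local: "\<And>y y' k. \<forall>i<k. y' i = y i \<Longrightarrow> good y' k = good y k"
    and p_local: "\<And>y y' k. \<forall>i<k. y' i = y i \<Longrightarrow> p y' k = p y k"
    and g_local: "\<And>y y' k i. \<forall>i<k. y' i = y i \<Longrightarrow> i < m k \<Longrightarrow> g y' i = g y i"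
    and good_0: "\<And>y. good y 0"
    and good_Suc: "\<And>y k. good y (Suc k) \<Longrightarrow> good y k"
    and p_mono: "\<And>y k. \<not> good y k \<Longrightarrow> p y (Suc k) \<le> p y k"
    and start: "\<And>y k. y \<in> omega_words \<Gamma> \<Longrightarrow> good y k \<Longrightarrow> \<not> good y (Suc k) \<Longrightarrow>
                  alt (omega_words \<Sigma>) L c (Suc (p y (Suc k))) (g y) (m k)"
    and m_mono: "mono m" and m_unbounded: "\<And>i. \<exists>k. i < m k"
    and g_in: "\<And>y. y \<in> omega_words \<Gamma> \<Longrightarrow> \<forall>k. good y k \<Longrightarrow> g y \<in> omega_words \<Sigma>"
  obtains f where "cantor_continuous \<Gamma> \<Sigma> f"
    and "\<And>y. y \<in> omega_words \<Gamma> \<Longrightarrow> \<forall>k. good y k \<Longrightarrow> f y = g y"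
    and "\<And>y k n. y \<in> omega_words \<Gamma> \<Longrightarrow> \<forall>j\<ge>k. \<not> good y j \<and> p y j = n \<Longrightarrow> f y \<in> L \<longleftrightarrow> (even n \<longleftrightarrow> c)"
proof -
  let ?X = "omega_words \<Sigma>"
  define o' where "o' = play ?X L c good p g m"
  define tgt where "tgt y k x \<longleftrightarrow> x \<in> ?X \<and> (\<forall>i<m k. x i = o' y k i) \<and>
             (x \<in> L \<longleftrightarrow> (even (p y (Suc k)) \<longleftrightarrow> c)) \<and> (\<forall>j. alt ?X L c (p y (Suc k)) x j)" for y k x
  have o_0: "o' y 0 = g y" for y by (simp add: o'_def)
  have o_Suc: "o' y (Suc k) = (if good y (Suc k) then g y
      else if \<not> good y k \<and> p y (Suc k) = p y k then o' y k else SOME x. tgt y k x)" for y k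
    by (simp add: o'_def tgt_def[abs_def])
  have o_good: "o' y k = g y" if "good y k" for y k
    using that by (cases k) (auto simp: o_0 o_Suc)
  have inv: "\<not> good y k \<longrightarrow> o' y k \<in> ?X \<and> (o' y k \<in> L \<longleftrightarrow> (even (p y k) \<longleftrightarrow> c)) \<and> (\<forall>j. alt ?X L c (p y k) (o' y k) j)"
    and tgt: "\<not> good y (Suc k) \<Longrightarrow> good y k \<or> p y (Suc k) \<noteq> p y k \<Longrightarrow> tgt y k (SOME x. tgt y k x)"
    if y: "y \<in> omega_words \<Gamma>" for y k
  proof -
    have step: "tgt y k (SOME x. tgt y k x)"
      if k: "\<not> good y (Suc k)" "good y k \<or> p y (Suc k) \<noteq> p y k" 
        and inv: "\<not> good y k \<longrightarrow> (\<forall>j. alt ?X L c (p y k) (o' y k) j)" for k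
    proof -
      \<comment> \<open>At the end of copying this is \<open>start\<close>. Later a drop of the
        index gives \<open>Suc (p y (Suc k)) \<le> p y k\<close>, and the current target lies in the
        closed set of index \<open>p y k\<close>.\<close>
      have "alt ?X L c (Suc (p y (Suc k))) (o' y k) (m k)"
      proof (cases "good y k")
        case True
        then show ?thesis using start[OF y True k(1)] o_good by simp
      next
        case False
        then have "Suc (p y (Suc k)) \<le> p y k" using p_mono[of y k] k(2) by simp
        then show ?thesis using inv False alt_antimono by blast
      qed
      then have "\<exists>x. tgt y k x" by (auto simp: tgt_def)
      then show ?thesis by (rule someI_ex)
    qed
    show inv: "\<not> good y k \<longrightarrow> o' y k \<in> ?X \<and> (o' y k \<in> L \<longleftrightarrow> (even (p y k) \<longleftrightarrow> c)) \<and> (\<forall>j. alt ?X L c (p y k) (o' y k) j)" for k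
    proof (induction k)
      case 0
      then show ?case using good_0 by simp
    next
      case (Suc k)
      show ?case
      proof (cases "\<not> good y (Suc k) \<and> (good y k \<or> p y (Suc k) \<noteq> p y k)")
        case True
        then have "tgt y k (o' y (Suc k))" using step[of k] Suc o_Suc by auto
        then show ?thesis by (simp add: tgt_def)
      next
        case False
        then show ?thesis using Suc o_Suc by auto
      qed
    qed
    show "tgt y k (SOME x. tgt y k x)" if "\<not> good y (Suc k)" "good y k \<or> p y (Suc k) \<noteq> p y k"
      using step[OF that] inv by blast
  qed
  have agree1: "o' y (Suc k) i = o' y k i" if "y \<in> omega_words \<Gamma>" "i < m k" for y k i
  proof (cases "\<not> good y (Suc k) \<and> (good y k \<or> p y (Suc k) \<noteq> p y k)")
    case True
    then have "tgt y k (o' y (Suc k))" using tgt[OF that(1)] o_Suc by auto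
    then show ?thesis using that(2) by (simp add: tgt_def)
  next
    case False
    then show ?thesis using o_Suc[of y k] o_good good_Suc by auto
  qed
  have agree: "o' y k' i = o' y k i" if "y \<in> omega_words \<Gamma>" "i < m k" "k \<le> k'" for y k k' i
    using that(3)
  proof (induction k' rule: dec_induct)
    case (step n)
    then have "i < m n" using m_mono that(2) by (meson monoD order_less_le_trans)
    then show ?case using agree1[OF that(1)] step by simp
  qed simp
  \<comment> \<open>During copying the word \<open>g y\<close> may depend on all of y, so only the
    committed letters are determined by the prefix; after copying the whole target is.\<close>
  have o_local: "(\<not> good y k \<longrightarrow> o' y' k = o' y k) \<and> (\<forall>i<m k. o' y' k i = o' y k i)"
    if "\<forall>i<k. y' i = y i" for y y' k
    using that
  proof (induction k)
    case 0
    then show ?case using good_0 g_local[of 0 y' y] by (simp add: o_0)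
  next
    case (Suc k)
    have IH: "(\<not> good y k \<longrightarrow> o' y' k = o' y k) \<and> (\<forall>i<m k. o' y' k i = o' y k i)"
      using Suc by simp
    have gd: "good y' (Suc k) = good y (Suc k)" "p y' (Suc k) = p y (Suc k)"
      "good y' k = good y k" "p y' k = p y k"
      using good_local[OF Suc.prems] p_local[OF Suc.prems] good_local[of k y' y] p_local[of k y' y] Suc.prems
      by auto
    have "tgt y' k = tgt y k" using IH gd by (auto simp: tgt_def fun_eq_iff)
    then show ?case using gd IH o_Suc[of y k] o_Suc[of y' k] g_local[OF Suc.prems] by auto
  qed
  define f where "f y i = o' y (LEAST k. i < m k) i" for y i
  have f_eq: "f y i = o' y k i" if "y \<in> omega_words \<Gamma>" "i < m k" for y k i
    using agree[OF that(1), of i "LEAST k. i < m k" k] that(2) LeastI[of "\<lambda>k. i < m k" k] Least_le[of "\<lambda>k. i < m k" k]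
    unfolding f_def by auto
  have f_good: "f y = g y" if "y \<in> omega_words \<Gamma>" "\<forall>k. good y k" for y
    using f_def o_good that(2) by auto
  have f_const: "f y = o' y k" if y: "y \<in> omega_words \<Gamma>" and k: "\<forall>j\<ge>k. \<not> good y j \<and> p y j = p y k" for y k
  proof
    fix i
    have *: "o' y j = o' y k" if "j \<ge> k" for j
      using that
    proof (induction j rule: dec_induct)
      case (step n)
      then show ?case using o_Suc[of y n] k[rule_format, of n] k[rule_format, of "Suc n"] by simp
    qed simp
    obtain k' where "i < m k'" using m_unbounded by blast
    then have "i < m (max k k')" using m_mono by (meson max.cobounded2 monoD order_less_le_trans)
    then show "f y i = o' y k i" using f_eq[OF y] *[of "max k k'"] by simp
  qed
  have f_lim: "f y \<in> ?X \<and> (\<forall>k n. (\<forall>j\<ge>k. \<not> good y j \<and> p y j = n) \<longrightarrow> (f y \<in> L \<longleftrightarrow> (even n \<longleftrightarrow> c)))" if y: "y \<in> omega_words \<Gamma>" for y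
  proof (cases "\<forall>k. good y k")
    case True
    then show ?thesis using f_good[OF y] g_in[OF y] by auto
  next
    case False
    then obtain k0 where k0: "\<not> good y k0" by blast
    have bad: "\<not> good y k" if "k \<ge> k0" for k
      using that k0 by (induction k rule: dec_induct) (auto dest: good_Suc)
    obtain k where k: "k \<ge> k0" "\<And>j. j \<ge> k \<Longrightarrow> p y j = p y k"
      using antimono_nat_stabilises[of k0 "p y"] p_mono bad by blast
    then have kk: "\<forall>j\<ge>k. \<not> good y j \<and> p y j = p y k" using bad order_trans[OF k(1)] by blast
    have "p y k = n" if "\<forall>j\<ge>k'. \<not> good y j \<and> p y j = n" for k' n
      using that k(2)[of "max k k'"] by simp
    then show ?thesis using f_const[OF y kk] inv[OF y, of k] bad[OF k(1)] by metis
  qed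
  have "cantor_continuous \<Gamma> \<Sigma> f"
    unfolding cantor_continuous_def
  proof (intro conjI ballI allI)
    fix y n assume y: "y \<in> omega_words \<Gamma>"
    obtain k where "n < m k" using m_unbounded by blast
    then have "f y' i = f y i" if "y' \<in> omega_words \<Gamma>" "\<forall>i<k. y' i = y i" "i < n" for y' i
      using f_eq[OF y, of i k] f_eq[OF that(1), of i k] o_local[OF that(2)] that(3) by simp
    then show "\<exists>k. \<forall>y'\<in>omega_words \<Gamma>. (\<forall>i<k. y' i = y i) \<longrightarrow> (\<forall>i<n. f y' i = f y i)" by blast
  qed (use f_lim in blast)
  then show thesis using that f_good f_lim by blast
qed

section \<open>Wadge equivalence of a language with its padded coding\<close>

text \<open>Padding gives one reduction. For the other, the index is the rank of the decoded prefix
  (the first level that misses its cone) plus 2 as long as y looks like a code, and 1 or 0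
  afterwards. In each of these cases an even final index means membership in \<open>L'\<close>, so
  one strategy with colour \<open>True\<close> covers them all.\<close>

lemma coding_wadge_eq:
  fixes \<Sigma> \<Gamma> :: "nat set" and pos fill :: "nat \<Rightarrow> nat"
  defines "C \<equiv> {y. (\<forall>i. y (pos i) \<in> \<Sigma>) \<and> (\<forall>n. n \<notin> range pos \<longrightarrow> y n = fill n)}"
  assumes pos: "strict_mono pos"
    and sub: "\<Sigma> \<subseteq> \<Gamma>" and fill: "\<And>n. fill n \<in> \<Gamma>"
    and on_code: "\<And>y. y \<in> omega_words \<Gamma> \<Longrightarrow> y \<in> C \<Longrightarrow> y \<in> L' \<longleftrightarrow> (\<lambda>i. y (pos i)) \<in> L"
    and off_code: "\<And>y. y \<in> omega_words \<Gamma> \<Longrightarrow> y \<notin> C \<Longrightarrow> y \<in> L' \<longleftrightarrow> y \<in> U"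
    and U: "cantor_open \<Gamma> U"
    and inf: "\<And>n x. alt (omega_words \<Sigma>) L True n x 0"
  shows "wadge_eq \<Sigma> L \<Gamma> L'"
proof -
  have inj: "inj pos" using pos by (rule strict_mono_imp_inj_on)
  define h where "h x n = (if n \<in> range pos then x (inv pos n) else fill n)" for x :: "nat \<Rightarrow> nat" and n
  have h_pos: "h x (pos i) = x i" for x i using inj by (simp add: h_def)
  have h_in: "h x \<in> omega_words \<Gamma>" if "x \<in> omega_words \<Sigma>" for x
    using that sub fill by (auto simp: h_def omega_words_def)
  have h_C: "h x \<in> C" if "x \<in> omega_words \<Sigma>" for x
    using that inj by (auto simp: h_def omega_words_def C_def)
  have "cantor_continuous \<Sigma> \<Gamma> h"
    unfolding cantor_continuous_def
  proof (intro conjI ballI allI)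
    fix x n
    have "inv pos (pos i) \<le> pos i" for i using strict_mono_imp_increasing[OF pos] inj by simp
    then have "h y i = h x i" if "\<forall>i<n. y i = x i" "i < n" for y i
    proof (cases "i \<in> range pos")
      case True
      then obtain j where j: "i = pos j" by blast
      then have "j < n" using \<open>inv pos (pos j) \<le> pos j\<close> inj that(2) by simp
      then show ?thesis using that(1) j h_pos by simp
    qed (simp add: h_def)
    then show "\<exists>k. \<forall>y\<in>omega_words \<Sigma>. (\<forall>i<k. y i = x i) \<longrightarrow> (\<forall>i<n. h y i = h x i)" by blast
  qed (use h_in in blast)
  moreover have "x \<in> L \<longleftrightarrow> h x \<in> L'" if "x \<in> omega_words \<Sigma>" for x
    using on_code[OF h_in h_C] that h_pos by simp
  ultimately have le: "wadge_le \<Sigma> L \<Gamma> L'" unfolding wadge_le_def by blast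

  define m where "m k = (LEAST i. k \<le> pos i)" for k
  have m_iff: "i < m k \<longleftrightarrow> pos i < k" for i k
  proof
    assume "i < m k"
    then show "pos i < k" using not_less_Least unfolding m_def by fastforce
  next
    assume *: "pos i < k"
    have "k \<le> pos (m k)" unfolding m_def
      by (rule LeastI[of _ k]) (rule strict_mono_imp_increasing[OF pos])
    then show "i < m k" using * pos by (meson leD leI le_less_trans order_trans strict_mono_less)
  qed
  have m_mono: "mono m"
  proof (rule monoI)
    fix k k' :: nat assume "k \<le> k'"
    then have "i < m k'" if "i < m k" for i using that m_iff by (meson less_le_trans)
    then show "m k \<le> m k'" using linorder_not_le by blast
  qed
  define A where "A = alt (omega_words \<Sigma>) L True"
  define dec where "dec y i = y (pos i)" for y :: "nat \<Rightarrow> nat" and i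
  define ok where "ok y k \<longleftrightarrow> (\<forall>n<k. if n \<in> range pos then y n \<in> \<Sigma> else y n = fill n)" for y k
  define good where "good y k \<longleftrightarrow> ok y k \<and> (\<forall>n. A n (dec y) (m k))" for y k
  define cone where "cone y k \<longleftrightarrow> (\<forall>y'\<in>omega_words \<Gamma>. (\<forall>i<k. y' i = y i) \<longrightarrow> y' \<in> U)" for y k
  \<comment> \<open>Adding 2 keeps the parity of the rank and leaves 1 (reject) and 0 (accept) for
    prefixes that are no longer codes. There the only possible change is from 1 to 0, when the cone
    has entered the open set \<open>U\<close>.\<close>
  define p where "p y k = (if ok y k then 2 + (LEAST n. \<not> A n (dec y) (m k)) else if cone y k then 0 else 1)" for y k
  have C_iff: "y \<in> C \<longleftrightarrow> (\<forall>k. ok y k)" for y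
  proof
    show "\<forall>k. ok y k" if "y \<in> C" using that by (auto simp: C_def ok_def)
    show "y \<in> C" if *: "\<forall>k. ok y k"
    proof -
      have "if n \<in> range pos then y n \<in> \<Sigma> else y n = fill n" for n
        using *[rule_format, of "Suc n"] unfolding ok_def by blast
      then show ?thesis unfolding C_def by (auto split: if_splits)
    qed
  qed
  have dec_local: "dec y' i = dec y i" if "\<forall>i<k. y' i = y i" "i < m k" for y y' k i
    using that m_iff by (auto simp: dec_def)
  have A_local: "A n (dec y') (m k) = A n (dec y) (m k)" if "\<forall>i<k. y' i = y i" for y y' k n
    unfolding A_def using alt_cong dec_local[OF that] by blast
  have ok_local: "ok y' k = ok y k" if "\<forall>i<k. y' i = y i" for y y' k
    using that unfolding ok_def by simp
  have ok_Suc: "ok y k" if "ok y (Suc k)" for y k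
    using that unfolding ok_def by simp
  have A_Suc: "A n (dec y) (m k)" if "A n (dec y) (m (Suc k))" for y k n
    using that alt_shorter m_mono unfolding A_def by (meson le_SucI monoD order_refl)
  have good_Suc: "good y k" if "good y (Suc k)" for y k
    using that A_Suc ok_Suc unfolding good_def by blast
  have cone_local: "cone y' k = cone y k" if "\<forall>i<k. y' i = y i" for y y' k
    using that unfolding cone_def by simp
  have p_mono: "p y (Suc k) \<le> p y k" if ng: "\<not> good y k" for y k
  proof (cases "ok y (Suc k)")
    case True
    then have "ok y k" by (rule ok_Suc)
    moreover obtain n where "\<not> A n (dec y) (m k)" using ng \<open>ok y k\<close> by (auto simp: good_def)
    then have "\<not> A (LEAST n. \<not> A n (dec y) (m k)) (dec y) (m k)" by (rule LeastI)
    then have "(LEAST n. \<not> A n (dec y) (m (Suc k))) \<le> (LEAST n. \<not> A n (dec y) (m k))"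
      using A_Suc by (intro Least_le) blast
    ultimately show ?thesis using True by (simp add: p_def)
  next
    case False
    then show ?thesis by (auto simp: p_def cone_def)
  qed
  have C_in: "dec y \<in> omega_words \<Sigma>" if "y \<in> C" for y
    using that by (auto simp: C_def dec_def omega_words_def)
  obtain f where f: "cantor_continuous \<Gamma> \<Sigma> f"
    and f_good: "\<And>y. y \<in> omega_words \<Gamma> \<Longrightarrow> \<forall>k. good y k \<Longrightarrow> f y = dec y"
    and f_bad: "\<And>y k n. y \<in> omega_words \<Gamma> \<Longrightarrow> \<forall>j\<ge>k. \<not> good y j \<and> p y j = n \<Longrightarrow> f y \<in> L \<longleftrightarrow> (even n \<longleftrightarrow> True)"
  proof (rule alternation_strategy[of good p m dec \<Gamma> \<Sigma> L True])
    show "good y' k = good y k" if "\<forall>i<k. y' i = y i" for y y' k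
      using that ok_local A_local unfolding good_def by blast
    show "p y' k = p y k" if "\<forall>i<k. y' i = y i" for y y' k
      using ok_local[OF that] A_local[OF that] cone_local[OF that] unfolding p_def by presburger
    show "good y 0" for y using inf by (auto simp: good_def ok_def A_def m_def)
    \<comment> \<open>\<open>good y k\<close> provides every level above the committed prefix, so
      the index may start at any value.\<close>
    show "alt (omega_words \<Sigma>) L True (Suc (p y (Suc k))) (dec y) (m k)" if "good y k" for y k
      using that unfolding good_def A_def by blast
    show "\<exists>k. i < m k" for i using m_iff by blast
    show "dec y \<in> omega_words \<Sigma>" if "\<forall>k. good y k" for y
      using that C_in C_iff good_def by blast
  qed (use good_Suc p_mono m_mono dec_local in auto)
  have "y \<in> L' \<longleftrightarrow> f y \<in> L" if y: "y \<in> omega_words \<Gamma>" for y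
  proof (cases "\<forall>k. good y k")
    case True
    then show ?thesis using f_good[OF y True] on_code[OF y] C_iff by (auto simp: good_def dec_def[abs_def])
  next
    case False
    then obtain k0 where k0: "\<not> good y k0" by blast
    have bad: "\<not> good y k" if "k \<ge> k0" for k
      using that k0 by (induction k rule: dec_induct) (auto dest: good_Suc)
    obtain k where k: "k \<ge> k0" "\<And>j. j \<ge> k \<Longrightarrow> p y j = p y k"
      using antimono_nat_stabilises[of k0 "p y"] p_mono bad by blast
    have "\<forall>j\<ge>k. \<not> good y j \<and> p y j = p y k" using k(2) bad order_trans[OF k(1)] by blast
    then have fy: "f y \<in> L \<longleftrightarrow> even (p y k)" using f_bad[OF y] by blast
    show ?thesis
    proof (cases "y \<in> C")
      case True
      then have ok: "\<And>k. ok y k" using C_iff by blast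
      let ?x = "dec y"
      define r where "r = (LEAST n. \<not> A n ?x (m k))"
      have ex: "\<exists>n. \<not> A n ?x (m j)" if "j \<ge> k" for j using bad[of j] ok k(1) that by (auto simp: good_def)
      have r: "r = (LEAST n. \<not> A n ?x (m j))" if "j \<ge> k" for j
        using k(2)[OF that] ok by (simp add: p_def r_def)
      have nr: "\<not> A r ?x (m k)" using LeastI_ex[OF ex[of k]] r_def by simp
      have r0: "r \<noteq> 0"
      proof
        assume "r = 0"
        then show False using nr C_in[OF True] by (auto simp: A_def)
      qed
      then obtain s where s: "r = Suc s" by (cases r) auto
      have as: "A s ?x (m j)" if "j \<ge> k" for j using r[OF that] s not_less_Least[of s "\<lambda>n. \<not> A n ?x (m j)"] by auto
      have "A s ?x i" for i
      proof -
        have "\<exists>j\<ge>k. i \<le> m j" 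
          using m_iff[of i "max k (Suc (pos i))"] by (intro exI[of _ "max k (Suc (pos i))"]) auto
        then show ?thesis using as alt_shorter unfolding A_def by blast
      qed
      \<comment> \<open>The decoded word lies in the s-th closed set, and the next one misses a cone
        of it. So it is in L iff s is odd, that is, iff the index \<open>2 + Suc s\<close> is
        even.\<close>
      then have "\<not> (?x \<in> L \<longleftrightarrow> (even s \<longleftrightarrow> True))"
        using nr alt_self[OF C_in[OF True], of L True s "m k"] unfolding A_def s by blast
      moreover have "p y k = 2 + r" using ok by (simp add: p_def r_def)
      ultimately show ?thesis using on_code[OF y True] fy s by (simp add: dec_def[abs_def])
    next
      case False
      then obtain k1 where k1: "\<not> ok y k1" using C_iff by blast
      have nok: "\<not> ok y k" if "k \<ge> k1" for k
        using that k1 by (induction k rule: dec_induct) (auto dest: ok_Suc)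
      have "y \<in> U \<longleftrightarrow> even (p y k)"
      proof
        assume "y \<in> U"
        then obtain n where n: "\<forall>y'\<in>omega_words \<Gamma>. (\<forall>i<n. y' i = y i) \<longrightarrow> y' \<in> U"
          using U unfolding cantor_open_def by blast
        then have "cone y (max k (max n k1))" by (auto simp: cone_def)
        then show "even (p y k)" using k(2)[of "max k (max n k1)"] nok[of "max k (max n k1)"] by (simp add: p_def)
      next
        assume "even (p y k)"
        then have "cone y (max k k1)" using k(2)[of "max k k1"] nok[of "max k k1"] by (auto simp: p_def split: if_splits)
        then show "y \<in> U" using y by (auto simp: cone_def)
      qed
      then show ?thesis using off_code[OF y False] fy by simp
    qed
  qed
  then have "wadge_le \<Gamma> L' \<Sigma> L" unfolding wadge_le_def using f by blast
  then show ?thesis using le by (simp add: wadge_eq_def)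
qed

lemma INFM_eventually_const: "\<forall>j\<ge>k. (P j \<longleftrightarrow> b) \<Longrightarrow> (\<exists>\<^sub>\<infinity>j::nat. P j) \<longleftrightarrow> b"
  by (metis INFM_nat_le nle_le)

section \<open>Complete languages of the finite levels\<close>

primrec least_letter :: "nat \<Rightarrow> (nat \<Rightarrow> nat) \<Rightarrow> nat \<Rightarrow> nat" where
  "least_letter n y 0 = n"
| "least_letter n y (Suc k) = min (least_letter n y k) (y (Suc k))"

lemma least_letter_le: "least_letter n y k \<le> n"
  by (induction k) auto

lemma least_letter_cong: "\<forall>i\<le>k. y' i = y i \<Longrightarrow> least_letter n y' k = least_letter n y k"
  by (induction k) auto

text \<open>The complete sets of the finite levels: the first letter selects the colour of even indices,
  the remaining letters are a decreasing index whose limit decides membership.\<close>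

definition parity_lang :: "nat \<Rightarrow> (nat \<Rightarrow> bool) \<Rightarrow> (nat \<Rightarrow> nat) set" where
  "parity_lang n col = {y \<in> omega_words {..Suc n}. \<exists>\<^sub>\<infinity>k. (even (least_letter n y k) \<longleftrightarrow> col (y 0))}"

text \<open>Here nothing is copied: the strategy leaves the copying phase at once and follows the
  decreasing index. Each first letter fixes a colour and thereby its own reduction; these are merged
  continuously by looking at that letter.\<close>

lemma parity_lang_wadge_le:
  assumes "\<And>a x. alt (omega_words \<Sigma>) L (col a) (Suc n) x 0"
  shows "wadge_le {..Suc n} (parity_lang n col) \<Sigma> L"
proof -
  let ?\<Gamma> = "{..Suc n}"
  have "\<exists>f. cantor_continuous ?\<Gamma> \<Sigma> f \<and>
      (\<forall>y\<in>omega_words ?\<Gamma>. f y \<in> L \<longleftrightarrow> (\<exists>\<^sub>\<infinity>k. (even (least_letter n y k) \<longleftrightarrow> col a)))" for a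
  proof -
    \<comment> \<open>Stage k has seen the letters before position k only. At stage 1 the index is
      n, which matches the level \<open>Suc n\<close> in the assumption.\<close>
    define p where "p y k = least_letter n y (k - 1)" for y k
    obtain f where f: "cantor_continuous ?\<Gamma> \<Sigma> f"
      and fL: "\<And>y k r. y \<in> omega_words ?\<Gamma> \<Longrightarrow> \<forall>j\<ge>k. j \<noteq> 0 \<and> p y j = r \<Longrightarrow> f y \<in> L \<longleftrightarrow> (even r \<longleftrightarrow> col a)"
    proof (rule alternation_strategy[of "\<lambda>y k. k = 0" p "\<lambda>k. k" "\<lambda>y. y" ?\<Gamma> \<Sigma> L "col a"])
      show "p y' k = p y k" if "\<forall>i<k. y' i = y i" for y y' k
        unfolding p_def using that by (cases k) (auto intro!: least_letter_cong)
      show "p y (Suc k) \<le> p y k" if "k \<noteq> 0" for y k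
        using that by (cases k) (auto simp: p_def)
      show "alt (omega_words \<Sigma>) L (col a) (Suc (p y (Suc k))) y k" if "k = 0" for y k
        using that assms by (simp add: p_def del: alt.simps)
    qed (auto simp: mono_def)
    have "f y \<in> L \<longleftrightarrow> (\<exists>\<^sub>\<infinity>k. (even (least_letter n y k) \<longleftrightarrow> col a))" if y: "y \<in> omega_words ?\<Gamma>" for y
    proof -
      obtain k where k: "\<And>j. j \<ge> k \<Longrightarrow> least_letter n y j = least_letter n y k"
        using antimono_nat_stabilises[of 0 "least_letter n y"] by (metis least_letter.simps(2) min.cobounded1)
      have "p y j = least_letter n y k" if "j \<ge> Suc k" for j
        unfolding p_def using that by (intro k) simp
      then have "\<forall>j\<ge>Suc k. j \<noteq> 0 \<and> p y j = least_letter n y k" by auto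
      then show ?thesis using fL[OF y] INFM_eventually_const[of k "\<lambda>k. even (least_letter n y k) \<longleftrightarrow> col a"] k
        by metis
    qed
    then show ?thesis using f by blast
  qed
  then obtain F where F: "\<And>a. cantor_continuous ?\<Gamma> \<Sigma> (F a)"
    and FL: "\<And>a y. y \<in> omega_words ?\<Gamma> \<Longrightarrow> F a y \<in> L \<longleftrightarrow> (\<exists>\<^sub>\<infinity>k. (even (least_letter n y k) \<longleftrightarrow> col a))"
    by metis
  have "cantor_continuous ?\<Gamma> \<Sigma> (\<lambda>y. F (y 0) y)"
    unfolding cantor_continuous_def
  proof (intro conjI ballI allI)
    show "F (y 0) y \<in> omega_words \<Sigma>" if "y \<in> omega_words ?\<Gamma>" for y
      using F that unfolding cantor_continuous_def by blast
    fix y r assume "y \<in> omega_words ?\<Gamma>"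
    then obtain k where "\<forall>y'\<in>omega_words ?\<Gamma>. (\<forall>i<k. y' i = y i) \<longrightarrow> (\<forall>i<r. F (y 0) y' i = F (y 0) y i)"
      using F unfolding cantor_continuous_def by meson
    then show "\<exists>k. \<forall>y'\<in>omega_words ?\<Gamma>. (\<forall>i<k. y' i = y i) \<longrightarrow> (\<forall>i<r. F (y' 0) y' i = F (y 0) y i)"
      by (intro exI[of _ "Suc k"]) (metis less_SucI zero_less_Suc)
  qed
  then show ?thesis unfolding wadge_le_def parity_lang_def using FL by blast
qed

text \<open>The number n is the last level reached by some colour. Near each x some colour dies out
  before level \<open>Suc n\<close>; its rank at x is then at most n and never increases along x,
  and the parity of its limit decides membership. The first letter of the image announces the other
  colour, the remaining letters list the ranks.\<close>

lemma finite_level_wadge_eq: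
  assumes ne: "omega_words \<Sigma> \<noteq> {}" and fin: "\<not> alt (omega_words \<Sigma>) L True N z 0"
  shows "\<exists>n col. wadge_eq \<Sigma> L {..Suc n} (parity_lang n col)"
proof -
  let ?X = "omega_words \<Sigma>"
  have alt_0: "alt ?X L c n x 0 = alt ?X L c n y 0" for c n x y by (intro alt_cong) auto
  define S where "S n c \<longleftrightarrow> alt ?X L c (Suc n) z 0" for n c
  define n where "n = (LEAST n. \<forall>c. \<not> S (Suc n) c)"
  have "\<not> S (Suc N) c" for c
    using fin alt_antimono[of ?X L True "Suc (Suc N)" z 0 N] alt_antimono[of ?X L True "Suc N" z 0 N]
      alt_Suc_shift[of ?X L False "Suc N" z 0] by (cases c) (auto simp: S_def simp del: alt.simps)
  then have none: "\<not> S (Suc n) c" for c unfolding n_def using LeastI[of "\<lambda>n. \<forall>c. \<not> S (Suc n) c" N] by blast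
  have some: "\<exists>c. S n c"
  proof (cases n)
    case 0
    obtain x where x: "x \<in> ?X" using ne by blast
    then have "S 0 (x \<in> L)" by (auto simp: S_def)
    then show ?thesis using 0 by blast
  next
    case (Suc n')
    then show ?thesis using not_less_Least[of n' "\<lambda>n. \<forall>c. \<not> S (Suc n) c"] n_def by auto
  qed
  \<comment> \<open>If both colours reach level n, the first letter has to offer both. The alphabet
    \<open>{..Suc n}\<close> contains 0 and 1 even for n = 0.\<close>
  define col where "col a = (if S n True \<and> S n False then a = 0 else S n True)" for a :: nat
  have S_col: "S n (col a)" for a
  proof -
    obtain c where "S n c" using some by blast
    then show ?thesis by (cases c; cases "S n True"; cases "S n False"; cases "a = 0") (auto simp: col_def)
  qed
  have col_S: "\<exists>a\<le>1. col a = c" if "S n c" for c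
    using that by (cases c; cases "S n True \<and> S n False") (auto simp: col_def intro: exI[of _ "0::nat"] exI[of _ "1::nat"])
  have 1: "wadge_le {..Suc n} (parity_lang n col) \<Sigma> L"
    using S_col alt_0 unfolding S_def by (intro parity_lang_wadge_le) blast

  define side where "side x k c \<longleftrightarrow> S n c \<and> \<not> alt ?X L (\<not> c) (Suc n) x k" for x k c
  have side_local: "side x' k c = side x k c" if "\<forall>i<k. x' i = x i" for x x' k c
    using alt_cong[OF that] by (simp add: side_def del: alt.simps)
  have side_ex: "\<exists>k c. side x k c" if x: "x \<in> ?X" for x
  proof (rule ccontr)
    assume *: "\<nexists>k c. side x k c"
    obtain c0 where c0: "S n c0" using some by blast
    then have "S n (\<not> c0)"
      using * alt_0[of "\<not> c0" "Suc n" z x] unfolding side_def S_def by blast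
    then have both: "S n c" for c using c0 by (cases "c = c0") auto
    have "alt ?X L c (Suc n) x k" for c k
    proof -
      have "\<not> side x k (\<not> c)" using * by blast
      then show ?thesis using both by (simp add: side_def del: alt.simps)
    qed
    \<comment> \<open>Being in the closed sets of level \<open>Suc n\<close> for both colours, x
      itself witnesses one more level for the colour that suits its membership, against the choice
      of n.\<close>
    then have "alt ?X L (x \<in> L \<longleftrightarrow> even (Suc n)) (Suc (Suc n)) x 0"
      by (intro alt_self[OF x]) (auto simp del: alt.simps)
    then show False using none alt_0 unfolding S_def by blast
  qed
  define K where "K x = (LEAST k. \<exists>c. side x k c)" for x
  define cx where "cx x = (SOME c. side x (K x) c)" for x
  have cx: "side x (K x) (cx x)" if "x \<in> ?X" for x
    unfolding cx_def K_def using side_ex[OF that] by (metis (mono_tags, lifting) LeastI someI_ex)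
  have cx_local: "cx x' = cx x" if x: "x \<in> ?X" and eq: "\<forall>i<K x. x' i = x i" for x x'
  proof -
    have "(\<exists>c. side x' k c) \<longleftrightarrow> (\<exists>c. side x k c)" if "k \<le> K x" for k
      using side_local[of k x' x] eq that by auto
    then have "K x' = K x" unfolding K_def[of x']
      using cx[OF x] K_def[of x] by (intro Least_equality) (auto, metis linorder_not_le not_less_Least nat_le_linear)
    moreover have "side x' (K x) = side x (K x)" using side_local[OF eq] by blast
    ultimately show ?thesis unfolding cx_def by simp
  qed
  define q where "q c x j = (LEAST r. \<not> alt ?X L c (Suc r) x j)" for c x j
  have q: "\<not> alt ?X L c (Suc (q c x j)) x j" for c x j
  proof -
    have "\<not> alt ?X L c (Suc (Suc n)) x j"
      using none[of c] alt_0 alt_shorter[of ?X L c "Suc (Suc n)" x j 0] unfolding S_def by blast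
    then show ?thesis unfolding q_def by (rule LeastI)
  qed
  have q_le: "q c x j \<le> r" if "\<not> alt ?X L c (Suc r) x j" for c x j r
    unfolding q_def using that by (rule Least_le)
  have q_mono: "q c x (Suc j) \<le> q c x j" for c x j
    using q[of c x j] alt_shorter[of ?X L c "Suc (q c x j)" x "Suc j" j] by (intro q_le) auto
  have q_local: "q c x' j = q c x j" if "\<forall>i<j. x' i = x i" for c x x' j
    unfolding q_def using alt_cong[OF that] by presburger
  \<comment> \<open>The first letter may need the \<open>K x\<close> first letters of x, a delay
    that continuity permits. Before that position the rank can be \<open>Suc n\<close>; the cap at n
    hides this.\<close>
  define f where "f x j = (case j of 0 \<Rightarrow> (SOME a. a \<le> 1 \<and> col a = cx x) | Suc j \<Rightarrow> min n (q (\<not> cx x) x j))" for x j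
  have f_0: "f x 0 \<le> 1 \<and> col (f x 0) = cx x" if "x \<in> ?X" for x
    using someI_ex[OF col_S[of "cx x", unfolded conj_assoc]] cx[OF that] unfolding f_def side_def by auto
  have f_Suc: "f x (Suc j) = min n (q (\<not> cx x) x j)" for x j by (simp add: f_def)
  have "cantor_continuous \<Sigma> {..Suc n} f"
    unfolding cantor_continuous_def
  proof (intro conjI ballI allI)
    show "f x \<in> omega_words {..Suc n}" if "x \<in> ?X" for x
    proof -
      have "f x j \<le> Suc n" for j using f_0[OF that] f_Suc by (cases j) auto
      then show ?thesis by (auto simp: omega_words_def)
    qed
    fix x r assume x: "x \<in> ?X"
    have "f x' i = f x i" if "\<forall>i<max (K x) r. x' i = x i" "i < r" for x' i
    proof -
      have "cx x' = cx x" by (intro cx_local[OF x]) (use that(1) in simp)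
      moreover have "q c x' j = q c x j" if "i = Suc j" for c j
        using \<open>\<forall>i<max (K x) r. x' i = x i\<close> \<open>i < r\<close> that by (intro q_local) simp
      ultimately show ?thesis by (cases i) (simp_all add: f_def)
    qed
    then show "\<exists>k. \<forall>x'\<in>?X. (\<forall>i<k. x' i = x i) \<longrightarrow> (\<forall>i<r. f x' i = f x i)" by blast
  qed
  moreover have "x \<in> L \<longleftrightarrow> f x \<in> parity_lang n col" if x: "x \<in> ?X" for x
  proof -
    let ?c = "cx x"
    have ll: "least_letter n (f x) (Suc j) = min n (q (\<not> ?c) x j)" for j
    proof (induction j)
      case (Suc j)
      then show ?case using q_mono[of "\<not> ?c" x j] by (simp add: f_Suc)
    qed (simp add: f_Suc)
    obtain k0 where k0: "\<And>j. j \<ge> k0 \<Longrightarrow> q (\<not> ?c) x j = q (\<not> ?c) x k0"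
      using antimono_nat_stabilises[of 0 "q (\<not> ?c) x"] q_mono by metis
    let ?r = "q (\<not> ?c) x k0"
    have "q (\<not> ?c) x (max k0 (K x)) \<le> n"
      using cx[OF x] alt_shorter[of ?X L "\<not> ?c" "Suc n" x "max k0 (K x)" "K x"] unfolding side_def by (intro q_le) auto
    then have rn: "?r \<le> n" using k0[of "max k0 (K x)"] by simp
    have "alt ?X L (\<not> ?c) ?r x j" for j
    proof (cases ?r)
      case 0
      then show ?thesis using x by auto
    next
      case (Suc r')
      then have "alt ?X L (\<not> ?c) (Suc r') x (max k0 j)"
        using k0[of "max k0 j"] not_less_Least[of r' "\<lambda>r. \<not> alt ?X L (\<not> ?c) (Suc r) x (max k0 j)"] unfolding q_def by auto
      then show ?thesis using Suc alt_shorter[of ?X L "\<not> ?c" "Suc r'" x "max k0 j" j] by (simp del: alt.simps)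
    qed
    then have "\<not> (x \<in> L \<longleftrightarrow> (even ?r \<longleftrightarrow> \<not> ?c))"
      using alt_self[OF x, of L "\<not> ?c" ?r k0] q by blast
    then have xL: "x \<in> L \<longleftrightarrow> (even ?r \<longleftrightarrow> ?c)" by blast
    have "\<forall>j\<ge>Suc k0. ((even (least_letter n (f x) j) \<longleftrightarrow> col (f x 0)) \<longleftrightarrow> (even ?r \<longleftrightarrow> ?c))"
    proof (intro allI impI)
      fix j assume "j \<ge> Suc k0"
      then obtain j' where "j = Suc j'" "j' \<ge> k0" by (cases j) auto
      then show "(even (least_letter n (f x) j) \<longleftrightarrow> col (f x 0)) \<longleftrightarrow> (even ?r \<longleftrightarrow> ?c)"
        using ll[of j'] k0[of j'] rn f_0[OF x] by (simp add: min_def del: least_letter.simps)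
    qed
    then have "(\<exists>\<^sub>\<infinity>j. (even (least_letter n (f x) j) \<longleftrightarrow> col (f x 0))) \<longleftrightarrow> (even ?r \<longleftrightarrow> ?c)"
      by (rule INFM_eventually_const)
    moreover have "f x \<in> omega_words {..Suc n}" using calculation(1) \<open>cantor_continuous \<Sigma> {..Suc n} f\<close> x
      unfolding cantor_continuous_def by blast
    ultimately show ?thesis using xL by (simp add: parity_lang_def)
  qed
  ultimately have "wadge_le \<Sigma> L {..Suc n} (parity_lang n col)" unfolding wadge_le_def by blast
  then show ?thesis using 1 unfolding wadge_eq_def by blast
qed

section \<open>Runs and automata\<close>

lemma block_exists:
  assumes "strict_mono P" "P 0 \<le> (n::nat)"
  obtains i where "P i \<le> n" "n < P (Suc i)"
proof -
  define j where "j = (LEAST j. n < P j)"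
  have ex: "n < P (Suc n)" using strict_mono_imp_increasing[OF assms(1), of "Suc n"] by simp
  then have j: "n < P j" unfolding j_def by (rule LeastI)
  then have "j \<noteq> 0" using assms(2) by (metis leD)
  then obtain i where i: "j = Suc i" by (cases j) auto
  then have "\<not> n < P i" using not_less_Least[of i "\<lambda>j. n < P j"] j_def by auto
  then show thesis using that[of i] i j by simp
qed

lemma block_unique:
  assumes "strict_mono P" "P i \<le> (n::nat)" "n < P (Suc i)" "P j \<le> n" "n < P (Suc j)"
  shows "i = j"
  using assms by (metis le_less_trans less_SucE linorder_less_linear not_less_eq strict_mono_less)

lemma INFM_blocks_imp:
  assumes P: "strict_mono (P :: nat \<Rightarrow> nat)"
    and Q: "\<And>i n. P i \<le> n \<Longrightarrow> n < P (Suc i) \<Longrightarrow> Q n \<Longrightarrow> g i"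
    and inf: "\<exists>\<^sub>\<infinity>n. Q n"
  shows "\<exists>\<^sub>\<infinity>i. g i"
  unfolding INFM_nat_le
proof
  fix m
  obtain n where n: "n \<ge> P m" "Q n" using inf unfolding INFM_nat_le by blast
  then have "P 0 \<le> n" using P by (meson le0 order_trans strict_mono_less_eq)
  then obtain i where i: "P i \<le> n" "n < P (Suc i)" using block_exists[OF P] by blast
  then have "m < Suc i" using n(1) P by (meson le_less_trans strict_mono_less)
  then show "\<exists>i\<ge>m. g i" using Q[OF i] n(2) by (intro exI[of _ i]) auto
qed

lemma INFM_sample:
  assumes P: "strict_mono (P :: nat \<Rightarrow> nat)" and inf: "\<exists>\<^sub>\<infinity>i. Q (P i)"
  shows "\<exists>\<^sub>\<infinity>n. Q n"
  unfolding INFM_nat_le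
  using inf strict_mono_imp_increasing[OF P] by (meson INFM_nat_le order_trans)

lemma INFM_blocks:
  assumes P: "strict_mono (P :: nat \<Rightarrow> nat)"
    and Q: "\<And>i n. P i \<le> n \<Longrightarrow> n < P (Suc i) \<Longrightarrow> Q n \<longleftrightarrow> g i"
  shows "(\<exists>\<^sub>\<infinity>n. Q n) \<longleftrightarrow> (\<exists>\<^sub>\<infinity>i. g i)"
proof
  show "\<exists>\<^sub>\<infinity>n. Q n \<Longrightarrow> \<exists>\<^sub>\<infinity>i. g i" using INFM_blocks_imp[OF P] Q by blast
  have "Q (P i) \<longleftrightarrow> g i" for i using Q[of i "P i"] P by (simp add: strict_mono_less)
  then show "\<exists>\<^sub>\<infinity>i. g i \<Longrightarrow> \<exists>\<^sub>\<infinity>n. Q n" using INFM_sample[OF P] by simp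
qed

text \<open>The relation carries absolute time because the n-th step reads the n-th letter; segments
  then compose without shifting the input.\<close>

inductive timed_path :: "(nat \<Rightarrow> 'c \<Rightarrow> 'c \<Rightarrow> bool) \<Rightarrow> nat \<Rightarrow> 'c \<Rightarrow> nat \<Rightarrow> 'c \<Rightarrow> bool" for R where
  path_refl: "timed_path R n c n c"
| path_step: "timed_path R n c m c' \<Longrightarrow> R m c' c'' \<Longrightarrow> timed_path R n c (Suc m) c''"

lemma path_trans: "timed_path R m c' l c'' \<Longrightarrow> timed_path R n c m c' \<Longrightarrow> timed_path R n c l c''"
  by (induction rule: timed_path.induct) (auto intro: timed_path.intros)

lemma path_fun:
  "timed_path R n c m c' \<Longrightarrow> n \<le> m \<and> (\<exists>f. f n = c \<and> f m = c' \<and> (\<forall>k. n \<le> k \<and> k < m \<longrightarrow> R k (f k) (f (Suc k))))"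
proof (induction rule: timed_path.induct)
  case (path_step n c m c' c'')
  then obtain f where f: "n \<le> m" "f n = c" "f m = c'" "\<forall>k. n \<le> k \<and> k < m \<longrightarrow> R k (f k) (f (Suc k))" by blast
  then show ?case using path_step.hyps(2) by (intro conjI exI[of _ "f(Suc m := c'')"]) (auto simp: less_Suc_eq)
qed auto

lemma path_loop:
  assumes "\<And>k. k < l \<Longrightarrow> R (n + k) (g k) (g (Suc k))"
  shows "timed_path R n (g 0) (n + l) (g l)"
  using assms
proof (induction l)
  case (Suc l)
  then show ?case using path_step[of R n "g 0" "n + l" "g l" "g (Suc l)"] by simp
qed (simp add: path_refl)

lemma glue_paths:
  assumes P: "strict_mono P" and init: "timed_path R 0 c0 (P 0) (C 0)"
    and seg: "\<And>i. timed_path R (P i) (C i) (P (Suc i)) (C (Suc i))"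
  obtains \<rho> where "\<rho> 0 = c0" "\<And>n. R n (\<rho> n) (\<rho> (Suc n))" "\<And>i. \<rho> (P i) = C i"
proof -
  obtain f0 where f0: "f0 0 = c0" "f0 (P 0) = C 0" "\<And>k. k < P 0 \<Longrightarrow> R k (f0 k) (f0 (Suc k))"
    using path_fun[OF init] by auto
  have "\<forall>i. \<exists>f. f (P i) = C i \<and> f (P (Suc i)) = C (Suc i) \<and> (\<forall>k. P i \<le> k \<and> k < P (Suc i) \<longrightarrow> R k (f k) (f (Suc k)))"
    using path_fun[OF seg] by blast
  then obtain f where f: "\<And>i. f i (P i) = C i" "\<And>i. f i (P (Suc i)) = C (Suc i)"
    "\<And>i k. P i \<le> k \<Longrightarrow> k < P (Suc i) \<Longrightarrow> R k (f i k) (f i (Suc k))"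
    by metis
  define \<rho> where "\<rho> n = (if n < P 0 then f0 n else f (THE i. P i \<le> n \<and> n < P (Suc i)) n)" for n
  have P0: "P 0 \<le> P i" for i using P by (simp add: strict_mono_less_eq)
  have Pi: "P i < P (Suc i)" for i using P by (simp add: strict_mono_less)
  have \<rho>: "\<rho> n = f i n" if "P i \<le> n" "n < P (Suc i)" for i n
  proof -
    have "(THE i. P i \<le> n \<and> n < P (Suc i)) = i"
      using that block_unique[OF P] by (intro the_equality) auto
    then show ?thesis using P0[of i] that by (simp add: \<rho>_def)
  qed
  have \<rho>P: "\<rho> (P i) = C i" for i using \<rho>[of i "P i"] f(1) Pi by simp
  have "R n (\<rho> n) (\<rho> (Suc n))" for n
  proof (cases "n < P 0")
    case True
    then have "\<rho> (Suc n) = f0 (Suc n)"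
      using \<rho>P[of 0] f0(2) by (cases "Suc n = P 0") (auto simp: \<rho>_def)
    then show ?thesis using f0(3) True by (simp add: \<rho>_def)
  next
    case False
    then obtain i where i: "P i \<le> n" "n < P (Suc i)" using block_exists[OF P, of n] by auto
    then have "\<rho> (Suc n) = f i (Suc n)"
      using \<rho>[of i "Suc n"] \<rho>P[of "Suc i"] f(2) by (cases "Suc n = P (Suc i)") auto
    then show ?thesis using f(3)[OF i] \<rho>[OF i] by simp
  qed
  moreover have "\<rho> 0 = c0" using f0 \<rho>P[of 0] by (cases "P 0 = 0") (auto simp: \<rho>_def)
  ultimately show thesis using that \<rho>P by blast
qed

section \<open>Automata with structured states, and closure under blindness\<close>

text \<open>Injectivity of \<open>to_nat\<close> makes runs of the encoded automaton correspond to
  runs over the structured states, with \<open>gstep\<close> in place of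
  \<open>ca_step\<close>.\<close>

definition mk_ca :: "'s::countable set \<Rightarrow> nat set \<Rightarrow> ('s \<times> nat \<times> bool list \<times> 's \<times> int list) set \<Rightarrow> 's \<Rightarrow> 's set \<Rightarrow> cautomaton" where
  "mk_ca Q \<Gamma> T s0 F = \<lparr>states = to_nat ` Q, alph = \<Gamma>,
     trans = (\<lambda>(s, a, i, s', j). (to_nat s, a, i, to_nat s', j)) ` T, init = to_nat s0, final = to_nat ` F\<rparr>"

definition gstep :: "nat \<Rightarrow> ('s \<times> nat \<times> bool list \<times> 's \<times> int list) set \<Rightarrow> 's \<times> nat list \<Rightarrow> nat \<Rightarrow> 's \<times> nat list \<Rightarrow> bool" where
  "gstep k T cf a cf' \<longleftrightarrow> (\<exists>i j. (fst cf, a, i, fst cf', j) \<in> T \<and>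
      length (snd cf) = k \<and> length (snd cf') = k \<and>
      (\<forall>m<k. (i ! m \<longleftrightarrow> snd cf ! m \<noteq> 0)) \<and>
      (\<forall>m<k. int (snd cf' ! m) = int (snd cf ! m) + j ! m))"

lemma mk_ca_simps [simp]:
  "states (mk_ca Q \<Gamma> T s0 F) = to_nat ` Q" "alph (mk_ca Q \<Gamma> T s0 F) = \<Gamma>"
  "init (mk_ca Q \<Gamma> T s0 F) = to_nat s0" "final (mk_ca Q \<Gamma> T s0 F) = to_nat ` F"
  by (simp_all add: mk_ca_def)

lemma trans_mk_ca: "(to_nat s, a, i, to_nat s', j) \<in> trans (mk_ca Q \<Gamma> T s0 F) \<longleftrightarrow> (s, a, i, s', j) \<in> T"
  by (force simp: mk_ca_def)

lemma ca_step_mk_ca: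
  "ca_step k (mk_ca Q \<Gamma> T s0 F) (to_nat s, v) a (to_nat s', v') \<longleftrightarrow> gstep k T (s, v) a (s', v')"
  unfolding ca_step_def gstep_def fst_conv snd_conv trans_mk_ca by blast

lemma ca_step_mk_caD: "ca_step k (mk_ca (Q :: 's::countable set) \<Gamma> T s0 F) cf a cf' \<Longrightarrow> \<exists>s :: 's. fst cf' = to_nat s"
  by (auto simp: ca_step_def mk_ca_def)

lemma ca_lang_mk_ca:
  fixes Q :: "'s::countable set"
  shows "ca_lang k (mk_ca Q \<Gamma> T s0 F) = {w \<in> omega_words \<Gamma>. \<exists>\<rho>. \<rho> 0 = (s0, replicate k 0) \<and>
     (\<forall>n. gstep k T (\<rho> n) (w n) (\<rho> (Suc n))) \<and> (\<exists>\<^sub>\<infinity>n. fst (\<rho> n) \<in> F)}" (is "?A = ?B")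
proof
  let ?M = "mk_ca Q \<Gamma> T s0 F"
  show "?B \<subseteq> ?A"
  proof
    fix w assume "w \<in> ?B"
    then obtain \<rho> where w: "w \<in> omega_words \<Gamma>" and \<rho>: "\<rho> 0 = (s0, replicate k 0)"
      "\<forall>n. gstep k T (\<rho> n) (w n) (\<rho> (Suc n))" "\<exists>\<^sub>\<infinity>n. fst (\<rho> n) \<in> F" by blast
    have "ca_run k ?M w (\<lambda>n. (to_nat (fst (\<rho> n)), snd (\<rho> n)))"
      using \<rho> by (auto simp: ca_run_def ca_step_mk_ca)
    moreover have "\<exists>\<^sub>\<infinity>n. to_nat (fst (\<rho> n)) \<in> to_nat ` F"
      using \<rho>(3) by (simp add: inj_image_mem_iff)
    ultimately show "w \<in> ?A" using w unfolding ca_lang_def by fastforce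
  qed
  show "?A \<subseteq> ?B"
  proof
    fix w assume "w \<in> ?A"
    then obtain \<rho> where w: "w \<in> omega_words \<Gamma>" and \<rho>: "ca_run k ?M w \<rho>"
      "\<exists>\<^sub>\<infinity>n. fst (\<rho> n) \<in> to_nat ` F" by (auto simp: ca_lang_def)
    have "\<exists>s :: 's. fst (\<rho> n) = to_nat s" for n
      using \<rho>(1) ca_step_mk_caD[of k Q \<Gamma> T s0 F "\<rho> (n - 1)" "w (n - 1)" "\<rho> n"]
      by (cases n) (auto simp: ca_run_def)
    then obtain s :: "nat \<Rightarrow> 's" where s: "\<And>n. fst (\<rho> n) = to_nat (s n)" by metis
    then have \<rho>_eq: "\<rho> n = (to_nat (s n), snd (\<rho> n))" for n by (metis prod.collapse)
    have "gstep k T (s n, snd (\<rho> n)) (w n) (s (Suc n), snd (\<rho> (Suc n)))" for n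
    proof -
      have "ca_step k ?M (\<rho> n) (w n) (\<rho> (Suc n))" using \<rho>(1) unfolding ca_run_def by blast
      then have "ca_step k ?M (to_nat (s n), snd (\<rho> n)) (w n) (to_nat (s (Suc n)), snd (\<rho> (Suc n)))"
        by (simp flip: s)
      then show ?thesis unfolding ca_step_mk_ca .
    qed
    moreover have "s 0 = s0 \<and> snd (\<rho> 0) = replicate k 0"
      using \<rho>(1) s[of 0] by (simp add: ca_run_def)
    moreover have "\<exists>\<^sub>\<infinity>n. s n \<in> F" using \<rho>(2) by (simp add: s inj_image_mem_iff)
    ultimately show "w \<in> ?B" using w
      by (auto intro!: exI[of _ "\<lambda>n. (s n, snd (\<rho> n))"])
  qed
qed

lemma valid_mk_ca:
  assumes "finite Q" "finite \<Gamma>" "s0 \<in> Q" "F \<subseteq> Q"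
    and "\<And>s a i s' j. (s, a, i, s', j) \<in> T \<Longrightarrow> s \<in> Q \<and> a \<in> \<Gamma> \<and> length i = k \<and> s' \<in> Q \<and> length j = k \<and>
       set j \<subseteq> {-1, 0, 1} \<and> (\<forall>m<k. j ! m = -1 \<longrightarrow> i ! m)"
  shows "valid_ca k (mk_ca Q \<Gamma> T s0 F)"
  unfolding valid_ca_def
proof (intro conjI ballI)
  fix t assume "t \<in> trans (mk_ca Q \<Gamma> T s0 F)"
  then obtain s a i s' j where t: "t = (to_nat s, a, i, to_nat s', j)" "(s, a, i, s', j) \<in> T"
    by (auto simp: mk_ca_def)
  show "case t of (q, a, i, q', j) \<Rightarrow> q \<in> states (mk_ca Q \<Gamma> T s0 F) \<and> a \<in> alph (mk_ca Q \<Gamma> T s0 F) \<and> length i = k \<and>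
        q' \<in> states (mk_ca Q \<Gamma> T s0 F) \<and> length j = k \<and> set j \<subseteq> {-1, 0, 1} \<and>
        (\<forall>m<k. \<not> (i ! m = False \<and> j ! m = -1))"
    using assms(5)[OF t(2)] unfolding t(1) by auto
qed (use assms in auto)

definition blind_closure :: "nat \<Rightarrow> ('s \<times> nat \<times> bool list \<times> 's \<times> int list) set \<Rightarrow> ('s \<times> nat \<times> bool list \<times> 's \<times> int list) set" where
  "blind_closure k T = {(s, a, i, s', j). length i = k \<and> length j = k \<and>
      (\<exists>r. (s, a, r, s', j) \<in> T \<and> (\<forall>m<k. r ! m \<or> j ! m = -1 \<longrightarrow> i ! m))}"

lemma blind_mk_ca: "blind_ca k (mk_ca Q \<Gamma> (blind_closure k T) s0 F)"
  unfolding blind_ca_def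
proof
  fix t assume "t \<in> trans (mk_ca Q \<Gamma> (blind_closure k T) s0 F)"
  then obtain s a i s' j where t: "t = (to_nat s, a, i, to_nat s', j)" "(s, a, i, s', j) \<in> blind_closure k T"
    by (auto simp: mk_ca_def)
  then have "(s, a, i[m := True], s', j) \<in> blind_closure k T" if "m < k" for m
    using that by (fastforce simp: blind_closure_def nth_list_update)
  then show "case t of (q, a, i, q', j) \<Rightarrow> \<forall>m<k. i ! m = False \<longrightarrow> (q, a, i[m := True], q', j) \<in> trans (mk_ca Q \<Gamma> (blind_closure k T) s0 F)"
    using t(1) trans_mk_ca by fastforce
qed

text \<open>The test at decremented counters disappears, since a decrement that ends in a natural
  number already starts from a nonzero one.\<close>

lemma gstep_blind_closure:
  "gstep k (blind_closure k T) (s, v) a (s', v') \<longleftrightarrow> length v = k \<and> length v' = k \<and>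
     (\<exists>r j. (s, a, r, s', j) \<in> T \<and> length j = k \<and>
       (\<forall>m<k. (r ! m \<longrightarrow> v ! m \<noteq> 0) \<and> int (v' ! m) = int (v ! m) + j ! m))" (is "?A \<longleftrightarrow> ?B")
proof
  assume ?A
  then obtain i j where ij: "(s, a, i, s', j) \<in> blind_closure k T" "length v = k" "length v' = k"
    "\<forall>m<k. (i ! m \<longleftrightarrow> v ! m \<noteq> 0)" "\<forall>m<k. int (v' ! m) = int (v ! m) + j ! m"
    unfolding gstep_def by auto
  then obtain r where "length j = k" "(s, a, r, s', j) \<in> T" "\<forall>m<k. r ! m \<or> j ! m = -1 \<longrightarrow> i ! m"
    unfolding blind_closure_def by auto
  then show ?B using ij by blast
next
  assume ?B
  then obtain r j where *: "length v = k" "length v' = k" "(s, a, r, s', j) \<in> T" "length j = k"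
    "\<forall>m<k. (r ! m \<longrightarrow> v ! m \<noteq> 0) \<and> int (v' ! m) = int (v ! m) + j ! m" by blast
  have "v ! m \<noteq> 0" if "m < k" "j ! m = -1" for m
    using *(5)[rule_format, OF that(1)] that(2) by linarith
  then have "(s, a, map (\<lambda>c. c \<noteq> 0) v, s', j) \<in> blind_closure k T"
    using * by (auto simp: blind_closure_def)
  then show ?A using * unfolding gstep_def by (intro exI[of _ "map (\<lambda>c. c \<noteq> 0) v"] exI[of _ j]) auto
qed

text \<open>Both constructions enter such a sink once a violation of the code has been
  found.\<close>

lemma accepted_via_sink:
  assumes "timed_path (\<lambda>n c c'. gstep k T c (w n) c') 0 (s0, replicate k 0) n (s, v)"
    and "\<And>m. gstep k T (s, v) (w m) (s, v)" and "s \<in> F" and "w \<in> omega_words \<Gamma>"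
  shows "w \<in> ca_lang k (mk_ca Q \<Gamma> T s0 F)"
proof -
  let ?R = "\<lambda>n c c'. gstep k T c (w n) c'"
  obtain \<rho> where "\<rho> 0 = (s0, replicate k 0)" "\<And>n. ?R n (\<rho> n) (\<rho> (Suc n))" "\<And>i. \<rho> (n + i) = (s, v)"
  proof (rule glue_paths[of "\<lambda>i. n + i" ?R "(s0, replicate k 0)" "\<lambda>_. (s, v)"])
    show "timed_path ?R (n + i) (s, v) (n + Suc i) (s, v)" for i
      using path_step[OF path_refl[of ?R "n + i" "(s, v)"]] assms(2) by simp
  qed (use assms in \<open>auto simp: strict_mono_def\<close>)
  moreover from this have "\<exists>\<^sub>\<infinity>n. fst (\<rho> n) \<in> F"
    unfolding INFM_nat_le using assms(3) by (metis fst_conv le_add2)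
  ultimately show ?thesis using assms(4) unfolding ca_lang_mk_ca by blast
qed

section \<open>Automata for the parity languages\<close>

text \<open>The k counters stay at 0 and are never tested, so the same automaton serves as a
  one-counter automaton and as a blind one.\<close>

definition parity_ca :: "nat \<Rightarrow> nat \<Rightarrow> (nat \<Rightarrow> bool) \<Rightarrow> cautomaton" where
  "parity_ca k n col = mk_ca (insert None (Some ` (UNIV \<times> {..n}))) {..Suc n}
     (blind_closure k {(s, a, r, s', j). s \<in> insert None (Some ` (UNIV \<times> {..n})) \<and> a \<le> Suc n \<and>
        r = replicate k False \<and> j = replicate k 0 \<and>
        s' = Some (case s of None \<Rightarrow> (col a, n) | Some (c, p) \<Rightarrow> (c, min p a))})
     None {Some (c, p) |c p. p \<le> n \<and> (even p \<longleftrightarrow> c)}"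

lemma valid_parity_ca: "valid_ca k (parity_ca k n col)"
  unfolding parity_ca_def
  by (rule valid_mk_ca) (auto simp: blind_closure_def split: option.splits)

lemma ca_lang_parity_ca: "ca_lang k (parity_ca k n col) = parity_lang n col"
proof -
  define \<Gamma> where "\<Gamma> = {..Suc n}"
  define Q where "Q = insert None (Some ` ((UNIV :: bool set) \<times> {..n}))"
  define \<delta> where "\<delta> s a = Some (case s of None \<Rightarrow> (col a, n) | Some (c, p) \<Rightarrow> (c, min p a))" for s a
  define T where "T = {(s, a, r, s', j). s \<in> Q \<and> a \<le> Suc n \<and>
        r = replicate k False \<and> j = replicate k (0::int) \<and> s' = \<delta> s a}"
  define F where "F = {Some (c, p) |c p. p \<le> n \<and> (even p \<longleftrightarrow> c)}"
  have M: "parity_ca k n col = mk_ca Q \<Gamma> (blind_closure k T) None F"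
    by (simp add: parity_ca_def \<Gamma>_def Q_def \<delta>_def T_def F_def)
  have step: "gstep k (blind_closure k T) (s, v) a (s', v') \<longleftrightarrow>
      s \<in> Q \<and> a \<le> Suc n \<and> s' = \<delta> s a \<and> length v = k \<and> v' = v" for s v a s' v'
    unfolding gstep_blind_closure by (auto simp: T_def intro: nth_equalityI)
  define st where "st w i = (case i of 0 \<Rightarrow> None | Suc i \<Rightarrow> Some (col (w 0), least_letter n w i))" for w i
  have st_Suc: "st w (Suc i) = \<delta> (st w i) (w i)" for w i
    by (cases i) (simp_all add: st_def \<delta>_def)
  have st_Q: "st w i \<in> Q" for w i
    using least_letter_le by (auto simp: st_def Q_def split: nat.splits)
  \<comment> \<open>The state at time \<open>Suc i\<close> stores the minimum up to letter i;
    \<open>INFM_blocks\<close> with \<open>Suc\<close> removes this shift by one.\<close>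
  have fin: "(\<exists>\<^sub>\<infinity>i. st w i \<in> F) \<longleftrightarrow> (\<exists>\<^sub>\<infinity>i. (even (least_letter n w i) \<longleftrightarrow> col (w 0)))" for w
    by (rule INFM_blocks[where P = Suc, symmetric, THEN trans[OF _ INFM_blocks[where P = "\<lambda>i. i"]], THEN sym])
       (auto simp: st_def F_def strict_mono_def least_letter_le less_Suc_eq_le)
  have "(\<exists>\<rho>. \<rho> 0 = (None, replicate k 0) \<and> (\<forall>i. gstep k (blind_closure k T) (\<rho> i) (w i) (\<rho> (Suc i))) \<and>
      (\<exists>\<^sub>\<infinity>i. fst (\<rho> i) \<in> F)) \<longleftrightarrow> (\<exists>\<^sub>\<infinity>i. st w i \<in> F)" (is "?A \<longleftrightarrow> ?B") if "w \<in> omega_words \<Gamma>" for w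
  proof
    assume ?A
    then obtain \<rho> where \<rho>: "\<rho> 0 = (None, replicate k 0)" "\<And>i. gstep k (blind_closure k T) (\<rho> i) (w i) (\<rho> (Suc i))"
      "\<exists>\<^sub>\<infinity>i. fst (\<rho> i) \<in> F" by blast
    have "fst (\<rho> i) = st w i" for i
    proof (induction i)
      case (Suc i)
      then show ?case using \<rho>(2)[of i] step st_Suc by (metis prod.collapse)
    qed (simp add: \<rho> st_def)
    then show ?B using \<rho>(3) by simp
  next
    assume ?B
    then show ?A using that st_Q
      by (intro exI[of _ "\<lambda>i. (st w i, replicate k 0)"]) (auto simp: step st_Suc omega_words_def \<Gamma>_def, auto simp: st_def)
  qed
  then show ?thesis unfolding M ca_lang_mk_ca parity_lang_def fin by (auto simp: \<Gamma>_def)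
qed

lemma alph_parity_ca: "alph (parity_ca k n col) = {..Suc n}"
  by (simp add: parity_ca_def)

lemma blind_parity_ca: "blind_ca k (parity_ca k n col)"
  unfolding parity_ca_def by (rule blind_mk_ca)

lemma rCL1_parity_lang: "rCL1 {..Suc n} (parity_lang n col)"
  unfolding rCL1_def using valid_parity_ca ca_lang_parity_ca alph_parity_ca by blast

lemma rBCL4_parity_lang: "rBCL4 {..Suc n} (parity_lang n col)"
  unfolding rBCL4_def using valid_parity_ca blind_parity_ca ca_lang_parity_ca alph_parity_ca by blast

section \<open>From one counter to four blind counters\<close>

datatype bstate = BInit | BScan | BCnt | BCmp | BAcc | BBlk nat bool bool

instance bstate :: countable by countable_datatype

text \<open>The active pair comes first among the arguments, and p tells whether it is stored in the
  last two places. Exchanging the roles of the pairs amounts to negating p.\<close>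

definition pairs :: "bool \<Rightarrow> 'a \<Rightarrow> 'a \<Rightarrow> 'a \<Rightarrow> 'a \<Rightarrow> 'a list" where
  "pairs p a b a' b' = (if p then [a', b', a, b] else [a, b, a', b'])"

lemma length_pairs [simp]: "length (pairs p a b a' b') = 4"
  by (simp add: pairs_def)

lemma pairs_eq_iff [simp]: "pairs p a b a' b' = pairs p c d c' d' \<longleftrightarrow> a = c \<and> b = d \<and> a' = c' \<and> b' = d'"
  by (auto simp: pairs_def)

lemma pairs_Not: "pairs (\<not> p) a b a' b' = pairs p a' b' a b"
  by (simp add: pairs_def)

lemma replicate_4_pairs: "replicate 4 a = pairs p a a a a"
  by (simp add: pairs_def numeral_eq_Suc)

lemma set_pairs [simp]: "set (pairs p a b a' b') = {a, b, a', b'}"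
  by (auto simp: pairs_def)

lemma pairs_cases:
  assumes "length v = 4" obtains a b a' b' where "v = pairs p a b a' b'"
proof -
  have "v = [v ! 0, v ! 1, v ! 2, v ! 3]"
    by (rule nth_equalityI) (use assms in \<open>auto simp: less_Suc_eq numeral_eq_Suc\<close>)
  then show thesis
    using that[of "v ! 2" "v ! 3" "v ! 0" "v ! 1"] that[of "v ! 0" "v ! 1" "v ! 2" "v ! 3"]
    by (cases p) (simp_all add: pairs_def)
qed

lemma all_less_4: "(\<forall>m<4. P m) \<longleftrightarrow> P 0 \<and> P (Suc 0) \<and> P 2 \<and> P (3::nat)"
  by (auto simp: numeral_eq_Suc less_Suc_eq)

lemma gstep_pairs:
  "gstep 4 (blind_closure 4 T) (s, pairs p a b a' b') l (s', v') \<longleftrightarrow>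
     (\<exists>r r1 r2 r3 j j1 j2 j3 c d c' d'. (s, l, pairs p r r1 r2 r3, s', pairs p j j1 j2 j3) \<in> T \<and>
       v' = pairs p c d c' d' \<and> (r \<longrightarrow> a \<noteq> 0) \<and> (r1 \<longrightarrow> b \<noteq> 0) \<and> (r2 \<longrightarrow> a' \<noteq> 0) \<and> (r3 \<longrightarrow> b' \<noteq> 0) \<and>
       int c = int a + j \<and> int d = int b + j1 \<and> int c' = int a' + j2 \<and> int d' = int b' + j3)"
  if T: "\<And>s l r s' j. (s, l, r, s', j) \<in> T \<Longrightarrow> length r = 4"
proof
  assume "gstep 4 (blind_closure 4 T) (s, pairs p a b a' b') l (s', v')"
  then obtain r j where *: "length v' = 4" "(s, l, r, s', j) \<in> T" "length j = 4"
    "\<forall>m<4. (r ! m \<longrightarrow> pairs p a b a' b' ! m \<noteq> 0) \<and> int (v' ! m) = int (pairs p a b a' b' ! m) + j ! m"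
    by (auto simp: gstep_blind_closure)
  obtain c d c' d' where v': "v' = pairs p c d c' d'" using *(1) pairs_cases by blast
  obtain r0 r1 r2 r3 where r: "r = pairs p r0 r1 r2 r3" using T[OF *(2)] pairs_cases by blast
  obtain j0 j1 j2 j3 where j: "j = pairs p j0 j1 j2 j3" using *(3) pairs_cases by blast
  show "\<exists>r r1 r2 r3 j j1 j2 j3 c d c' d'. (s, l, pairs p r r1 r2 r3, s', pairs p j j1 j2 j3) \<in> T \<and>
       v' = pairs p c d c' d' \<and> (r \<longrightarrow> a \<noteq> 0) \<and> (r1 \<longrightarrow> b \<noteq> 0) \<and> (r2 \<longrightarrow> a' \<noteq> 0) \<and> (r3 \<longrightarrow> b' \<noteq> 0) \<and>
       int c = int a + j \<and> int d = int b + j1 \<and> int c' = int a' + j2 \<and> int d' = int b' + j3"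
    apply (rule exI[of _ r0], rule exI[of _ r1], rule exI[of _ r2], rule exI[of _ r3])
    apply (rule exI[of _ j0], rule exI[of _ j1], rule exI[of _ j2], rule exI[of _ j3])
    apply (rule exI[of _ c], rule exI[of _ d], rule exI[of _ c'], rule exI[of _ d'])
    using *(2,4) unfolding v' r j by (cases p) (auto simp: all_less_4 pairs_def)
next
  assume "\<exists>r r1 r2 r3 j j1 j2 j3 c d c' d'. (s, l, pairs p r r1 r2 r3, s', pairs p j j1 j2 j3) \<in> T \<and>
       v' = pairs p c d c' d' \<and> (r \<longrightarrow> a \<noteq> 0) \<and> (r1 \<longrightarrow> b \<noteq> 0) \<and> (r2 \<longrightarrow> a' \<noteq> 0) \<and> (r3 \<longrightarrow> b' \<noteq> 0) \<and>
       int c = int a + j \<and> int d = int b + j1 \<and> int c' = int a' + j2 \<and> int d' = int b' + j3"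
  then obtain r r1 r2 r3 j j1 j2 j3 c d c' d' where *: "(s, l, pairs p r r1 r2 r3, s', pairs p j j1 j2 j3) \<in> T"
     "v' = pairs p c d c' d'" "r \<longrightarrow> a \<noteq> 0" "r1 \<longrightarrow> b \<noteq> 0" "r2 \<longrightarrow> a' \<noteq> 0" "r3 \<longrightarrow> b' \<noteq> 0"
     "int c = int a + j" "int d = int b + j1" "int c' = int a' + j2" "int d' = int b' + j3" by blast
  show "gstep 4 (blind_closure 4 T) (s, pairs p a b a' b') l (s', v')"
    unfolding gstep_blind_closure
    apply (intro conjI exI[of _ "pairs p r r1 r2 r3"] exI[of _ "pairs p j j1 j2 j3"])
    using * by (cases p; simp add: all_less_4 pairs_def)+
qed

locale counter_to_blind =
  fixes M :: cautomaton and z :: nat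
  assumes valid: "valid_ca 1 M" and z: "z \<notin> alph M"
begin

definition \<Gamma> :: "nat set" where "\<Gamma> = insert z (alph M)"

text \<open>\<open>BInit\<close> counts as the end of an empty block, so the first letter needs no
  rule of its own.\<close>

definition base :: "bstate \<Rightarrow> nat \<Rightarrow> bool \<Rightarrow> bool" where
  "base s q p \<longleftrightarrow> s = BInit \<and> q = init M \<and> \<not> p \<or> (\<exists>i. s = BBlk q p i)"

text \<open>The simulated counter is the first component of the active pair, whose sum is known to be
  the length of the next block of z's. Reading that block moves the active pair to the other one;
  this succeeds only for blocks which are not too long. In a block after a zero test, only the
  second component may be moved, so that the first one has to be zero. The
  other states look for a block which is too short.\<close>

inductive brule :: "bstate \<Rightarrow> nat \<Rightarrow> bool list \<Rightarrow> bstate \<Rightarrow> int list \<Rightarrow> bool" where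
  scan: "s \<in> {BInit, BScan} \<Longrightarrow> a \<in> \<Gamma> \<Longrightarrow> brule s a (pairs False False False False False) BScan (pairs False 0 0 0 0)"
| cnt: "s \<in> {BInit, BScan} \<Longrightarrow> a \<in> alph M \<Longrightarrow> brule s a (pairs False False False False False) BCnt (pairs False 0 0 0 0)"
| cntz: "brule BCnt z (pairs False False False False False) BCnt (pairs False 1 0 0 0)"
| cmp: "a \<in> alph M \<Longrightarrow> brule BCnt a (pairs False False False False False) BCmp (pairs False 0 0 0 0)"
| cmpz: "brule BCmp z (pairs False False False False False) BCmp (pairs False (-1) 0 0 0)"
| acc: "s = BCmp \<and> a \<in> alph M \<or> s = BAcc \<and> a \<in> \<Gamma> \<Longrightarrow> brule s a (pairs False False False False False) BAcc (pairs False 0 0 0 0)"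
| letter: "base s q p \<Longrightarrow> (q, a, [i], q', [j]) \<in> trans M \<Longrightarrow>
    brule s a (pairs (\<not> p) i False False False) (BBlk q' (\<not> p) i)
     (pairs (\<not> p) (if j = -1 then -1 else 0) (if j = -1 then 1 else 0) (if j = 1 then 1 else 0) (if j = 1 then 0 else 1))"
| moveb: "q \<in> states M \<Longrightarrow> brule (BBlk q p i) z (pairs p False False False False) (BBlk q p i) (pairs p 0 (-1) 0 1)"
| movea: "q \<in> states M \<Longrightarrow> brule (BBlk q p True) z (pairs p False False False False) (BBlk q p True) (pairs p (-1) 0 1 0)"

definition Q :: "bstate set" where
  "Q = {BInit, BScan, BCnt, BCmp, BAcc} \<union> {BBlk q p i |q p i. q \<in> states M}"

definition F :: "bstate set" where
  "F = insert BAcc {BBlk q p i |q p i. q \<in> final M}"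

definition T :: "(bstate \<times> nat \<times> bool list \<times> bstate \<times> int list) set" where
  "T = {(s, a, r, s', j). brule s a r s' j}"

definition B :: cautomaton where
  "B = mk_ca Q \<Gamma> (blind_closure 4 T) BInit F"

abbreviation step :: "bstate \<times> nat list \<Rightarrow> nat \<Rightarrow> bstate \<times> nat list \<Rightarrow> bool" where
  "step \<equiv> gstep 4 (blind_closure 4 T)"

lemma transD:
  assumes "(q, a, i, q', j) \<in> trans M"
  shows "q \<in> states M" "a \<in> alph M" "a \<in> \<Gamma>" "a \<noteq> z" "q' \<in> states M"
    "\<exists>i'. i = [i']" "\<exists>j'. j = [j'] \<and> j' \<in> {-1, 0, 1} \<and> (j' = -1 \<longrightarrow> i = [True])"
proof -
  have "case (q, a, i, q', j) of (q, a, i, q', j) \<Rightarrow> q \<in> states M \<and> a \<in> alph M \<and> length i = 1 \<and>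
       q' \<in> states M \<and> length j = 1 \<and> set j \<subseteq> {-1, 0, 1} \<and>
        (\<forall>m<1. \<not> (i ! m = False \<and> j ! m = -1))"
    using valid unfolding valid_ca_def by (elim conjE) (drule bspec[OF _ assms])
  then show "q \<in> states M" "a \<in> alph M" "a \<in> \<Gamma>" "a \<noteq> z" "q' \<in> states M"
    "\<exists>i'. i = [i']" "\<exists>j'. j = [j'] \<and> j' \<in> {-1, 0, 1} \<and> (j' = -1 \<longrightarrow> i = [True])"
    using z by (auto simp: \<Gamma>_def length_Suc_conv)
qed

lemma init_in: "init M \<in> states M" and fin: "finite (states M)" "finite (alph M)" "final M \<subseteq> states M"
  using valid by (auto simp: valid_ca_def)

lemma brule_length: "brule s a r s' j \<Longrightarrow> length r = 4"
  by (induction rule: brule.induct) simp_all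

lemma brule_valid: "brule s a r s' j \<Longrightarrow> s \<in> Q \<and> a \<in> \<Gamma> \<and> s' \<in> Q \<and> set j \<subseteq> {-1, 0, 1}"
  by (induction rule: brule.induct) (auto simp: Q_def \<Gamma>_def base_def dest: transD)

lemma rBCL4_B: "rBCL4 \<Gamma> (ca_lang 4 B)"
proof -
  have "Q = {BInit, BScan, BCnt, BCmp, BAcc} \<union> (\<lambda>(q, p, i). BBlk q p i) ` (states M \<times> UNIV)"
    by (auto simp: Q_def image_def)
  then have "finite Q" using fin(1) by (auto intro!: finite_imageI finite_cartesian_product)
  then have "valid_ca 4 B"
    unfolding B_def
  proof (rule valid_mk_ca)
    fix s a i s' j assume "(s, a, i, s', j) \<in> blind_closure 4 T"
    then obtain r where *: "length i = 4" "length j = 4" "brule s a r s' j" "\<forall>m<4. r ! m \<or> j ! m = -1 \<longrightarrow> i ! m"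
      by (auto simp: blind_closure_def T_def)
    show "s \<in> Q \<and> a \<in> \<Gamma> \<and> length i = 4 \<and> s' \<in> Q \<and> length j = 4 \<and>
       set j \<subseteq> {-1, 0, 1} \<and> (\<forall>m<4. j ! m = -1 \<longrightarrow> i ! m)"
      using * brule_valid[OF *(3)] by simp
  qed (use fin in \<open>auto simp: Q_def F_def \<Gamma>_def\<close>)
  then show ?thesis unfolding rBCL4_def using blind_mk_ca by (intro exI[of _ B]) (simp add: B_def)
qed

lemma step_pairs:
  "step (s, pairs p a b a' b') l (s', v') \<longleftrightarrow>
     (\<exists>r r1 r2 r3 j j1 j2 j3 c d c' d'. brule s l (pairs p r r1 r2 r3) s' (pairs p j j1 j2 j3) \<and>
       v' = pairs p c d c' d' \<and> (r \<longrightarrow> a \<noteq> 0) \<and> (r1 \<longrightarrow> b \<noteq> 0) \<and> (r2 \<longrightarrow> a' \<noteq> 0) \<and> (r3 \<longrightarrow> b' \<noteq> 0) \<and>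
       int c = int a + j \<and> int d = int b + j1 \<and> int c' = int a' + j2 \<and> int d' = int b' + j3)"
  using gstep_pairs[of T] brule_length by (simp add: T_def)

lemma stepI:
  assumes "brule s l (pairs p r r1 r2 r3) s' (pairs p j j1 j2 j3)"
    "(r \<longrightarrow> a \<noteq> 0) \<and> (r1 \<longrightarrow> b \<noteq> 0) \<and> (r2 \<longrightarrow> a' \<noteq> 0) \<and> (r3 \<longrightarrow> b' \<noteq> 0)"
    "int c = int a + j" "int d = int b + j1" "int c' = int a' + j2" "int d' = int b' + j3"
  shows "step (s, pairs p a b a' b') l (s', pairs p c d c' d')"
  using assms unfolding step_pairs by blast

section \<open>Detection of short blocks\<close>

text \<open>A block is compared only with its predecessor, which is enough: the token count bounds
  the block after the i-th letter (from 0) by i, and if each block is longer than the one before,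
  its length is exactly i. Detection needs one counter that stays nonnegative, hence no zero
  test.\<close>

definition short :: "(nat \<Rightarrow> nat) \<Rightarrow> bool" where
  "short y \<longleftrightarrow> (\<exists>s t r. s < t \<and> t < r \<and> y s \<in> alph M \<and> y t \<in> alph M \<and> y r \<in> alph M \<and>
     (\<forall>n. s < n \<and> n < r \<and> n \<noteq> t \<longrightarrow> y n \<notin> alph M) \<and> r - t \<le> t - s)"

lemma short_accepted:
  assumes y: "y \<in> omega_words \<Gamma>" and "short y"
  shows "y \<in> ca_lang 4 B"
proof -
  obtain s t r where str: "s < t" "t < r" "y s \<in> alph M" "y t \<in> alph M" "y r \<in> alph M"
     "\<forall>n. s < n \<and> n < r \<and> n \<noteq> t \<longrightarrow> y n \<notin> alph M" "r - t \<le> t - s"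
    using \<open>short y\<close> unfolding short_def by blast
  have y\<Gamma>: "y n \<in> \<Gamma>" for n using y by (simp add: omega_words_def)
  have yz: "y n = z" if "s < n" "n < r" "n \<noteq> t" for n
    using str(6) y\<Gamma>[of n] that by (auto simp: \<Gamma>_def)
  let ?R = "\<lambda>n c c'. step c (y n) c'"
  let ?v = "\<lambda>c. pairs False c 0 0 (0::nat)"
  define s0 where "s0 n = (if n = 0 then BInit else BScan)" for n :: nat
  have 1: "timed_path ?R 0 (BInit, ?v 0) s (s0 s, ?v 0)"
    using path_loop[of s ?R 0 "\<lambda>n. (s0 n, ?v 0)"] stepI[OF scan] y\<Gamma> by (simp add: s0_def)
  have 2: "timed_path ?R s (s0 s, ?v 0) (Suc s) (BCnt, ?v 0)"
    by (rule path_step[OF path_refl]) (rule stepI[OF cnt], use str in \<open>auto simp: s0_def\<close>)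
  have 3: "timed_path ?R (Suc s) (BCnt, ?v 0) t (BCnt, ?v (t - Suc s))"
    using path_loop[of "t - Suc s" ?R "Suc s" "\<lambda>k. (BCnt, ?v k)"] stepI[OF cntz] yz str(1,2) by simp
  have 4: "timed_path ?R t (BCnt, ?v (t - Suc s)) (Suc t) (BCmp, ?v (t - Suc s))"
    by (rule path_step[OF path_refl]) (rule stepI[OF cmp], use str in auto)
  \<comment> \<open>The counter holds the surplus of the first block over what has been read of the
    second. The second block is not longer, so every decrement is possible.\<close>
  have 5: "timed_path ?R (Suc t) (BCmp, ?v (t - Suc s)) r (BCmp, ?v (t - Suc s - (r - Suc t)))"
  proof -
    have "timed_path ?R (Suc t) (BCmp, ?v (t - Suc s - 0)) (Suc t + (r - Suc t)) (BCmp, ?v (t - Suc s - (r - Suc t)))"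
    proof (rule path_loop)
      fix k assume k: "k < r - Suc t"
      then have "y (Suc t + k) = z" using yz str(1) by simp
      then show "step (BCmp, ?v (t - Suc s - k)) (y (Suc t + k)) (BCmp, ?v (t - Suc s - Suc k))"
        using str(7) k stepI[OF cmpz] by auto
    qed
    then show ?thesis using str(2) by simp
  qed
  have 6: "timed_path ?R r (BCmp, ?v (t - Suc s - (r - Suc t))) (Suc r) (BAcc, ?v (t - Suc s - (r - Suc t)))"
    by (rule path_step[OF path_refl]) (rule stepI[OF acc], use str in auto)
  have "timed_path ?R 0 (BInit, replicate 4 0) (Suc r) (BAcc, ?v (t - Suc s - (r - Suc t)))"
    using path_trans[OF 6 path_trans[OF 5 path_trans[OF 4 path_trans[OF 3 path_trans[OF 2 1]]]]]
    by (simp add: replicate_4_pairs[of _ False])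
  then show ?thesis unfolding B_def
  proof (rule accepted_via_sink)
    show "step (BAcc, ?v c) (y m) (BAcc, ?v c)" for c m
      by (rule stepI[OF acc]) (use y\<Gamma> in auto)
  qed (use y in \<open>auto simp: F_def\<close>)
qed

text \<open>A decrement shifts a token from the first to the second component of the active pair, so
  its sum stays equal to the length of the coming block. The letter itself puts one token into the
  passive pair, in its first component exactly for an increment; hence the sum available for the
  next block is larger by one.\<close>

lemma step_letterI:
  assumes "base s q p" "(q, x, [i], q', [j]) \<in> trans M" "i \<longrightarrow> c \<noteq> 0" "j = -1 \<longrightarrow> c \<noteq> 0"
  shows "step (s, pairs (\<not> p) c b 0 0) x (BBlk q' (\<not> p) i, pairs (\<not> p) (if j = -1 then c - 1 else c)
    (if j = -1 then b + 1 else b) (if j = 1 then 1 else 0) (if j = 1 then 0 else 1))"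
  by (rule stepI[OF letter[OF assms(1,2)]]) (use assms(3,4) in auto)

lemma step_letterD:
  assumes "step (s, pairs (\<not> p) c b 0 0) x (BBlk q' p' i, v')" "base s q p" "x \<in> alph M"
  obtains j where "(q, x, [i], q', [j]) \<in> trans M" "p' = (\<not> p)" "i \<longrightarrow> c \<noteq> 0"
    "v' = pairs (\<not> p) (if j = -1 then c - 1 else c)
      (if j = -1 then b + 1 else b) (if j = 1 then 1 else 0) (if j = 1 then 0 else 1)"
proof -
  obtain r r1 r2 r3 j j1 j2 j3 d e d' e' where
    *: "brule s x (pairs (\<not> p) r r1 r2 r3) (BBlk q' p' i) (pairs (\<not> p) j j1 j2 j3)"
      "v' = pairs (\<not> p) d e d' e'" "r \<longrightarrow> c \<noteq> 0"
      "int d = int c + j" "int e = int b + j1" "int d' = int 0 + j2" "int e' = int 0 + j3"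
    using assms(1) unfolding step_pairs by blast
  from *(1) show thesis
  proof (cases rule: brule.cases)
    case (letter q2 p2 j')
    then have "q2 = q" "p2 = p" using assms(2) by (auto simp: base_def)
    then show thesis using letter *(2-) by (intro that[of j']) (auto split: if_splits)
  qed (use assms(3) z in auto)
qed

lemma step_z:
  assumes "step (BBlk q p i, pairs p a b a' b') z (s', v')"
  shows "s' = BBlk q p i \<and> (b > 0 \<and> v' = pairs p a (b - 1) a' (b' + 1) \<or> i \<and> a > 0 \<and> v' = pairs p (a - 1) b (a' + 1) b')"
proof -
  obtain r r1 r2 r3 j j1 j2 j3 d e d' e' where
    *: "brule (BBlk q p i) z (pairs p r r1 r2 r3) s' (pairs p j j1 j2 j3)"
      "v' = pairs p d e d' e'"
      "int d = int a + j" "int e = int b + j1" "int d' = int a' + j2" "int e' = int b' + j3"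
    using assms unfolding step_pairs by blast
  from *(1) show ?thesis
  proof (cases rule: brule.cases)
    case letter
    then show ?thesis using transD(4) by blast
  next
    case moveb
    then show ?thesis using *(2-) by auto
  next
    case movea
    then show ?thesis using *(2-) by auto
  qed auto
qed

lemma step_brule:
  assumes "step (s, v) a (s', v')"
  obtains r j where "brule s a r s' j" "int (v' ! 0) = int (v ! 0) + j ! 0"
proof -
  obtain r j where "(s, a, r, s', j) \<in> T" "\<forall>m<4. int (v' ! m) = int (v ! m) + j ! m"
    using assms unfolding gstep_blind_closure by blast
  then show thesis using that[of r j] by (auto simp: T_def)
qed

text \<open>The search uses only counter 0. Its value in \<open>BCmp\<close> is given by a sum
  rather than a difference, so that the equation contains the inequality required by
  \<open>short\<close> when the next letter arrives.\<close>

definition search_inv :: "(nat \<Rightarrow> nat) \<Rightarrow> nat \<Rightarrow> bstate \<times> nat list \<Rightarrow> bool" where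
  "search_inv y n cf \<longleftrightarrow> (case fst cf of
      BInit \<Rightarrow> snd cf ! 0 = 0
    | BScan \<Rightarrow> snd cf ! 0 = 0
    | BCnt \<Rightarrow> \<exists>s<n. y s \<in> alph M \<and> (\<forall>m. s < m \<and> m < n \<longrightarrow> y m \<notin> alph M) \<and> snd cf ! 0 = n - Suc s
    | BCmp \<Rightarrow> \<exists>s t. s < t \<and> t < n \<and> y s \<in> alph M \<and> y t \<in> alph M \<and>
        (\<forall>m. s < m \<and> m < n \<and> m \<noteq> t \<longrightarrow> y m \<notin> alph M) \<and> snd cf ! 0 + (n - t) = t - s
    | BAcc \<Rightarrow> short y
    | BBlk q p i \<Rightarrow> True)"

lemma search_inv_step:
  assumes "search_inv y n (s, v)" "step (s, v) (y n) (s', v')"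
  shows "search_inv y (Suc n) (s', v')"
proof -
  obtain r j where *: "brule s (y n) r s' j" "int (v' ! 0) = int (v ! 0) + j ! 0"
    using step_brule[OF assms(2)] by blast
  from *(1) show ?thesis
  proof (cases rule: brule.cases)
    case scan
    then show ?thesis using assms(1) *(2) by (auto simp: search_inv_def pairs_def)
  next
    case cnt
    then have "v' ! 0 = 0" using assms(1) *(2) by (auto simp: search_inv_def pairs_def)
    then show ?thesis using cnt by (auto simp: search_inv_def intro!: exI[of _ n])
  next
    case cntz
    then obtain s where "s < n" "y s \<in> alph M" "\<forall>m. s < m \<and> m < n \<longrightarrow> y m \<notin> alph M" "v ! 0 = n - Suc s"
      using assms(1) by (auto simp: search_inv_def)
    then show ?thesis using cntz *(2) z
      by (auto simp: search_inv_def pairs_def less_Suc_eq intro!: exI[of _ s])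
  next
    case cmp
    then obtain s where "s < n" "y s \<in> alph M" "\<forall>m. s < m \<and> m < n \<longrightarrow> y m \<notin> alph M" "v ! 0 = n - Suc s"
      using assms(1) by (auto simp: search_inv_def)
    then have "s < n \<and> n < Suc n \<and> y s \<in> alph M \<and> y n \<in> alph M \<and>
        (\<forall>m. s < m \<and> m < Suc n \<and> m \<noteq> n \<longrightarrow> y m \<notin> alph M) \<and> v' ! 0 + (Suc n - n) = n - s"
      using cmp *(2) by (auto simp: pairs_def)
    then have "\<exists>s t. s < t \<and> t < Suc n \<and> y s \<in> alph M \<and> y t \<in> alph M \<and>
        (\<forall>m. s < m \<and> m < Suc n \<and> m \<noteq> t \<longrightarrow> y m \<notin> alph M) \<and> v' ! 0 + (Suc n - t) = t - s" by blast
    then show ?thesis using cmp by (simp add: search_inv_def)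
  next
    case cmpz
    then obtain s t where "s < t" "t < n" "y s \<in> alph M" "y t \<in> alph M"
        "\<forall>m. s < m \<and> m < n \<and> m \<noteq> t \<longrightarrow> y m \<notin> alph M" "v ! 0 + (n - t) = t - s"
      using assms(1) by (auto simp: search_inv_def)
    then have "s < t \<and> t < Suc n \<and> y s \<in> alph M \<and> y t \<in> alph M \<and>
        (\<forall>m. s < m \<and> m < Suc n \<and> m \<noteq> t \<longrightarrow> y m \<notin> alph M) \<and> v' ! 0 + (Suc n - t) = t - s"
      using cmpz *(2) z by (auto simp: pairs_def less_Suc_eq)
    then have "\<exists>s t. s < t \<and> t < Suc n \<and> y s \<in> alph M \<and> y t \<in> alph M \<and>
        (\<forall>m. s < m \<and> m < Suc n \<and> m \<noteq> t \<longrightarrow> y m \<notin> alph M) \<and> v' ! 0 + (Suc n - t) = t - s" by blast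
    then show ?thesis using cmpz by (simp add: search_inv_def)
  next
    case acc
    show ?thesis
    proof (cases "s = BCmp")
      case True
      then obtain s t where "s < t" "t < n" "y s \<in> alph M" "y t \<in> alph M"
        "\<forall>m. s < m \<and> m < n \<and> m \<noteq> t \<longrightarrow> y m \<notin> alph M" "v ! 0 + (n - t) = t - s"
        using assms(1) by (auto simp: search_inv_def)
      then have "short y" unfolding short_def using acc True
        by - (rule exI[of _ s], rule exI[of _ t], rule exI[of _ n], auto)
      then show ?thesis using acc by (simp add: search_inv_def)
    next
      case False
      then show ?thesis using acc assms(1) by (auto simp: search_inv_def)
    qed
  qed (auto simp: search_inv_def)
qed

section \<open>Correctness of the blind simulation\<close>

text \<open>Search states never return to block states and can accept only in \<open>BAcc\<close>,
  which is excluded for words that are not short. So an accepting run stays in block states, where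
  counting tokens forces the block lengths and the zero tests to be correct.\<close>

lemma simulation_sound:
  assumes y: "y \<in> omega_words \<Gamma>" and acc: "y \<in> ca_lang 4 B" and ns: "\<not> short y"
  shows "(\<forall>n. y n \<in> alph M \<longleftrightarrow> n \<in> range triangle) \<and> (\<lambda>i. y (triangle i)) \<in> ca_lang 1 M"
proof -
  obtain \<rho> where \<rho>0: "\<rho> 0 = (BInit, replicate 4 0)" and \<rho>: "\<And>n. step (\<rho> n) (y n) (\<rho> (Suc n))"
    and inf: "\<exists>\<^sub>\<infinity>n. fst (\<rho> n) \<in> F" using acc unfolding B_def ca_lang_mk_ca by blast
  have brule: "\<exists>r j. brule (fst (\<rho> n)) (y n) r (fst (\<rho> (Suc n))) j" for n
    using \<rho>[of n] by (metis prod.collapse step_brule)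
  have sinv: "search_inv y n (\<rho> n)" for n
  proof (induction n)
    case (Suc n)
    then show ?case using search_inv_step \<rho>[of n] by (metis prod.collapse)
  qed (simp add: \<rho>0 search_inv_def)
  have not_acc: "fst (\<rho> n) \<noteq> BAcc" for n
  proof
    assume "fst (\<rho> n) = BAcc"
    then show False using sinv[of n] ns by (simp add: search_inv_def)
  qed
  have blk: "\<exists>q p i. fst (\<rho> n) = BBlk q p i" if "n > 0" for n
  proof (rule ccontr)
    assume *: "\<nexists>q p i. fst (\<rho> n) = BBlk q p i"
    have "fst (\<rho> m) \<in> {BScan, BCnt, BCmp, BAcc}" if "m \<ge> n" for m
      using that
    proof (induction m rule: dec_induct)
      case base
      obtain n' where n': "n = Suc n'" using \<open>n > 0\<close> by (cases n) auto
      obtain r j where "brule (fst (\<rho> n')) (y n') r (fst (\<rho> n)) j" using brule n' by blast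
      then show ?case using * by (cases rule: brule.cases) auto
    next
      case (step m)
      obtain r j where "brule (fst (\<rho> m)) (y m) r (fst (\<rho> (Suc m))) j" using brule by blast
      then show ?case using step by (cases rule: brule.cases) (auto simp: base_def)
    qed
    then have "fst (\<rho> m) \<notin> F" if "m \<ge> n" for m using that not_acc[of m] by (fastforce simp: F_def)
    then show False using inf unfolding INFM_nat_le by blast
  qed
  have y\<Gamma>: "y n = z" if "y n \<notin> alph M" for n using y that by (auto simp: omega_words_def \<Gamma>_def)
  have tri: "strict_mono triangle" by (simp add: strict_mono_Suc_iff)
  \<comment> \<open>Just before the i-th letter the active pair has sum i and the passive one is
    empty. The state still carries the orientation p of the previous block, so the active pair is
    the one given by \<open>\<not> p\<close>.\<close>
  define Rel where "Rel i cf \<longleftrightarrow> (\<exists>q c b p s. cf = (q, [c]) \<and> c + b = i \<and> \<rho> (triangle i) = (s, pairs (\<not> p) c b 0 0) \<and>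
     base s q p \<and> (\<forall>n<triangle i. y n \<in> alph M \<longleftrightarrow> n \<in> range triangle))" for i cf
  define Nxt where "Nxt i cf cf' \<longleftrightarrow> ca_step 1 M cf (y (triangle i)) cf' \<and>
    (\<forall>n. triangle i < n \<and> n \<le> triangle (Suc i) \<longrightarrow> (\<exists>p m. fst (\<rho> n) = BBlk (fst cf') p m))" for i cf cf'
  have nxt: "\<exists>cf'. Rel (Suc i) cf' \<and> Nxt i cf cf'" if rel: "Rel i cf" for i cf
  proof -
    let ?t = "triangle i"
    obtain q c b p s where cf: "cf = (q, [c])" "c + b = i" "\<rho> ?t = (s, pairs (\<not> p) c b 0 0)" "base s q p"
      and pat: "\<And>n. n < ?t \<Longrightarrow> y n \<in> alph M \<longleftrightarrow> n \<in> range triangle" using rel unfolding Rel_def by blast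
    obtain q' p' m v1 where 1: "\<rho> (Suc ?t) = (BBlk q' p' m, v1)"
      using blk[of "Suc ?t"] by (metis prod.collapse zero_less_Suc)
    have st: "step (s, pairs (\<not> p) c b 0 0) (y ?t) (BBlk q' p' m, v1)" using \<rho>[of ?t] cf 1 by simp
    \<comment> \<open>A z here would have to move a token out of a pair that the previous block has
      already emptied; so no block is too long.\<close>
    have yt: "y ?t \<in> alph M"
    proof (rule ccontr)
      assume "y ?t \<notin> alph M"
      then have yz: "y ?t = z" by (rule y\<Gamma>)
      show False
      proof (cases "s = BInit")
        case True
        obtain r j where "brule BInit z r (BBlk q' p' m) j" using step_brule[OF st] True yz by metis
        then show False by (cases rule: brule.cases) (use transD(4) in blast)+
      next
        case False
        then obtain m' where "s = BBlk q p m'" using cf(4) by (auto simp: base_def)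
        then show False using step_z[of q p m' 0 0 c b] st yz by (auto simp: pairs_Not)
      qed
    qed
    obtain j where tr: "(q, y ?t, [m], q', [j]) \<in> trans M" and p': "p' = (\<not> p)" and m: "m \<longrightarrow> c \<noteq> 0"
      and v1: "v1 = pairs (\<not> p) (if j = -1 then c - 1 else c)
        (if j = -1 then b + 1 else b) (if j = 1 then 1 else 0) (if j = 1 then 0 else 1)"
      using step_letterD[OF st cf(4) yt] by blast
    have j: "j \<in> {-1, 0, 1}" "j = -1 \<longrightarrow> m" using transD(7)[OF tr] by auto
    define \<alpha> where "\<alpha> = (if j = -1 then c - 1 else c)"
    define d where "d = (if j = 1 then 1 else 0 :: nat)"
    have c': "int (\<alpha> + d) = int c + j" using j m by (auto simp: \<alpha>_def d_def)
    \<comment> \<open>Each z moves one token from the active to the passive pair. The sum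
      \<open>a + a'\<close> of the first components, which is the simulated value, is preserved, and
      after a zero test the first component stays in place.\<close>
    have loop: "\<exists>a b' a' e. \<rho> (Suc ?t + k) = (BBlk q' p' m, pairs p' a b' a' e) \<and> a + b' = i - k \<and> a' + e = Suc k \<and>
        a + a' = \<alpha> + d \<and> (\<not> m \<longrightarrow> a = \<alpha>) \<and> (\<forall>k'<k. y (Suc ?t + k') = z)" if "k \<le> i" for k
      using that
    proof (induction k)
      case 0
      then show ?case using 1 v1 p' cf(2) m j
        by - (rule exI[of _ \<alpha>], rule exI[of _ "if j = -1 then b + 1 else b"], rule exI[of _ d], rule exI[of _ "if j = 1 then 0 else 1"], (auto simp: \<alpha>_def d_def))
    next
      case (Suc k)
      then obtain a b' a' e where k: "\<rho> (Suc ?t + k) = (BBlk q' p' m, pairs p' a b' a' e)" "a + b' = i - k" "a' + e = Suc k"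
        "a + a' = \<alpha> + d" "\<not> m \<longrightarrow> a = \<alpha>" "\<forall>k'<k. y (Suc ?t + k') = z" by auto
      obtain i' where i: "i = Suc i'" using Suc.prems by (cases i) auto
      \<comment> \<open>A letter at this position would follow at distance
        \<open>Suc k \<le> i\<close>, while i is the distance between the two preceding
        letters.\<close>
      have "y (Suc ?t + k) = z"
      proof (rule ccontr)
        assume "y (Suc ?t + k) \<noteq> z"
        then have yk: "y (Suc ?t + k) \<in> alph M" using y\<Gamma> by blast
        have t': "?t = triangle i' + Suc i'" by (simp add: i)
        have "y n \<notin> alph M" if n: "triangle i' < n" "n < Suc ?t + k" "n \<noteq> ?t" for n
        proof (cases "n < ?t")
          case True
          have "n \<notin> range triangle"
          proof
            assume "n \<in> range triangle"
            then obtain l where l: "n = triangle l" by blast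
            then have "triangle i' < triangle l" "triangle l < triangle (Suc i')" using n(1) True i by simp_all
            then have "i' < l" "l < Suc i'" using strict_mono_less[OF tri] by blast+
            then show False by simp
          qed
          then show ?thesis using pat[OF True] by simp
        next
          case False
          then obtain k' where "n = Suc ?t + k'" using n(3) by (metis Suc_leI add_Suc le_iff_add le_neq_implies_less not_less)
          then show ?thesis using k(6) n(2) z by simp
        qed
        moreover have "y (triangle i') \<in> alph M" using pat[of "triangle i'"] t' by simp
        ultimately have "short y" unfolding short_def using yt yk t' Suc.prems i
          by - (rule exI[of _ "triangle i'"], rule exI[of _ ?t], rule exI[of _ "Suc ?t + k"], auto)
        then show False using ns by simp
      qed
      note yz = this
      have "step (BBlk q' p' m, pairs p' a b' a' e) z (\<rho> (Suc (Suc ?t + k)))" using \<rho>[of "Suc ?t + k"] k(1) yz by simp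
      then have "fst (\<rho> (Suc (Suc ?t + k))) = BBlk q' p' m \<and>
        (b' > 0 \<and> snd (\<rho> (Suc (Suc ?t + k))) = pairs p' a (b' - 1) a' (e + 1) \<or>
         m \<and> a > 0 \<and> snd (\<rho> (Suc (Suc ?t + k))) = pairs p' (a - 1) b' (a' + 1) e)"
        using step_z by (metis prod.collapse)
      then obtain a2 b2 a2' e2 where "\<rho> (Suc (Suc ?t + k)) = (BBlk q' p' m, pairs p' a2 b2 a2' e2)"
        "Suc (a2 + b2) = a + b'" "a2' + e2 = Suc (a' + e)" "a2 + a2' = a + a'" "\<not> m \<longrightarrow> a2 = a"
        by (cases "\<rho> (Suc (Suc ?t + k))") fastforce
      then show ?case using k yz
        by - (rule exI[of _ a2], rule exI[of _ b2], rule exI[of _ a2'], rule exI[of _ e2], (auto simp: less_Suc_eq))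
    qed
    obtain a b' a' e where "\<rho> (Suc ?t + i) = (BBlk q' p' m, pairs p' a b' a' e)" "a + b' = i - i" "a' + e = Suc i"
        "a + a' = \<alpha> + d" "\<not> m \<longrightarrow> a = \<alpha>" and zs: "\<forall>k'<i. y (Suc ?t + k') = z"
      using loop[of i] by blast
    then have e: "\<rho> (triangle (Suc i)) = (BBlk q' p' m, pairs (\<not> p') (\<alpha> + d) e 0 0)" "\<alpha> + d + e = Suc i" "\<not> m \<longrightarrow> \<alpha> = 0"
      by (auto simp: pairs_Not add.commute)
    \<comment> \<open>The active pair is empty after i steps. After a zero test no token left its
      first component, so that component was 0; and a zero test excludes a decrement, so \<alpha> is
      c itself.\<close>
    have "\<not> m \<longrightarrow> c = 0" using e(3) j by (auto simp: \<alpha>_def)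
    then have "ca_step 1 M cf (y ?t) (q', [\<alpha> + d])"
      unfolding ca_step_def using tr cf(1) m c' by - (rule exI[of _ "[m]"], rule exI[of _ "[j]"], auto)
    moreover have "\<exists>p m. fst (\<rho> n) = BBlk q' p m" if "triangle i < n" "n \<le> triangle (Suc i)" for n
      using loop[of "n - Suc ?t"] that by fastforce
    moreover have "Rel (Suc i) (q', [\<alpha> + d])"
    proof -
      have "y n \<in> alph M \<longleftrightarrow> n \<in> range triangle" if "n < triangle (Suc i)" for n
      proof (cases "n \<le> ?t")
        case True
        then show ?thesis using pat[of n] yt by (cases "n = ?t") auto
      next
        case False
        then have "y n = z" using zs[rule_format, of "n - Suc ?t"] that by simp
        moreover have "n \<notin> range triangle"
        proof
          assume "n \<in> range triangle"
          then obtain l where "n = triangle l" by blast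
          then have "triangle i < triangle l" "triangle l < triangle (Suc i)" using that False by simp_all
          then have "i < l" "l < Suc i" using strict_mono_less[OF tri] by blast+
          then show False by simp
        qed
        ultimately show ?thesis using z by simp
      qed
      moreover have "base (BBlk q' p' m) q' p'" by (simp add: base_def)
      ultimately show ?thesis unfolding Rel_def using e(1,2) by blast
    qed
    ultimately show ?thesis unfolding Nxt_def by (intro exI[of _ "(q', [\<alpha> + d])"]) auto
  qed
  have "Rel 0 (init M, [0])"
    unfolding Rel_def by - (rule exI[of _ "init M"], rule exI[of _ 0], rule exI[of _ 0], rule exI[of _ False], rule exI[of _ BInit], (auto simp: \<rho>0 base_def replicate_4_pairs))
  then have "\<exists>\<sigma>. \<forall>i. (Rel i (\<sigma> i) \<and> (i = 0 \<longrightarrow> \<sigma> i = (init M, [0]))) \<and> Nxt i (\<sigma> i) (\<sigma> (Suc i))"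
    using nxt by (intro dependent_nat_choice) auto
  then obtain \<sigma> where Rel: "\<And>i. Rel i (\<sigma> i)" and \<sigma>0: "\<sigma> 0 = (init M, [0])" and Nxt: "\<And>i. Nxt i (\<sigma> i) (\<sigma> (Suc i))"
    by blast
  have pat: "y n \<in> alph M \<longleftrightarrow> n \<in> range triangle" for n
  proof -
    have "n < triangle (Suc n)" using strict_mono_imp_increasing[OF tri, of "Suc n"] by simp
    then show ?thesis using Rel[of "Suc n"] unfolding Rel_def by blast
  qed
  have "ca_run 1 M (\<lambda>i. y (triangle i)) \<sigma>" using Nxt \<sigma>0 by (auto simp: ca_run_def Nxt_def)
  moreover have "\<exists>\<^sub>\<infinity>i. fst (\<sigma> i) \<in> final M"
  proof -
    have "(\<exists>\<^sub>\<infinity>n. fst (\<rho> n) \<in> F) \<longleftrightarrow> (\<exists>\<^sub>\<infinity>i. fst (\<sigma> (Suc i)) \<in> final M)"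
    proof (rule INFM_blocks[of "\<lambda>i. Suc (triangle i)"])
      fix i n assume "Suc (triangle i) \<le> n" "n < Suc (triangle (Suc i))"
      then have "triangle i < n \<and> n \<le> triangle (Suc i)" by simp
      then obtain p m where "fst (\<rho> n) = BBlk (fst (\<sigma> (Suc i))) p m" using Nxt[of i] unfolding Nxt_def by blast
      then show "fst (\<rho> n) \<in> F \<longleftrightarrow> fst (\<sigma> (Suc i)) \<in> final M" by (simp add: F_def)
    qed (use tri in \<open>simp add: strict_mono_def\<close>)
    also have "\<dots> \<longleftrightarrow> (\<exists>\<^sub>\<infinity>i. fst (\<sigma> i) \<in> final M)"
      by (rule INFM_blocks[of Suc, symmetric]) (auto simp: strict_mono_def le_less_Suc_eq)
    finally show ?thesis using inf by simp
  qed
  moreover have "(\<lambda>i. y (triangle i)) \<in> omega_words (alph M)" using pat by (auto simp: omega_words_def)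
  ultimately show ?thesis using pat unfolding ca_lang_def by blast
qed

lemma simulation_complete:
  assumes y: "y \<in> omega_words \<Gamma>" and yz: "\<And>n. n \<notin> range triangle \<Longrightarrow> y n = z"
    and acc: "(\<lambda>i. y (triangle i)) \<in> ca_lang 1 M"
  shows "y \<in> ca_lang 4 B"
proof -
  obtain \<sigma> where \<sigma>: "ca_run 1 M (\<lambda>i. y (triangle i)) \<sigma>" and inf: "\<exists>\<^sub>\<infinity>n. fst (\<sigma> n) \<in> final M"
    using acc unfolding ca_lang_def by blast
  define q where "q i = fst (\<sigma> i)" for i
  define c where "c i = snd (\<sigma> i) ! 0" for i
  define m where "m i \<longleftrightarrow> c i \<noteq> 0" for i
  have "\<exists>j. (q i, y (triangle i), [m i], q (Suc i), [j]) \<in> trans M \<and> int (c (Suc i)) = int (c i) + j" for i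
  proof -
    have "ca_step 1 M (\<sigma> i) (y (triangle i)) (\<sigma> (Suc i))" using \<sigma> unfolding ca_run_def by blast
    then obtain i' j' where *: "(q i, y (triangle i), i', q (Suc i), j') \<in> trans M" "i' ! 0 \<longleftrightarrow> c i \<noteq> 0"
      "int (c (Suc i)) = int (c i) + j' ! 0" unfolding ca_step_def q_def c_def by auto
    obtain m' j where "i' = [m']" "j' = [j]" using transD(6,7)[OF *(1)] by blast
    then show ?thesis using * by (auto simp: m_def)
  qed
  then obtain j where tr: "\<And>i. (q i, y (triangle i), [m i], q (Suc i), [j i]) \<in> trans M"
    and c_Suc: "\<And>i. int (c (Suc i)) = int (c i) + j i" by metis
  have j: "j i \<in> {-1, 0, 1}" for i using transD(7)[OF tr[of i]] by auto
  have c0: "c 0 = 0" "q 0 = init M" using \<sigma> by (simp_all add: ca_run_def c_def q_def)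
  have c_le: "c i \<le> i" for i
  proof (induction i)
    case (Suc i)
    then show ?case using c_Suc[of i] j[of i] by auto
  qed (simp add: c0)
  define \<alpha> where "\<alpha> i = (if j i = -1 then c i - 1 else c i)" for i
  define \<beta> where "\<beta> i = (if j i = -1 then i - c i + 1 else i - c i)" for i
  define d where "d i = (if j i = 1 then 1 else 0 :: nat)" for i
  define e where "e i = (if j i = 1 then 0 else 1 :: nat)" for i
  define C where "C i = (BBlk (q (Suc i)) (even i) (m i), pairs (even i) (\<alpha> i) (\<beta> i) (d i) (e i))" for i
  have j_neg: "j i = -1 \<Longrightarrow> c i \<noteq> 0" for i using c_Suc[of i] by auto
  have \<alpha>\<beta>: "\<alpha> i + \<beta> i = i" for i using c_le[of i] j_neg[of i] by (auto simp: \<alpha>_def \<beta>_def)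
  have \<alpha>d: "\<alpha> i + d i = c (Suc i)" for i
    using c_Suc[of i] j[of i] by (auto simp: \<alpha>_def d_def)
  have e: "\<beta> i + e i = Suc i - c (Suc i)" for i
    using \<alpha>d[of i] \<alpha>\<beta>[of i] c_le[of "Suc i"] by (auto simp: d_def e_def)
  let ?R = "\<lambda>n c c'. step c (y n) c'"
  have letter: "step (s, pairs (even i) (c i) (i - c i) 0 0) (y (triangle i)) (C i)"
    if "base s (q i) (odd i)" for s i
    using step_letterI[OF that tr, where c = "c i" and b = "i - c i"] m_def[of i] j_neg[of i]
    by (auto simp: C_def \<alpha>_def \<beta>_def d_def e_def)
  have init: "timed_path ?R 0 (BInit, replicate 4 0) (Suc (triangle 0)) (C 0)"
    using path_step[OF path_refl, of ?R 0 "(BInit, replicate 4 0)" "C 0"] letter[of BInit 0] c0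
    by (simp add: base_def replicate_4_pairs[of _ True])
  have seg: "timed_path ?R (Suc (triangle i)) (C i) (Suc (triangle (Suc i))) (C (Suc i))" for i
  proof -
    let ?t = "Suc (triangle i)" and ?p = "even i"
    let ?s = "BBlk (q (Suc i)) ?p (m i)"
    have q: "q (Suc i) \<in> states M" using transD(5)[OF tr] .
    have z': "y (?t + k) = z" if "k < i" for k
    proof -
      have tri: "strict_mono triangle" by (simp add: strict_mono_Suc_iff)
      have "?t + k \<notin> range triangle"
      proof
        assume "?t + k \<in> range triangle"
        then obtain l where l: "?t + k = triangle l" by blast
        then have "triangle i < triangle l" "triangle l < triangle (Suc i)" using that by simp_all
        then have "i < l" "l < Suc i" using strict_mono_less[OF tri] by blast+
        then show False by simp
      qed
      then show ?thesis by (rule yz)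
    qed
    \<comment> \<open>The first component is emptied before the second. If it is nonzero then so was
      the tested counter, and \<open>movea\<close> is available.\<close>
    have A: "timed_path ?R ?t (?s, pairs ?p (\<alpha> i - 0) (\<beta> i) (d i + 0) (e i)) (?t + \<alpha> i) (?s, pairs ?p (\<alpha> i - \<alpha> i) (\<beta> i) (d i + \<alpha> i) (e i))"
    proof (rule path_loop)
      fix k assume k: "k < \<alpha> i"
      then have "m i" "k < i" using m_def[of i] \<alpha>\<beta>[of i] by (auto simp: \<alpha>_def split: if_splits)
      then show "step (?s, pairs ?p (\<alpha> i - k) (\<beta> i) (d i + k) (e i)) (y (?t + k)) (?s, pairs ?p (\<alpha> i - Suc k) (\<beta> i) (d i + Suc k) (e i))"
        using z'[of k] k stepI[OF movea[OF q, of ?p]] by auto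
    qed
    have B: "timed_path ?R (?t + \<alpha> i) (?s, pairs ?p 0 (\<beta> i - 0) (d i + \<alpha> i) (e i + 0)) (?t + \<alpha> i + \<beta> i) (?s, pairs ?p 0 (\<beta> i - \<beta> i) (d i + \<alpha> i) (e i + \<beta> i))"
    proof (rule path_loop)
      fix k assume k: "k < \<beta> i"
      then have "\<alpha> i + k < i" using \<alpha>\<beta>[of i] by simp
      then have "y (?t + \<alpha> i + k) = z" using z'[of "\<alpha> i + k"] by (simp add: add.assoc)
      then show "step (?s, pairs ?p 0 (\<beta> i - k) (d i + \<alpha> i) (e i + k)) (y (?t + \<alpha> i + k)) (?s, pairs ?p 0 (\<beta> i - Suc k) (d i + \<alpha> i) (e i + Suc k))"
        using k stepI[OF moveb[OF q, of ?p "m i"]] by auto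
    qed
    have t: "?t + \<alpha> i + \<beta> i = triangle (Suc i)" using \<alpha>\<beta>[of i] by simp
    have v: "pairs ?p 0 (\<beta> i - \<beta> i) (d i + \<alpha> i) (e i + \<beta> i) = pairs (even (Suc i)) (c (Suc i)) (Suc i - c (Suc i)) 0 0"
      using \<alpha>d[of i] e[of i] pairs_Not[of ?p "c (Suc i)" "Suc i - c (Suc i)" 0 0, symmetric]
      by (simp add: add.commute)
    have "step (?s, pairs ?p 0 (\<beta> i - \<beta> i) (d i + \<alpha> i) (e i + \<beta> i)) (y (triangle (Suc i))) (C (Suc i))"
      unfolding v by (rule letter) (simp add: base_def)
    moreover have "timed_path ?R ?t (C i) (triangle (Suc i)) (?s, pairs ?p 0 (\<beta> i - \<beta> i) (d i + \<alpha> i) (e i + \<beta> i))"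
      using path_trans[OF B, of ?t "C i"] A unfolding t C_def by simp
    ultimately show ?thesis by (rule path_step[rotated])
  qed
  have tri: "strict_mono (\<lambda>i. Suc (triangle i))" by (simp add: strict_mono_Suc_iff)
  obtain \<rho> where \<rho>: "\<rho> 0 = (BInit, replicate 4 0)" "\<And>n. ?R n (\<rho> n) (\<rho> (Suc n))" "\<And>i. \<rho> (Suc (triangle i)) = C i"
    using glue_paths[OF tri init seg] by blast
  have "\<exists>\<^sub>\<infinity>n. fst (\<rho> n) \<in> F"
    unfolding INFM_nat_le
  proof
    fix N
    obtain i where i: "i \<ge> Suc N" "q i \<in> final M" using inf unfolding INFM_nat_le q_def by blast
    then obtain i' where i': "i = Suc i'" by (cases i) auto
    have "Suc (triangle i') \<ge> i'" using strict_mono_imp_increasing[OF tri] by blast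
    moreover have "fst (\<rho> (Suc (triangle i'))) \<in> F" using i(2) i' by (simp add: \<rho>(3) C_def F_def)
    ultimately show "\<exists>n\<ge>N. fst (\<rho> n) \<in> F" using i i' by (intro exI[of _ "Suc (triangle i')"]) auto
  qed
  then show ?thesis unfolding B_def ca_lang_mk_ca using y \<rho>(1,2) by blast
qed

text \<open>The open set is that of the short words. The distances 1, 2, 3, ... between letters of a
  code strictly increase, so no code is short; off the code a word that is not short is rejected by
  \<open>simulation_sound\<close>.\<close>

lemma wadge_eq_B:
  assumes "\<And>n x. alt (omega_words (alph M)) (ca_lang 1 M) True n x 0"
  shows "wadge_eq (alph M) (ca_lang 1 M) \<Gamma> (ca_lang 4 B)"
proof (rule coding_wadge_eq[where pos = triangle and fill = "\<lambda>_. z" and U = "{y \<in> omega_words \<Gamma>. short y}"])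
  let ?C = "{y. (\<forall>i. y (triangle i) \<in> alph M) \<and> (\<forall>n. n \<notin> range triangle \<longrightarrow> y n = z)}"
  have tri: "strict_mono triangle" by (simp add: strict_mono_Suc_iff)
  then show "strict_mono triangle" .
  show "alph M \<subseteq> \<Gamma>" "z \<in> \<Gamma>" by (auto simp: \<Gamma>_def)
  have C: "y n \<in> alph M \<longleftrightarrow> n \<in> range triangle" if "y \<in> ?C" for y n
    using that z by (cases "n \<in> range triangle") auto
  show "y \<in> ca_lang 4 B \<longleftrightarrow> (\<lambda>i. y (triangle i)) \<in> ca_lang 1 M" if y: "y \<in> omega_words \<Gamma>" and yC: "y \<in> ?C" for y
  proof -
    have "\<not> short y"
    proof
      assume "short y"
      then obtain s t r where str: "s < t" "t < r" "y s \<in> alph M" "y t \<in> alph M" "y r \<in> alph M"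
        "\<forall>n. s < n \<and> n < r \<and> n \<noteq> t \<longrightarrow> y n \<notin> alph M" "r - t \<le> t - s" unfolding short_def by blast
      obtain i where s: "s = triangle i" using C[OF yC] str(3) by blast
      obtain k where t: "t = triangle k" using C[OF yC] str(4) by blast
      obtain l where r: "r = triangle l" using C[OF yC] str(5) by blast
      have "i < k" "k < l" using str(1,2) strict_mono_less[OF tri] unfolding s t r by blast+
      then have "Suc i \<le> k" "Suc k \<le> l" by simp_all
      then have le: "triangle (Suc i) \<le> t" "triangle (Suc k) \<le> r"
        unfolding t r using strict_mono_less_eq[OF tri] by blast+
      have "t = triangle (Suc i)"
      proof (rule ccontr)
        assume "t \<noteq> triangle (Suc i)"
        then have "s < triangle (Suc i) \<and> triangle (Suc i) < r \<and> triangle (Suc i) \<noteq> t"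
          using le(1) str(2) by (simp add: s)
        then have "y (triangle (Suc i)) \<notin> alph M" using str(6) by blast
        then show False using C[OF yC, of "triangle (Suc i)"] by blast
      qed
      then have "triangle k = triangle (Suc i)" using t by simp
      then have "k = Suc i" using strict_mono_eq[OF tri] by blast
      then show False using str(7) le(2) t s by simp
    qed
    then show ?thesis using simulation_sound[OF y] simulation_complete[OF y] yC by blast
  qed
  show "y \<in> ca_lang 4 B \<longleftrightarrow> y \<in> {y \<in> omega_words \<Gamma>. short y}" if y: "y \<in> omega_words \<Gamma>" and yC: "y \<notin> ?C" for y
  proof -
    have "y n = z" if "y n \<notin> alph M" for n using y that by (auto simp: omega_words_def \<Gamma>_def)
    then have "\<not> (\<forall>n. y n \<in> alph M \<longleftrightarrow> n \<in> range triangle)" using yC by blast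
    then show ?thesis using simulation_sound[OF y] short_accepted[OF y] y by blast
  qed
  show "cantor_open \<Gamma> {y \<in> omega_words \<Gamma>. short y}"
    unfolding cantor_open_def
  proof (intro conjI ballI)
    fix y assume "y \<in> {y \<in> omega_words \<Gamma>. short y}"
    then obtain s t r where str: "s < t" "t < r" "y s \<in> alph M" "y t \<in> alph M" "y r \<in> alph M"
      "\<forall>n. s < n \<and> n < r \<and> n \<noteq> t \<longrightarrow> y n \<notin> alph M" "r - t \<le> t - s" unfolding short_def by blast
    have "short y'" if "\<forall>i<Suc r. y' i = y i" for y'
      unfolding short_def using str that
      by - (rule exI[of _ s], rule exI[of _ t], rule exI[of _ r], auto)
    then show "\<exists>n. \<forall>y'\<in>omega_words \<Gamma>. (\<forall>i<n. y' i = y i) \<longrightarrow> y' \<in> {y \<in> omega_words \<Gamma>. short y}" by blast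
  qed auto
qed (use assms in auto)

end

section \<open>From four counters to one counter\<close>

definition ps :: "nat \<Rightarrow> nat" where "ps m = [2, 3, 5, 7] ! m"

definition K :: nat where "K = (\<Prod>m<4. ps m)"

definition val :: "nat list \<Rightarrow> nat" where "val c = (\<Prod>m<4. ps m ^ (c ! m))"

text \<open>Multiplying by \<open>K\<close> (that is, 210) first turns every update into an exact
  division: by the 0th, 1st or 2nd power of a prime for an increment, no change, or a
  decrement.\<close>

definition divisor :: "int list \<Rightarrow> nat" where "divisor j = (\<Prod>m<4. ps m ^ nat (1 - j ! m))"

lemma prime_ps: "m < 4 \<Longrightarrow> prime (ps m)"
proof -
  assume "m < 4"
  then have "m = 0 \<or> m = 1 \<or> m = 2 \<or> m = 3" by linarith
  then show ?thesis by (auto simp: ps_def)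
qed

lemma ps_inj: "m < 4 \<Longrightarrow> n < 4 \<Longrightarrow> ps m = ps n \<Longrightarrow> m = n"
  by (auto simp: ps_def less_Suc_eq numeral_eq_Suc)

lemma ps_pos: "m < 4 \<Longrightarrow> ps m > 0"
  using prime_ps prime_gt_0_nat by blast

lemma K_pos: "K > 0" and val_pos: "val c > 0" and divisor_pos: "divisor j > 0"
  unfolding K_def val_def divisor_def using ps_pos by (auto intro!: prod_pos)

lemma ps_dvd_K: "m < 4 \<Longrightarrow> ps m dvd K"
  unfolding K_def by (rule dvd_prodI) auto

lemma ps_dvd_val: "m < 4 \<Longrightarrow> ps m dvd val c \<longleftrightarrow> c ! m \<noteq> 0"
proof
  assume m: "m < 4" and "ps m dvd val c"
  then obtain i where i: "i < 4" "ps m dvd ps i ^ (c ! i)"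
    unfolding val_def using prime_dvd_prod_iff[of "{..<4::nat}" "ps m"] prime_ps by auto
  then have "ps m dvd ps i" using prime_dvd_power prime_ps[OF m] by blast
  then have "m = i" using primes_dvd_imp_eq prime_ps i(1) m ps_inj by blast
  then show "c ! m \<noteq> 0" using i(2) prime_ps[OF m] by (metis nat_dvd_1_iff_1 not_prime_1 power_0)
next
  assume m: "m < 4" and "c ! m \<noteq> 0"
  then have "ps m dvd ps m ^ (c ! m)" by (simp add: dvd_power)
  also have "\<dots> dvd val c" unfolding val_def using m by (intro dvd_prodI) auto
  finally show "ps m dvd val c" .
qed

lemma val_update:
  assumes "\<And>m. m < 4 \<Longrightarrow> int (c' ! m) = int (c ! m) + j ! m" "\<And>m. m < 4 \<Longrightarrow> j ! m \<le> 1"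
  shows "val c' * divisor j = K * val c"
proof -
  have "ps m ^ (c' ! m) * ps m ^ nat (1 - j ! m) = ps m * ps m ^ (c ! m)" if "m < 4" for m
  proof -
    have "c' ! m + nat (1 - j ! m) = Suc (c ! m)" using assms(1)[OF that] assms(2)[OF that] by linarith
    then show ?thesis by (metis power_Suc power_add)
  qed
  then show ?thesis unfolding val_def divisor_def K_def by (simp flip: prod.distrib)
qed

text \<open>No exponent exceeds 2. The bound keeps the divisors stored in states, and the phases
  counted up to them, in a finite set.\<close>

lemma divisor_le:
  assumes "\<And>m. m < 4 \<Longrightarrow> j ! m \<ge> -1"
  shows "divisor j \<le> K * K"
proof -
  have "ps m ^ nat (1 - j ! m) \<le> ps m * ps m" if "m < 4" for m
    using power_increasing[of "nat (1 - j ! m)" 2 "ps m"] assms[OF that] ps_pos[OF that]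
    by (simp add: power2_eq_square)
  then have "divisor j \<le> (\<Prod>m<4. ps m * ps m)" unfolding divisor_def by (intro prod_mono) auto
  then show ?thesis by (simp add: K_def prod.distrib)
qed

section \<open>Block lengths of the second code\<close>

text \<open>The i-th letter is followed by a block of length \<open>K ^ i\<close>, a separator, and
  a block of length \<open>K ^ Suc i\<close>. Each transition multiplies the stored value by at most
  \<open>K\<close>, so before the i-th letter it is at most \<open>K ^ i\<close> and fits into the
  block.\<close>

definition gap :: "nat \<Rightarrow> nat" where "gap j = K ^ (Suc j div 2)"

text \<open>The value 1 at 0 is a fictitious predecessor that makes \<open>rate_prev_gap\<close>
  hold for the first block as well; the checking branch starts with it in the counter.\<close>

definition prev_gap :: "nat \<Rightarrow> nat" where "prev_gap j = (case j of 0 \<Rightarrow> 1 | Suc i \<Rightarrow> gap i)"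

text \<open>A block after a letter (\<open>True\<close>) repeats the length of its predecessor; a
  block after a separator is \<open>K\<close> times as long.\<close>

definition rate :: "bool \<Rightarrow> nat" where "rate ty = (if ty then 1 else K)"

primrec mark :: "nat \<Rightarrow> nat" where
  "mark 0 = 0"
| "mark (Suc j) = mark j + Suc (gap j)"

lemma rate_prev_gap: "rate (even j) * prev_gap j = gap j"
  by (cases j) (auto simp: rate_def prev_gap_def gap_def elim!: evenE oddE)

lemma rate_pos: "rate ty > 0"
  using K_pos by (simp add: rate_def)

lemma mark_mono: "strict_mono mark"
  by (simp add: strict_mono_Suc_iff)

lemma between_marks: "mark j < n \<Longrightarrow> n < mark (Suc j) \<Longrightarrow> n \<notin> range mark"
proof
  assume n: "mark j < n" "n < mark (Suc j)" and "n \<in> range mark"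
  then obtain l where l: "n = mark l" by blast
  have "j < l" "l < Suc j" using n strict_mono_less[OF mark_mono] unfolding l by blast+
  then show False by simp
qed

datatype cstate = CInit | CScan | CCnt | CAcc | CChk bool nat | CFst nat nat bool nat | CSnd nat nat bool nat

instance cstate :: countable by countable_datatype

locale counters_to_one =
  fixes M :: cautomaton and z S :: nat
  assumes valid: "valid_ca 4 M" and zS: "z \<notin> alph M" "S \<notin> alph M" "z \<noteq> S"
begin

definition \<Gamma> :: "nat set" where "\<Gamma> = insert z (insert S (alph M))"

definition Q :: "cstate set" where
  "Q = {CInit, CScan, CCnt, CAcc} \<union> {CChk ty t |ty t. t < K}
     \<union> {CFst q a d r |q a d r. q \<in> states M \<and> a \<in> alph M \<and> r < K}
     \<union> {CSnd q s d t |q s d t. q \<in> states M \<and> s \<le> K * K \<and> t < K * K}"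

definition F :: "cstate set" where
  "F = insert CAcc {CFst q a d r |q a d r. q \<in> final M \<and> a \<in> alph M \<and> r < K}"

text \<open>The four simulated counters c are stored as the number val c. During a block of length b
  (CFst), the counter changes from val c to b - val c, while val c is computed modulo K;
  its residue tells which of the four counters are zero. During the following block
  of length K * b (CSnd), the counter is decreased to zero once for every K letters, so that K * val c
  letters remain; increasing the counter once for every s of them then yields K * val c / s.
  CChk checks whether a block has the correct length relative to the preceding one.\<close>

inductive crule :: "cstate \<Rightarrow> nat \<Rightarrow> bool \<Rightarrow> cstate \<Rightarrow> int \<Rightarrow> bool" where
  init_scan: "a \<in> alph M \<Longrightarrow> crule CInit a b CScan 0"
| init_cnt: "a \<in> alph M \<Longrightarrow> crule CInit a b CCnt 0"
| init_chk: "a \<in> alph M \<Longrightarrow> crule CInit a b (CChk True 0) 1"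
| init_fst: "a \<in> alph M \<Longrightarrow> crule CInit a b (CFst (init M) a True 0) 1"
| init_acc: "a \<notin> alph M \<Longrightarrow> crule CInit a b CAcc 0"
| scan: "crule CScan a b CScan 0"
| scan_cnt: "a \<noteq> z \<Longrightarrow> crule CScan a b CCnt 0"
| cnt_z: "crule CCnt z b CCnt 1"
| cnt_chk: "a \<noteq> z \<Longrightarrow> crule CCnt a b (CChk (a \<in> alph M) 0) 0"
| chk_skip: "b \<or> t \<noteq> 0 \<Longrightarrow> Suc t < rate ty \<Longrightarrow> crule (CChk ty t) z b (CChk ty (Suc t)) 0"
| chk_dec: "b \<Longrightarrow> Suc t = rate ty \<Longrightarrow> crule (CChk ty t) z b (CChk ty 0) (-1)"
| chk_long: "\<not> b \<Longrightarrow> t = 0 \<Longrightarrow> crule (CChk ty t) z b CAcc 0"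
| chk_marker: "a \<noteq> z \<Longrightarrow> \<not> (t = 0 \<and> \<not> b \<and> (a \<in> alph M \<longleftrightarrow> \<not> ty)) \<Longrightarrow> crule (CChk ty t) a b CAcc 0"
| acc: "crule CAcc a b CAcc 0"
| fst_down: "b \<Longrightarrow> d \<Longrightarrow> crule (CFst q a d r) z b (CFst q a True (Suc r mod K)) (-1)"
| fst_up: "\<not> b \<or> \<not> d \<Longrightarrow> crule (CFst q a d r) z b (CFst q a False r) 1"
| fst_trans: "(q, a, i, q', j) \<in> trans M \<Longrightarrow> \<forall>m<4. i ! m \<longleftrightarrow> ps m dvd r \<Longrightarrow>
    crule (CFst q a d r) S b (CSnd q' (divisor j) True 0) 0"
| snd_skip: "d \<Longrightarrow> b \<or> t \<noteq> 0 \<Longrightarrow> Suc t < K \<Longrightarrow> crule (CSnd q s d t) z b (CSnd q s True (Suc t)) 0"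
| snd_dec: "d \<Longrightarrow> b \<Longrightarrow> Suc t = K \<Longrightarrow> crule (CSnd q s d t) z b (CSnd q s True 0) (-1)"
| snd_up: "\<not> d \<or> t = 0 \<and> \<not> b \<Longrightarrow> Suc t < s \<Longrightarrow> crule (CSnd q s d t) z b (CSnd q s False (Suc t)) 0"
| snd_inc: "\<not> d \<or> t = 0 \<and> \<not> b \<Longrightarrow> Suc t = s \<Longrightarrow> crule (CSnd q s d t) z b (CSnd q s False 0) 1"
| snd_letter: "a \<in> alph M \<Longrightarrow> crule (CSnd q s d t) a b (CFst q a True 0) 0"

definition T :: "(cstate \<times> nat \<times> bool list \<times> cstate \<times> int list) set" where
  "T = {(s, a, i, s', j). s \<in> Q \<and> s' \<in> Q \<and> a \<in> \<Gamma> \<and> (\<exists>b x. i = [b] \<and> j = [x] \<and> crule s a b s' x)}"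

definition B :: cautomaton where "B = mk_ca Q \<Gamma> T CInit F"

abbreviation step :: "cstate \<times> nat list \<Rightarrow> nat \<Rightarrow> cstate \<times> nat list \<Rightarrow> bool" where
  "step \<equiv> gstep (Suc 0) T"

lemma step_iff:
  "step (s, [c]) a cf' \<longleftrightarrow> s \<in> Q \<and> fst cf' \<in> Q \<and> a \<in> \<Gamma> \<and>
     (\<exists>c' x. snd cf' = [c'] \<and> crule s a (c \<noteq> 0) (fst cf') x \<and> int c' = int c + x)"
  (is "?A \<longleftrightarrow> ?B")
proof
  assume ?A
  then show ?B by (cases "snd cf'") (auto simp: gstep_def T_def)
next
  assume ?B
  then obtain c' x where "s \<in> Q" "fst cf' \<in> Q" "a \<in> \<Gamma>" "snd cf' = [c']" "crule s a (c \<noteq> 0) (fst cf') x" "int c' = int c + x"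
    by blast
  then show ?A unfolding gstep_def T_def by (intro exI[of _ "[c \<noteq> 0]"] exI[of _ "[x]"]) auto
qed

lemma stepI:
  assumes "crule s a (c \<noteq> 0) s' x" "int c' = int c + x" "s \<in> Q" "s' \<in> Q" "a \<in> \<Gamma>"
  shows "step (s, [c]) a (s', [c'])"
  using assms unfolding step_iff by auto

lemma transD:
  assumes "(q, a, i, q', j) \<in> trans M"
  shows "q \<in> states M" "a \<in> alph M" "q' \<in> states M" "length i = 4" "length j = 4"
    "\<And>m. m < 4 \<Longrightarrow> j ! m \<in> {-1, 0, 1}" "\<And>m. m < 4 \<Longrightarrow> j ! m = -1 \<Longrightarrow> i ! m"
proof -
  have *: "case (q, a, i, q', j) of (q, a, i, q', j) \<Rightarrow> q \<in> states M \<and> a \<in> alph M \<and> length i = 4 \<and>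
       q' \<in> states M \<and> length j = 4 \<and> set j \<subseteq> {-1, 0, 1} \<and>
        (\<forall>m<4. \<not> (i ! m = False \<and> j ! m = -1))"
    using valid unfolding valid_ca_def by (elim conjE) (drule bspec[OF _ assms])
  then show "q \<in> states M" "a \<in> alph M" "q' \<in> states M" "length i = 4" "length j = 4" by auto
  show "j ! m \<in> {-1, 0, 1}" if "m < 4" for m
  proof -
    have "j ! m \<in> set j" using * that by simp
    then show ?thesis using * by blast
  qed
  show "i ! m" if "m < 4" "j ! m = -1" for m
    using * that by auto
qed

lemma init_in: "init M \<in> states M" and fin: "finite (states M)" "finite (alph M)" "final M \<subseteq> states M"
  using valid by (auto simp: valid_ca_def)

lemma rCL1_B: "rCL1 \<Gamma> (ca_lang 1 B)"
proof -
  have "Q = {CInit, CScan, CCnt, CAcc} \<union> (\<lambda>(ty, t). CChk ty t) ` (UNIV \<times> {..<K})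
     \<union> (\<lambda>(q, a, d, r). CFst q a d r) ` (states M \<times> alph M \<times> UNIV \<times> {..<K})
     \<union> (\<lambda>(q, s, d, t). CSnd q s d t) ` (states M \<times> {..K * K} \<times> UNIV \<times> {..<K * K})"
    by (auto simp: Q_def image_def)
  moreover have "finite \<dots>" using fin(1,2) by (intro finite_UnI finite_imageI finite_cartesian_product) auto
  ultimately have "finite Q" by simp
  then have "valid_ca 1 B"
    unfolding B_def
  proof (rule valid_mk_ca)
    fix s a i s' j assume "(s, a, i, s', j) \<in> T"
    then obtain b x where *: "s \<in> Q" "s' \<in> Q" "a \<in> \<Gamma>" "i = [b]" "j = [x]" "crule s a b s' x" by (auto simp: T_def)
    from *(6) have "x \<in> {-1, 0, 1} \<and> (x = -1 \<longrightarrow> b)" by (cases rule: crule.cases) auto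
    then show "s \<in> Q \<and> a \<in> \<Gamma> \<and> length i = 1 \<and> s' \<in> Q \<and> length j = 1 \<and> set j \<subseteq> {-1, 0, 1} \<and>
       (\<forall>m<1. j ! m = -1 \<longrightarrow> i ! m)" using * by simp
  qed (use fin in \<open>auto simp: Q_def F_def \<Gamma>_def\<close>)
  then show ?thesis unfolding rCL1_def by (intro exI[of _ B]) (simp add: B_def)
qed

section \<open>Deterministic traversal of a block\<close>

text \<open>This and the next two definitions are closed forms for the configuration after k letters
  z. The step lemmas are equivalences, so the traversal of a block is deterministic and one lemma
  serves soundness and completeness alike.\<close>

definition fst_conf :: "nat \<Rightarrow> nat \<Rightarrow> nat \<Rightarrow> nat \<Rightarrow> cstate \<times> nat list" where
  "fst_conf q a v k = (if k \<le> v then (CFst q a True (k mod K), [v - k]) else (CFst q a False (v mod K), [k - v]))"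

definition snd_conf :: "nat \<Rightarrow> nat \<Rightarrow> nat \<Rightarrow> nat \<Rightarrow> cstate \<times> nat list" where
  "snd_conf q s c k = (if k \<le> K * c then (CSnd q s True (k mod K), [c - k div K])
     else (CSnd q s False ((k - K * c) mod s), [(k - K * c) div s]))"

definition chk_conf :: "bool \<Rightarrow> nat \<Rightarrow> nat \<Rightarrow> cstate \<times> nat list" where
  "chk_conf ty g k = (CChk ty (k mod rate ty), [g - k div rate ty])"

lemma z_in: "z \<in> \<Gamma>" "S \<in> \<Gamma>" "a \<in> alph M \<Longrightarrow> a \<in> \<Gamma>"
  by (auto simp: \<Gamma>_def)

lemma fst_conf_step:
  assumes "q \<in> states M" "a \<in> alph M"
  shows "step (fst_conf q a v k) z cf' \<longleftrightarrow> cf' = fst_conf q a v (Suc k)"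
proof -
  have Q: "CFst q a d r \<in> Q" if "r < K" for d r using assms that by (auto simp: Q_def)
  have K: "x mod K < K" for x using K_pos by simp
  consider "k < v" | "k = v" | "k > v" by linarith
  then show ?thesis
  proof cases
    case 1
    have "crule (CFst q a True (k mod K)) z True s' x \<longleftrightarrow> s' = CFst q a True (Suc k mod K) \<and> x = -1" for s' x
      using zS by (auto simp: mod_Suc_eq elim: crule.cases intro: crule.intros dest: transD(2))
        (metis crule.fst_down mod_Suc_eq)
    then show ?thesis using 1 Q K z_in by (cases cf') (auto simp: fst_conf_def step_iff)
  next
    case 2
    have "crule (CFst q a True (k mod K)) z False s' x \<longleftrightarrow> s' = CFst q a False (k mod K) \<and> x = 1" for s' x
      using zS by (auto elim: crule.cases intro: crule.intros)
    then show ?thesis using 2 Q K z_in by (cases cf') (auto simp: fst_conf_def step_iff)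
  next
    case 3
    have "crule (CFst q a False (v mod K)) z True s' x \<longleftrightarrow> s' = CFst q a False (v mod K) \<and> x = 1" for s' x
      using zS by (auto elim: crule.cases intro: crule.intros)
    then show ?thesis using 3 Q K z_in by (cases cf') (auto simp: fst_conf_def step_iff)
  qed
qed

lemma snd_conf_step:
  assumes "q \<in> states M" "0 < s" "s \<le> K * K"
  shows "step (snd_conf q s c k) z cf' \<longleftrightarrow> cf' = snd_conf q s c (Suc k)"
proof -
  have K: "x mod K < K" "K \<le> K * K" for x using K_pos by simp_all
  have "t < K * K" if "t < K \<or> t < s" for t using that K(2) assms(3) by linarith
  then have Q: "CSnd q s d t \<in> Q" if "t < K \<or> t < s" for d t
    using assms that by (auto simp: Q_def)
  consider "k < K * c" | "k = K * c" | "k > K * c" by linarith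
  then show ?thesis
  proof cases
    case 1
    have "k div K < c" using 1 by (intro less_mult_imp_div_less) (simp add: mult.commute)
    then have c: "c - k div K \<noteq> 0" by simp
    have "crule (CSnd q s True (k mod K)) z True s' x \<longleftrightarrow>
        s' = CSnd q s True (Suc k mod K) \<and> x = (if Suc (k mod K) = K then -1 else 0)" for s' x
      using zS K(1)[of k] by (auto simp: mod_Suc elim: crule.cases intro: crule.intros)
    moreover have "int (c - Suc k div K) = int (c - k div K) + (if Suc (k mod K) = K then -1 else 0)"
      using c by (auto simp: div_Suc mod_Suc)
    ultimately show ?thesis using 1 c Q K z_in by (cases cf') (auto simp: snd_conf_def step_iff simp del: div_mod_decomp)
  next
    \<comment> \<open>The turn takes place while reading: with counter 0 and phase 0 the current z
      is already the first of the s letters to be counted, and for \<open>s = 1\<close> it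
      increments at once.\<close>
    case 2
    have "crule (CSnd q s True 0) z False s' x \<longleftrightarrow>
        s' = CSnd q s False (Suc 0 mod s) \<and> x = (if s = 1 then 1 else 0)" for s' x
      using zS assms(2) by (auto simp: mod_Suc elim: crule.cases intro: crule.intros)
    then show ?thesis using 2 Q K_pos K z_in assms(2)
      by (cases cf') (auto simp: snd_conf_def step_iff)
  next
    case 3
    define u where "u = k - K * c"
    have u: "Suc k - K * c = Suc u" using 3 by (simp add: u_def)
    have "crule (CSnd q s False (u mod s)) z b s' x \<longleftrightarrow>
        s' = CSnd q s False (Suc u mod s) \<and> x = (if Suc (u mod s) = s then 1 else 0)" for s' x b
      using zS mod_less_divisor[OF assms(2), of u] by (auto simp: mod_Suc elim: crule.cases intro: crule.intros)
    moreover have "int (Suc u div s) = int (u div s) + (if Suc (u mod s) = s then 1 else 0)"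
      by (auto simp: div_Suc mod_Suc)
    ultimately show ?thesis using 3 Q z_in assms(2)
      by (cases cf') (auto simp: snd_conf_def step_iff u u_def[symmetric])
  qed
qed

lemma chk_conf_step:
  assumes "k < rate ty * g"
  shows "step (chk_conf ty g k) z cf' \<longleftrightarrow> cf' = chk_conf ty g (Suc k)"
proof -
  let ?r = "rate ty"
  have K: "x mod ?r < ?r" "?r \<le> K" for x using K_pos rate_pos by (auto simp: rate_def)
  have "x mod ?r < K" for x using K(1)[of x] K(2) by linarith
  then have Q: "CChk ty (x mod ?r) \<in> Q" for x by (auto simp: Q_def)
  have "k div ?r < g" using assms by (intro less_mult_imp_div_less) (simp add: mult.commute)
  then have c: "g - k div ?r \<noteq> 0" by simp
  have "crule (CChk ty (k mod ?r)) z True s' x \<longleftrightarrow>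
      s' = CChk ty (Suc k mod ?r) \<and> x = (if Suc (k mod ?r) = ?r then -1 else 0)" for s' x
    using zS K(1)[of k] by (auto simp: mod_Suc elim: crule.cases intro: crule.intros)
  moreover have "int (g - Suc k div ?r) = int (g - k div ?r) + (if Suc (k mod ?r) = ?r then -1 else 0)"
    using c by (auto simp: div_Suc mod_Suc)
  ultimately show ?thesis using c Q z_in by (cases cf') (auto simp: chk_conf_def step_iff)
qed

text \<open>All four primes divide \<open>K\<close>, so the residue modulo \<open>K\<close> answers
  the four zero tests at once.\<close>

lemma middle_step:
  assumes "q \<in> states M" "a \<in> alph M" "r < K"
  shows "step (CFst q a d r, [c]) S cf' \<longleftrightarrow> (\<exists>i q' j. (q, a, i, q', j) \<in> trans M \<and>
     (\<forall>m<4. i ! m \<longleftrightarrow> ps m dvd r) \<and> cf' = (CSnd q' (divisor j) True 0, [c]))"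
proof -
  have "CSnd q' (divisor j) True 0 \<in> Q" if "(q, a, i, q', j) \<in> trans M" for i q' j
  proof -
    have "j ! m \<ge> -1" if "m < 4" for m using transD(6)[OF \<open>(q, a, i, q', j) \<in> trans M\<close> that] by auto
    then show ?thesis using divisor_le[of j] transD(3)[OF that] K_pos by (auto simp: Q_def)
  qed
  moreover have "CFst q a d r \<in> Q" using assms by (auto simp: Q_def)
  moreover have "crule (CFst q a d r) S b s' x \<longleftrightarrow> (\<exists>i q' j. (q, a, i, q', j) \<in> trans M \<and>
     (\<forall>m<4. i ! m \<longleftrightarrow> ps m dvd r) \<and> s' = CSnd q' (divisor j) True 0 \<and> x = 0)" for b s' x
  proof
    assume "crule (CFst q a d r) S b s' x"
    then show "\<exists>i q' j. (q, a, i, q', j) \<in> trans M \<and>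
     (\<forall>m<4. i ! m \<longleftrightarrow> ps m dvd r) \<and> s' = CSnd q' (divisor j) True 0 \<and> x = 0"
      by (cases rule: crule.cases) (use zS in auto)
  qed (auto intro: crule.intros)
  ultimately show ?thesis using z_in
    by (cases cf') (auto simp: step_iff; blast)
qed

lemma letter_step:
  assumes "CSnd q s d t \<in> Q" "x \<in> alph M"
  shows "step (CSnd q s d t, [c]) x cf' \<longleftrightarrow> cf' = (CFst q x True 0, [c])"
proof -
  have "CFst q x True 0 \<in> Q" using assms K_pos by (auto simp: Q_def)
  then show ?thesis using assms zS z_in
    by (cases cf') (auto simp: step_iff elim!: crule.cases intro: crule.intros)
qed

section \<open>Detection of the first deviation from the code\<close>

definition filler :: "nat \<Rightarrow> nat" where
  "filler n = (if n \<in> range (\<lambda>i. mark (Suc (2 * i))) then S else z)"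

definition okp :: "(nat \<Rightarrow> nat) \<Rightarrow> nat \<Rightarrow> bool" where
  "okp y n \<longleftrightarrow> (if n \<in> range (\<lambda>i. mark (2 * i)) then y n \<in> alph M else y n = filler n)"

lemma mark_range: "mark j \<in> range (\<lambda>i. mark (2 * i)) \<longleftrightarrow> even j" "mark j \<in> range (\<lambda>i. mark (Suc (2 * i))) \<longleftrightarrow> odd j"
proof -
  have "mark j \<in> range (\<lambda>i. mark (2 * i)) \<longleftrightarrow> (\<exists>i. j = 2 * i)"
    by (simp add: image_iff strict_mono_eq[OF mark_mono] del: mark.simps)
  then show "mark j \<in> range (\<lambda>i. mark (2 * i)) \<longleftrightarrow> even j" by (auto elim: evenE)
  have "mark j \<in> range (\<lambda>i. mark (Suc (2 * i))) \<longleftrightarrow> (\<exists>i. j = Suc (2 * i))"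
    by (simp add: image_iff strict_mono_eq[OF mark_mono] del: mark.simps)
  then show "mark j \<in> range (\<lambda>i. mark (Suc (2 * i))) \<longleftrightarrow> odd j" by (auto elim: oddE)
qed

lemma okp_mark: "okp y (mark j) \<longleftrightarrow> (if even j then y (mark j) \<in> alph M else y (mark j) = S)"
  by (simp add: okp_def filler_def mark_range del: mark.simps)

lemma okp_between: "mark j < n \<Longrightarrow> n < mark (Suc j) \<Longrightarrow> okp y n \<longleftrightarrow> y n = z"
  using between_marks[of j n] by (auto simp: okp_def filler_def simp del: mark.simps)

lemma mark_cases:
  obtains "n = 0" | j where "mark j < n" "n \<le> mark (Suc j)"
proof (cases n)
  case (Suc n')
  obtain j where "mark j \<le> n'" "n' < mark (Suc j)" using block_exists[OF mark_mono, of n'] by auto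
  then show thesis using that(2)[of j] Suc by simp
qed (use that in simp)

lemma Q_simps: "CInit \<in> Q" "CScan \<in> Q" "CCnt \<in> Q" "CAcc \<in> Q" "CChk ty 0 \<in> Q"
  "q \<in> states M \<Longrightarrow> a \<in> alph M \<Longrightarrow> CFst q a d 0 \<in> Q" "CChk ty (k mod rate ty) \<in> Q"
proof -
  have "rate ty \<le> K" using K_pos by (simp add: rate_def)
  then have "k mod rate ty < K" using rate_pos[of ty] mod_less_divisor[of "rate ty" k] by linarith
  then show "CChk ty (k mod rate ty) \<in> Q" by (auto simp: Q_def)
qed (use K_pos in \<open>auto simp: Q_def\<close>)

text \<open>Only the first wrong position has to be found. Everything before it is correct, so the
  preceding block has its prescribed length, and \<open>rate\<close> times that length is the right
  measure for the block in question. The automaton guesses where the preceding block begins.\<close>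

lemma mismatch_accepted:
  assumes y: "y \<in> omega_words \<Gamma>" and mismatch: "\<not> okp y n"
  shows "y \<in> ca_lang 1 B"
proof -
  define n0 where "n0 = (LEAST n. \<not> okp y n)"
  have n0: "\<not> okp y n0" unfolding n0_def using mismatch by (rule LeastI)
  have ok: "okp y n" if "n < n0" for n using that not_less_Least unfolding n0_def by blast
  have y\<Gamma>: "y n \<in> \<Gamma>" for n using y by (simp add: omega_words_def)
  let ?R = "\<lambda>n c c'. step c (y n) c'"
  have fin: ?thesis if "timed_path ?R 0 (CInit, [0]) n (CAcc, [c])" for n c
    unfolding B_def
  proof (rule accepted_via_sink)
    show "timed_path (\<lambda>n c c'. gstep 1 T c (y n) c') 0 (CInit, replicate 1 0) n (CAcc, [c])" using that by simp
    show "gstep 1 T (CAcc, [c]) (y m) (CAcc, [c])" for m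
      using stepI[OF crule.acc] y\<Gamma> Q_simps by simp
  qed (use y in \<open>auto simp: F_def\<close>)
  show ?thesis
  proof (cases rule: mark_cases[of n0])
    case 1
    then have "y 0 \<notin> alph M" using n0 okp_mark[of y 0] by simp
    then have "timed_path ?R 0 (CInit, [0]) (Suc 0) (CAcc, [0])"
      by (intro path_step[OF path_refl] stepI[OF init_acc]) (use y\<Gamma> Q_simps in auto)
    then show ?thesis by (rule fin)
  next
    case (2 j)
    have okm: "okp y (mark i)" if "i \<le> j" for i
    proof -
      have "mark i \<le> mark j" using that strict_mono_less_eq[OF mark_mono] by blast
      then show ?thesis using ok 2(1) by simp
    qed
    have ymark: "y (mark i) \<noteq> z \<and> (y (mark i) \<in> alph M \<longleftrightarrow> even i)" if "i \<le> j" for i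
      using okm[OF that] zS by (auto simp: okp_mark split: if_splits)
    have reach: "timed_path ?R 0 (CInit, [0]) (Suc (mark j)) (chk_conf (even j) (prev_gap j) 0)"
    proof (cases j)
      case 0
      have "timed_path ?R 0 (CInit, [0]) (Suc 0) (CChk True 0, [1])"
        by (intro path_step[OF path_refl] stepI[OF init_chk]) (use y\<Gamma> Q_simps ymark[of 0] in auto)
      then show ?thesis using 0 by (simp add: chk_conf_def prev_gap_def)
    next
      case (Suc i)
      have y0: "y 0 \<in> alph M" using ymark[of 0] by simp
      have 1: "timed_path ?R 0 (CInit, [0]) (Suc (mark i)) (CCnt, [0])"
      proof (cases "mark i")
        case 0
        have "timed_path ?R 0 (CInit, [0]) (Suc 0) (CCnt, [0])"
          by (intro path_step[OF path_refl] stepI[OF init_cnt]) (use y\<Gamma> Q_simps y0 in auto)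
        then show ?thesis using 0 by simp
      next
        case (Suc t)
        have "timed_path ?R 0 (CInit, [0]) (Suc 0) (CScan, [0])"
          by (intro path_step[OF path_refl] stepI[OF init_scan]) (use y\<Gamma> Q_simps y0 in auto)
        moreover have "timed_path ?R (Suc 0) (CScan, [0]) (Suc 0 + t) (CScan, [0])"
          by (rule path_loop[of t ?R "Suc 0" "\<lambda>_. (CScan, [0])"], rule stepI[OF scan]) (use y\<Gamma> Q_simps in auto)
        ultimately have "timed_path ?R 0 (CInit, [0]) (mark i) (CScan, [0])" using path_trans Suc by fastforce
        then show ?thesis
          by (rule path_step, intro stepI[OF scan_cnt]) (use y\<Gamma> Q_simps ymark[of i] \<open>j = Suc i\<close> in auto)
      qed
      have 2: "timed_path ?R (Suc (mark i)) (CCnt, [0]) (Suc (mark i) + gap i) (CCnt, [gap i])"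
      proof (rule path_loop)
        fix k assume k: "k < gap i"
        have "okp y (Suc (mark i) + k)" using ok \<open>mark j < n0\<close> k Suc by simp
        then have "y (Suc (mark i) + k) = z" using okp_between[of i "Suc (mark i) + k" y] k by simp
        then show "step (CCnt, [k]) (y (Suc (mark i) + k)) (CCnt, [Suc k])"
          using stepI[OF cnt_z] z_in Q_simps by simp
      qed
      have t: "Suc (mark i) + gap i = mark j" using Suc by simp
      have "step (CCnt, [gap i]) (y (mark j)) (CChk (y (mark j) \<in> alph M) 0, [gap i])"
        by (rule stepI[OF cnt_chk]) (use y\<Gamma> Q_simps ymark[of j] in auto)
      then have "step (CCnt, [gap i]) (y (mark j)) (chk_conf (even j) (prev_gap j) 0)"
        using ymark[of j] Suc by (simp add: chk_conf_def prev_gap_def)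
      then show ?thesis using path_step[OF path_trans[OF 2[unfolded t] 1]] by blast
    qed
    define k where "k = n0 - Suc (mark j)"
    have k: "n0 = Suc (mark j) + k" "k \<le> gap j" using 2 by (auto simp: k_def)
    have "timed_path ?R (Suc (mark j)) (chk_conf (even j) (prev_gap j) 0) (Suc (mark j) + k) (chk_conf (even j) (prev_gap j) k)"
    proof (rule path_loop)
      fix l assume l: "l < k"
      then have "y (Suc (mark j) + l) = z"
        using ok[of "Suc (mark j) + l"] okp_between[of j "Suc (mark j) + l" y] k by simp
      then show "step (chk_conf (even j) (prev_gap j) l) (y (Suc (mark j) + l)) (chk_conf (even j) (prev_gap j) (Suc l))"
        using chk_conf_step[of l "even j" "prev_gap j"] l k rate_prev_gap[of j] by simp
    qed
    then have path: "timed_path ?R 0 (CInit, [0]) n0 (chk_conf (even j) (prev_gap j) k)"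
      using path_trans reach k by fastforce
    let ?t = "k mod rate (even j)" and ?c = "prev_gap j - k div rate (even j)"
    \<comment> \<open>Either a marker comes before the block is complete, or the complete block is
      followed by one more z or by a marker of the wrong kind.\<close>
    have "step (CChk (even j) ?t, [?c]) (y n0) (CAcc, [?c])"
    proof (cases "k < gap j")
      case True
      then have "y n0 \<noteq> z" using n0 okp_between[of j n0 y] k by simp
      moreover have "k div rate (even j) < prev_gap j"
        using True rate_prev_gap[of j] by (intro less_mult_imp_div_less) (simp add: mult.commute)
      ultimately show ?thesis using y\<Gamma> Q_simps by (intro stepI[OF chk_marker]) auto
    next
      case False
      then have kj: "k = rate (even j) * prev_gap j" "n0 = mark (Suc j)" using k rate_prev_gap[of j] by simp_all
      then have tc: "?t = 0" "?c = 0" using rate_pos by simp_all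
      show ?thesis
      proof (cases "y n0 = z")
        case True
        have "step (CChk (even j) 0, [0]) z (CAcc, [0])"
          by (rule stepI[OF chk_long]) (use z_in Q_simps in auto)
        then show ?thesis unfolding True tc .
      next
        case False
        have "\<not> (y n0 \<in> alph M \<longleftrightarrow> \<not> even j)"
          using n0 y\<Gamma>[of n0] False unfolding kj(2) okp_mark by (auto simp: \<Gamma>_def split: if_splits)
        then show ?thesis using False y\<Gamma> Q_simps tc by (intro stepI[OF chk_marker]) auto
      qed
    qed
    then have "timed_path ?R 0 (CInit, [0]) (Suc n0) (CAcc, [?c])"
      using path_step[OF path] unfolding chk_conf_def by blast
    then show ?thesis by (rule fin)
  qed
qed

text \<open>On a code a search never reaches \<open>CAcc\<close>: at the marker that ends a checked
  block, phase and counter are both 0 and the kind of marker is right, so no rule applies.\<close>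

definition search_inv :: "nat \<Rightarrow> cstate \<times> nat list \<Rightarrow> bool" where
  "search_inv n cf \<longleftrightarrow> (case fst cf of
      CInit \<Rightarrow> n = 0
    | CScan \<Rightarrow> n > 0 \<and> snd cf = [0]
    | CCnt \<Rightarrow> \<exists>j. mark j < n \<and> n \<le> mark (Suc j) \<and> snd cf = [n - Suc (mark j)]
    | CChk ty t \<Rightarrow> \<exists>j. mark j < n \<and> n \<le> mark (Suc j) \<and> cf = chk_conf (even j) (prev_gap j) (n - Suc (mark j))
    | CAcc \<Rightarrow> False
    | CFst q a d r \<Rightarrow> True
    | CSnd q s d t \<Rightarrow> True)"

lemma search_inv_step:
  assumes ok: "\<And>n. okp y n" and inv: "search_inv n (s, [c])" and step: "step (s, [c]) (y n) (s', v')"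
    and n0: "n = 0 \<Longrightarrow> s = CInit \<and> c = 0"
  shows "search_inv (Suc n) (s', v')"
proof -
  obtain c' x where v': "v' = [c']" and r: "crule s (y n) (c \<noteq> 0) s' x" "int c' = int c + x"
    using step unfolding step_iff by auto
  have ymark: "y (mark i) \<noteq> z \<and> (y (mark i) \<in> alph M \<longleftrightarrow> even i)" for i
    using ok[of "mark i"] zS by (auto simp: okp_mark split: if_splits)
  have at_mark: "n = mark (Suc j)" if "mark j < n" "n \<le> mark (Suc j)" "y n \<noteq> z" for j
    using that ok[of n] okp_between[of j n y] by (cases "n = mark (Suc j)") auto
  have not_mark: "n < mark (Suc j)" if "n \<le> mark (Suc j)" "y n = z" for j
    using that ymark[of "Suc j"] by (cases "n = mark (Suc j)") auto
  have chk: ?thesis if s: "s = CChk ty t" for ty t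
  proof -
    obtain j where j: "mark j < n" "n \<le> mark (Suc j)" "(s, [c]) = chk_conf (even j) (prev_gap j) (n - Suc (mark j))"
      using inv s by (auto simp: search_inv_def)
    let ?k = "n - Suc (mark j)"
    have ty: "ty = even j" "t = ?k mod rate (even j)" "c = prev_gap j - ?k div rate (even j)" using j(3) s by (auto simp: chk_conf_def)
    show ?thesis
    proof (cases "y n = z")
      case True
      then have "n < mark (Suc j)" using not_mark j(2) by blast
      then have "?k < rate (even j) * prev_gap j" using rate_prev_gap[of j] j(1) by simp
      then have "(s', v') = chk_conf (even j) (prev_gap j) (Suc ?k)"
        using chk_conf_step step True j(3) by simp
      moreover have "Suc ?k = Suc n - Suc (mark j)" using j(1) by simp
      ultimately show ?thesis using j(1) \<open>n < mark (Suc j)\<close>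
        by (auto simp: search_inv_def chk_conf_def intro!: exI[of _ j])
    next
      case False
      then have n: "n = mark (Suc j)" using at_mark j by blast
      then have "?k = rate (even j) * prev_gap j" using rate_prev_gap[of j] by simp
      then have tc: "t = 0" "c = 0" using ty rate_pos by simp_all
      have "y n \<in> alph M \<longleftrightarrow> \<not> ty" using ymark[of "Suc j"] n ty(1) by simp
      moreover have "crule (CChk ty t) (y n) (c \<noteq> 0) s' x" using r(1) s by simp
      ultimately have False using tc False zS by (auto elim: crule.cases)
      then show ?thesis ..
    qed
  qed
  show ?thesis
  proof (cases "\<exists>ty t. s = CChk ty t")
    case True
    then show ?thesis using chk by blast
  next
    case nchk: False
    from r(1) show ?thesis
    proof (cases rule: crule.cases)
      case init_scan
      then show ?thesis using inv n0 r(2) v' by (auto simp: search_inv_def)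
    next
      case init_cnt
      then show ?thesis using inv n0 r(2) v' by (auto simp: search_inv_def intro!: exI[of _ 0])
    next
      case init_chk
      then show ?thesis using inv n0 r(2) v' rate_pos
        by (auto simp: search_inv_def chk_conf_def prev_gap_def intro!: exI[of _ 0])
    next
      case init_acc
      then show ?thesis using inv ymark[of 0] by (simp add: search_inv_def)
    next
      case scan
      then show ?thesis using inv r(2) v' by (auto simp: search_inv_def)
    next
      case scan_cnt
      then have "n > 0" "c = 0" using inv by (auto simp: search_inv_def)
      then obtain j where j: "mark j < n" "n \<le> mark (Suc j)" by (cases rule: mark_cases[of n]) auto
      then have "n = mark (Suc j)" using at_mark scan_cnt by blast
      then show ?thesis using scan_cnt r(2) v' \<open>c = 0\<close> by (auto simp: search_inv_def intro!: exI[of _ "Suc j"])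
    next
      case cnt_z
      then obtain j where j: "mark j < n" "n \<le> mark (Suc j)" "c = n - Suc (mark j)" using inv by (auto simp: search_inv_def)
      then have "n < mark (Suc j)" using not_mark cnt_z by blast
      then show ?thesis using j cnt_z r(2) v' by (auto simp: search_inv_def intro!: exI[of _ j])
    next
      case cnt_chk
      then obtain j where j: "mark j < n" "n \<le> mark (Suc j)" "c = n - Suc (mark j)" using inv by (auto simp: search_inv_def)
      then have n: "n = mark (Suc j)" using at_mark cnt_chk by blast
      then have "(s', v') = chk_conf (even (Suc j)) (prev_gap (Suc j)) (Suc n - Suc (mark (Suc j)))"
        using cnt_chk r(2) v' j ymark[of "Suc j"] by (auto simp: chk_conf_def prev_gap_def)
      moreover have "mark (Suc j) < Suc n \<and> Suc n \<le> mark (Suc (Suc j))" using n by simp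
      ultimately have "\<exists>j. mark j < Suc n \<and> Suc n \<le> mark (Suc j) \<and> (s', v') = chk_conf (even j) (prev_gap j) (Suc n - Suc (mark j))" by blast
      then show ?thesis using cnt_chk by (simp add: search_inv_def)
    qed (use nchk inv in \<open>auto simp: search_inv_def\<close>)
  qed
qed

section \<open>Correctness of the one-counter simulation\<close>

lemma fst_conf_0: "fst_conf q a v 0 = (CFst q a True 0, [v])"
  by (simp add: fst_conf_def)

lemma snd_conf_0: "snd_conf q s c 0 = (CSnd q s True 0, [c])"
  by (simp add: snd_conf_def)

lemma fst_conf_end: "v \<le> b \<Longrightarrow> \<exists>d. fst_conf q a v b = (CFst q a d (v mod K), [b - v])"
  by (cases "b = v") (auto simp: fst_conf_def)

text \<open>Counting \<open>b - v\<close> down takes \<open>K * (b - v)\<close> letters and leaves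
  \<open>K * v\<close> of them. This is a positive multiple of s, so the upward phase has begun and
  ends exactly with phase 0.\<close>

lemma snd_conf_end:
  assumes "0 < v" "v \<le> b" "v' * s = K * v" "0 < s"
  shows "snd_conf q s (b - v) (K * b) = (CSnd q s False 0, [v'])"
proof -
  have "K * (b - v) < K * b" using assms K_pos by simp
  moreover have "K * b - K * (b - v) = v' * s" using assms by (simp add: right_diff_distrib')
  ultimately show ?thesis using assms(4) by (simp add: snd_conf_def)
qed

lemma final_fst_conf: "fst (fst_conf q a v k) \<in> F \<Longrightarrow> q \<in> final M"
  by (auto simp: fst_conf_def F_def split: if_splits)

lemma not_final_snd_conf: "fst (snd_conf q s c k) \<notin> F"
  by (auto simp: snd_conf_def F_def)

lemma gap_even: "gap (2 * i) = K ^ i" "gap (Suc (2 * i)) = K * K ^ i"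
  by (simp_all add: gap_def)

lemma mark_double_Suc: "mark (2 * Suc i) = Suc (mark (Suc (2 * i))) + gap (Suc (2 * i))"
  by simp

lemma okp_letters:
  assumes "\<And>n. okp y n"
  shows "y (mark (2 * i)) \<in> alph M" "y (mark (Suc (2 * i))) = S"
    "k < gap j \<Longrightarrow> y (Suc (mark j) + k) = z"
  using assms okp_mark[of y "2 * i"] okp_mark[of y "Suc (2 * i)"] okp_between[of j "Suc (mark j) + k" y]
  by simp_all

lemma divisor_trans:
  assumes "(q, a, i, q', j) \<in> trans M"
  shows "divisor j \<le> K * K"
proof (rule divisor_le)
  show "-1 \<le> j ! m" if "m < 4" for m using transD(6)[OF assms that] by auto
qed

lemma val_trans:
  assumes "(q, a, i, q', j) \<in> trans M" "\<And>m. m < 4 \<Longrightarrow> int (c' ! m) = int (c ! m) + j ! m"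
  shows "val c' * divisor j = K * val c" "val c' \<le> K * val c"
proof -
  have "j ! m \<le> 1" if "m < 4" for m using transD(6)[OF assms(1) that] by auto
  then show eq: "val c' * divisor j = K * val c" using assms(2) by (intro val_update) auto
  have "val c' * 1 \<le> val c' * divisor j" using divisor_pos[of j] by (intro mult_le_mono2) simp
  then show "val c' \<le> K * val c" using eq by simp
qed

text \<open>On a code a search cannot accept, so an accepting run simulates from the first letter
  on. Its only choices are the transitions taken at the separators, and these form the run of
  M.\<close>

lemma simulation_sound:
  assumes y: "y \<in> omega_words \<Gamma>" and acc: "y \<in> ca_lang 1 B" and ok: "\<And>n. okp y n"
  shows "(\<lambda>i. y (mark (2 * i))) \<in> ca_lang 4 M"
proof -
  obtain \<rho> where \<rho>0: "\<rho> 0 = (CInit, [0])" and \<rho>: "\<And>n. step (\<rho> n) (y n) (\<rho> (Suc n))"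
    and inf: "\<exists>\<^sub>\<infinity>n. fst (\<rho> n) \<in> F" using acc unfolding B_def ca_lang_mk_ca by auto
  have "\<exists>c. snd (\<rho> n) = [c]" for n
    using \<rho>[of n] by (auto simp: gstep_def length_Suc_conv)
  then obtain c where "\<And>n. snd (\<rho> n) = [c n]" by metis
  then have \<rho>_eq: "\<rho> n = (fst (\<rho> n), [c n])" for n by (metis prod.collapse)
  have rule: "\<exists>x. crule (fst (\<rho> n)) (y n) (c n \<noteq> 0) (fst (\<rho> (Suc n))) x \<and> int (c (Suc n)) = int (c n) + x" for n
    using \<rho>[of n] \<rho>_eq[of n] \<rho>_eq[of "Suc n"] step_iff by (metis list.inject snd_conv)
  have sinv: "search_inv n (\<rho> n)" for n
  proof (induction n)
    case (Suc n)
    show ?case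
      using search_inv_step[OF ok, of n "fst (\<rho> n)" "c n" "fst (\<rho> (Suc n))" "snd (\<rho> (Suc n))"]
        Suc \<rho>[of n] \<rho>_eq[of n] \<rho>0 by (cases n) auto
  qed (simp add: \<rho>0 search_inv_def)
  have not_acc: "fst (\<rho> n) \<noteq> CAcc" for n
  proof
    assume "fst (\<rho> n) = CAcc"
    then show False using sinv[of n] by (simp add: search_inv_def)
  qed
  define search where "search s \<longleftrightarrow> s \<in> {CScan, CCnt, CAcc} \<or> (\<exists>ty t. s = CChk ty t)" for s
  have no_search: "\<not> search (fst (\<rho> n))" for n
  proof
    assume *: "search (fst (\<rho> n))"
    have "search (fst (\<rho> m))" if "m \<ge> n" for m
      using that
    proof (induction m rule: dec_induct)
      case (step m)
      obtain x where "crule (fst (\<rho> m)) (y m) (c m \<noteq> 0) (fst (\<rho> (Suc m))) x" using rule by blast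
      then show ?case using step(3) by (cases rule: crule.cases) (auto simp: search_def)
    qed (rule *)
    then have "fst (\<rho> m) \<notin> F" if "m \<ge> n" for m using that not_acc[of m] by (fastforce simp: F_def search_def)
    then show False using inf unfolding INFM_nat_le by blast
  qed
  note letters = okp_letters[OF ok]
  define Rel where "Rel i cf \<longleftrightarrow> (\<exists>q v. cf = (q, v) \<and> length v = 4 \<and> q \<in> states M \<and> val v \<le> gap (2 * i) \<and>
     \<rho> (Suc (mark (2 * i))) = fst_conf q (y (mark (2 * i))) (val v) 0)" for i cf
  define Nxt where "Nxt i cf cf' \<longleftrightarrow> ca_step 4 M cf (y (mark (2 * i))) cf' \<and>
    (\<forall>n. Suc (mark (2 * i)) \<le> n \<and> n < Suc (mark (2 * Suc i)) \<longrightarrow> fst (\<rho> n) \<in> F \<longrightarrow> fst cf \<in> final M)" for i cf cf'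
  have nxt: "\<exists>cf'. Rel (Suc i) cf' \<and> Nxt i cf cf'" if rel: "Rel i cf" for i cf
  proof -
    let ?t = "Suc (mark (2 * i))" and ?t' = "Suc (mark (Suc (2 * i)))" and ?a = "y (mark (2 * i))" and ?b = "gap (2 * i)"
    obtain q v where v: "cf = (q, v)" "length v = 4" "q \<in> states M" "val v \<le> ?b" "\<rho> ?t = fst_conf q ?a (val v) 0"
      using rel unfolding Rel_def by blast
    have blk1: "\<rho> (?t + k) = fst_conf q ?a (val v) k" if "k \<le> ?b" for k
      using that
    proof (induction k)
      case (Suc k)
      then have "step (fst_conf q ?a (val v) k) z (\<rho> (Suc (?t + k)))"
        using \<rho>[of "?t + k"] letters(3)[of k "2 * i"] by simp
      then show ?case using fst_conf_step[OF v(3) letters(1)] by simp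
    qed (use v in simp)
    obtain d where d: "fst_conf q ?a (val v) ?b = (CFst q ?a d (val v mod K), [?b - val v])"
      using fst_conf_end[OF v(4)] by blast
    have "step (CFst q ?a d (val v mod K), [?b - val v]) S (\<rho> ?t')"
      using \<rho>[of "?t + ?b"] blk1[of ?b] d letters(2)[of i] by simp
    then obtain i' q' j where tr: "(q, ?a, i', q', j) \<in> trans M" and i': "\<forall>m<4. i' ! m \<longleftrightarrow> ps m dvd val v mod K"
      and \<rho>t': "\<rho> ?t' = snd_conf q' (divisor j) (?b - val v) 0"
      using middle_step[OF v(3) letters(1), of "val v mod K"] K_pos unfolding snd_conf_0 by auto
    have q': "q' \<in> states M" using transD(3)[OF tr] .
    have blk2: "\<rho> (?t' + k) = snd_conf q' (divisor j) (?b - val v) k" if "k \<le> gap (Suc (2 * i))" for k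
      using that
    proof (induction k)
      case (Suc k)
      then have "step (snd_conf q' (divisor j) (?b - val v) k) z (\<rho> (Suc (?t' + k)))"
        using \<rho>[of "?t' + k"] letters(3)[of k "Suc (2 * i)"] by simp
      then show ?case using snd_conf_step[OF q' divisor_pos divisor_trans[OF tr]] by simp
    qed (use \<rho>t' in simp)
    have i'v: "i' ! m \<longleftrightarrow> v ! m \<noteq> 0" if "m < 4" for m
      using i' that ps_dvd_val dvd_mod_iff[OF ps_dvd_K] by simp
    \<comment> \<open>\<open>nat\<close> loses nothing: a decrement requires a true test, and by the
      residue that counter is nonzero.\<close>
    define v' where "v' = map (\<lambda>m. nat (int (v ! m) + j ! m)) [0..<4]"
    have v'_nth: "int (v' ! m) = int (v ! m) + j ! m" if "m < 4" for m
      using that transD(6,7)[OF tr that] i'v[OF that] by (auto simp: v'_def)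
    note val' = val_trans[OF tr v'_nth]
    have "\<rho> (mark (2 * Suc i)) = snd_conf q' (divisor j) (?b - val v) (K * ?b)"
      using blk2[of "gap (Suc (2 * i))"] unfolding mark_double_Suc gap_even by simp
    also have "\<dots> = (CSnd q' (divisor j) False 0, [val v'])"
      using snd_conf_end[OF val_pos v(4) val'(1) divisor_pos] .
    finally have "step (CSnd q' (divisor j) False 0, [val v']) (y (mark (2 * Suc i))) (\<rho> (Suc (mark (2 * Suc i))))"
      using \<rho>[of "mark (2 * Suc i)"] by simp
    moreover have "CSnd q' (divisor j) False 0 \<in> Q" using q' divisor_trans[OF tr] K_pos by (auto simp: Q_def)
    ultimately have "\<rho> (Suc (mark (2 * Suc i))) = fst_conf q' (y (mark (2 * Suc i))) (val v') 0"
      using letter_step letters(1)[of "Suc i"] unfolding fst_conf_0 by blast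
    moreover have "val v' \<le> gap (2 * Suc i)"
      using order_trans[OF val'(2) mult_le_mono2[OF v(4), of K]] by (simp only: gap_even power_Suc)
    ultimately have "Rel (Suc i) (q', v')" using q' by (simp add: Rel_def v'_def)
    moreover have "ca_step 4 M cf ?a (q', v')"
      unfolding ca_step_def using v tr i'v v'_nth by (intro exI[of _ i'] exI[of _ j]) (simp add: v'_def)
    moreover have "fst cf \<in> final M" if n: "?t \<le> n" "n < Suc (mark (2 * Suc i))" and F: "fst (\<rho> n) \<in> F" for n
    proof (cases "n < ?t'")
      case True
      then have "\<rho> n = fst_conf q ?a (val v) (n - ?t)" using blk1[of "n - ?t"] n(1) by simp
      then show ?thesis using F final_fst_conf v(1) by simp
    next
      case False
      then obtain l where l: "n = ?t' + l" by (metis le_iff_add not_less)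
      then have "\<rho> n = snd_conf q' (divisor j) (?b - val v) l"
        using blk2[of l] n(2) unfolding mark_double_Suc by simp
      then show ?thesis using F not_final_snd_conf by simp
    qed
    ultimately show ?thesis unfolding Nxt_def by blast
  qed
  have "Rel 0 (init M, replicate 4 0)"
  proof -
    obtain x where x: "crule CInit (y 0) False (fst (\<rho> (Suc 0))) x" "int (c (Suc 0)) = x"
      using rule[of 0] \<rho>0 \<rho>_eq[of 0] by auto
    \<comment> \<open>The other moves from \<open>CInit\<close> lead into a search. The counter
      value 1 is \<open>val\<close> of four zeros.\<close>
    have "\<rho> (Suc 0) = (CFst (init M) (y 0) True 0, [1])"
      using x(1)
    proof (cases rule: crule.cases)
      case init_fst
      then show ?thesis using x(2) \<rho>_eq[of "Suc 0"] by simp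
    qed (use no_search[of "Suc 0"] in \<open>auto simp: search_def\<close>)
    then show ?thesis using init_in by (simp add: Rel_def fst_conf_0 val_def gap_def)
  qed
  then have "\<exists>\<sigma>. \<forall>i. (Rel i (\<sigma> i) \<and> (i = 0 \<longrightarrow> \<sigma> i = (init M, replicate 4 0))) \<and> Nxt i (\<sigma> i) (\<sigma> (Suc i))"
    using nxt by (intro dependent_nat_choice) auto
  then obtain \<sigma> where \<sigma>0: "\<sigma> 0 = (init M, replicate 4 0)" and Nxt: "\<And>i. Nxt i (\<sigma> i) (\<sigma> (Suc i))"
    by blast
  have "ca_run 4 M (\<lambda>i. y (mark (2 * i))) \<sigma>" using Nxt \<sigma>0 by (auto simp: ca_run_def Nxt_def)
  moreover have "\<exists>\<^sub>\<infinity>i. fst (\<sigma> i) \<in> final M"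
  proof (rule INFM_blocks_imp[OF _ _ inf])
    show "strict_mono (\<lambda>i. Suc (mark (2 * i)))" by (simp add: strict_mono_Suc_iff)
    show "fst (\<sigma> i) \<in> final M" if "Suc (mark (2 * i)) \<le> n" "n < Suc (mark (2 * Suc i))" "fst (\<rho> n) \<in> F" for i n
      using Nxt[of i] that unfolding Nxt_def by blast
  qed
  moreover have "(\<lambda>i. y (mark (2 * i))) \<in> omega_words (alph M)" using letters(1) by (auto simp: omega_words_def)
  ultimately show ?thesis unfolding ca_lang_def by blast
qed

lemma simulation_complete:
  assumes y: "y \<in> omega_words \<Gamma>" and acc: "(\<lambda>i. y (mark (2 * i))) \<in> ca_lang 4 M" and ok: "\<And>n. okp y n"
  shows "y \<in> ca_lang 1 B"
proof -
  obtain \<sigma> where \<sigma>: "ca_run 4 M (\<lambda>i. y (mark (2 * i))) \<sigma>" and inf: "\<exists>\<^sub>\<infinity>n. fst (\<sigma> n) \<in> final M"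
    using acc unfolding ca_lang_def by blast
  note letters = okp_letters[OF ok]
  define q where "q i = fst (\<sigma> i)" for i
  define v where "v i = snd (\<sigma> i)" for i
  have "\<exists>i' j. (q i, y (mark (2 * i)), i', q (Suc i), j) \<in> trans M \<and> (\<forall>m<4. i' ! m \<longleftrightarrow> v i ! m \<noteq> 0) \<and>
      (\<forall>m<4. int (v (Suc i) ! m) = int (v i ! m) + j ! m)" for i
    using \<sigma> unfolding ca_run_def ca_step_def q_def v_def by blast
  then obtain i' j where tr: "\<And>i. (q i, y (mark (2 * i)), i' i, q (Suc i), j i) \<in> trans M"
    and i': "\<And>i m. m < 4 \<Longrightarrow> i' i ! m \<longleftrightarrow> v i ! m \<noteq> 0"
    and v: "\<And>i m. m < 4 \<Longrightarrow> int (v (Suc i) ! m) = int (v i ! m) + j i ! m" by metis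
  note val = val_trans[OF tr v]
  have v0: "val (v 0) = 1" "q 0 = init M" using \<sigma> by (simp_all add: ca_run_def q_def v_def val_def)
  have le: "val (v i) \<le> gap (2 * i)" for i
  proof (induction i)
    case (Suc i)
    then show ?case using order_trans[OF val(2)[of i] mult_le_mono2[OF Suc, of K]] by (simp only: gap_even power_Suc)
  qed (simp add: v0 gap_def)
  define C where "C i = fst_conf (q i) (y (mark (2 * i))) (val (v i)) 0" for i
  let ?R = "\<lambda>n c c'. step c (y n) c'"
  have q: "q i \<in> states M" for i using transD(1)[OF tr] .
  have init: "timed_path ?R 0 (CInit, [0]) (Suc (mark (2 * 0))) (C 0)"
  proof -
    have "timed_path ?R 0 (CInit, [0]) (Suc 0) (CFst (init M) (y 0) True 0, [1])"
      by (intro path_step[OF path_refl]) (use letters(1)[of 0] stepI[OF init_fst] Q_simps init_in z_in in auto)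
    then show ?thesis by (simp add: C_def fst_conf_0 v0)
  qed
  have seg: "timed_path ?R (Suc (mark (2 * i))) (C i) (Suc (mark (2 * Suc i))) (C (Suc i))" for i
  proof -
    let ?t = "Suc (mark (2 * i))" and ?t' = "Suc (mark (Suc (2 * i)))" and ?a = "y (mark (2 * i))" and ?b = "gap (2 * i)"
    let ?s = "divisor (j i)" and ?v = "val (v i)"
    have A: "timed_path ?R ?t (fst_conf (q i) ?a ?v 0) (?t + ?b) (fst_conf (q i) ?a ?v ?b)"
      by (rule path_loop) (simp only: letters(3) fst_conf_step[OF q letters(1)])
    obtain d where d: "fst_conf (q i) ?a ?v ?b = (CFst (q i) ?a d (?v mod K), [?b - ?v])"
      using fst_conf_end[OF le] by blast
    have "\<forall>m<4. i' i ! m \<longleftrightarrow> ps m dvd ?v mod K"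
      using i' ps_dvd_val dvd_mod_iff[OF ps_dvd_K] by simp
    then have "step (fst_conf (q i) ?a ?v ?b) S (snd_conf (q (Suc i)) ?s (?b - ?v) 0)"
      unfolding d snd_conf_0 using middle_step[OF q letters(1), of "?v mod K"] tr[of i] K_pos by auto
    then have A': "timed_path ?R ?t (fst_conf (q i) ?a ?v 0) ?t' (snd_conf (q (Suc i)) ?s (?b - ?v) 0)"
      using path_step[OF A] letters(2)[of i] by simp
    have "timed_path ?R ?t' (snd_conf (q (Suc i)) ?s (?b - ?v) 0) (?t' + gap (Suc (2 * i))) (snd_conf (q (Suc i)) ?s (?b - ?v) (gap (Suc (2 * i))))"
      by (rule path_loop) (simp only: letters(3) snd_conf_step[OF q divisor_pos divisor_trans[OF tr]])
    then have B: "timed_path ?R ?t' (snd_conf (q (Suc i)) ?s (?b - ?v) 0) (mark (2 * Suc i)) (CSnd (q (Suc i)) ?s False 0, [val (v (Suc i))])"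
      using snd_conf_end[OF val_pos le val(1) divisor_pos] unfolding mark_double_Suc gap_even by simp
    have "CSnd (q (Suc i)) ?s False 0 \<in> Q" using q divisor_trans[OF tr] K_pos by (auto simp: Q_def)
    then have "step (CSnd (q (Suc i)) ?s False 0, [val (v (Suc i))]) (y (mark (2 * Suc i))) (C (Suc i))"
      unfolding C_def fst_conf_0 using letter_step letters(1)[of "Suc i"] by blast
    then show ?thesis using path_step[OF path_trans[OF B A']] unfolding C_def by blast
  qed
  have mono: "strict_mono (\<lambda>i. Suc (mark (2 * i)))" by (simp add: strict_mono_Suc_iff)
  obtain \<rho> where \<rho>: "\<rho> 0 = (CInit, [0])" "\<And>n. ?R n (\<rho> n) (\<rho> (Suc n))" "\<And>i. \<rho> (Suc (mark (2 * i))) = C i"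
    using glue_paths[OF mono init seg] by blast
  have "fst (\<rho> (Suc (mark (2 * i)))) \<in> F \<longleftrightarrow> fst (\<sigma> i) \<in> final M" for i
    unfolding \<rho>(3) C_def fst_conf_0 using letters(1)[of i] K_pos by (auto simp: F_def q_def)
  then have "\<exists>\<^sub>\<infinity>n. fst (\<rho> n) \<in> F" using INFM_sample[OF mono, of "\<lambda>n. fst (\<rho> n) \<in> F"] inf by simp
  then show ?thesis unfolding B_def ca_lang_mk_ca using y \<rho>(1,2) by auto
qed

text \<open>Zero tests detect every deviation from the code, too long blocks included, so all words
  off the code are accepted and the open set is the whole space.\<close>

lemma wadge_eq_B:
  assumes "\<And>n x. alt (omega_words (alph M)) (ca_lang 4 M) True n x 0"
  shows "wadge_eq (alph M) (ca_lang 4 M) \<Gamma> (ca_lang 1 B)"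
proof (rule coding_wadge_eq[where pos = "\<lambda>i. mark (2 * i)" and fill = filler and U = "omega_words \<Gamma>"])
  let ?C = "{y. (\<forall>i. y (mark (2 * i)) \<in> alph M) \<and> (\<forall>n. n \<notin> range (\<lambda>i. mark (2 * i)) \<longrightarrow> y n = filler n)}"
  have C: "y \<in> ?C \<longleftrightarrow> (\<forall>n. okp y n)" for y by (auto simp: okp_def)
  show "strict_mono (\<lambda>i. mark (2 * i))" by (simp add: strict_mono_Suc_iff)
  show "alph M \<subseteq> \<Gamma>" "filler n \<in> \<Gamma>" for n by (auto simp: \<Gamma>_def filler_def)
  show "y \<in> ca_lang 1 B \<longleftrightarrow> (\<lambda>i. y (mark (2 * i))) \<in> ca_lang 4 M" if "y \<in> omega_words \<Gamma>" "y \<in> ?C" for y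
    using simulation_sound simulation_complete that C by blast
  show "y \<in> ca_lang 1 B \<longleftrightarrow> y \<in> omega_words \<Gamma>" if "y \<in> omega_words \<Gamma>" "y \<notin> ?C" for y
    using mismatch_accepted that C by blast
qed (use assms in \<open>auto simp: cantor_open_def\<close>)

end

section \<open>The two hierarchies\<close>

text \<open>Over the empty alphabet there are no words, and no function maps the words over a
  nonempty alphabet into that empty space. So the parity languages cannot serve as witnesses
  there.\<close>

lemma empty_language:
  "rCL1 {} {}" "rBCL4 {} {}"
proof -
  define E where "E k = mk_ca {0 :: nat} {} (blind_closure k {}) 0 {}" for k
  have "valid_ca k (E k)" for k
    unfolding E_def by (rule valid_mk_ca) (auto simp: blind_closure_def)
  moreover have "blind_ca k (E k)" for k
    unfolding E_def by (rule blind_mk_ca)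
  moreover have "alph (E k) = {}" "ca_lang k (E k) = {}" for k
    by (auto simp: E_def ca_lang_def omega_words_def)
  ultimately show "rCL1 {} {}" "rBCL4 {} {}" unfolding rCL1_def rBCL4_def by metis+
qed

text \<open>P stands for the target class of either direction. A simulation is required only when no
  level of \<open>alt\<close> dies out.\<close>

lemma wadge_equivalent_member:
  assumes parity: "\<And>n col. P {..Suc n} (parity_lang n col)" and empty: "P {} {}"
    and inf: "(\<And>n x. alt (omega_words \<Sigma>) L True n x 0) \<Longrightarrow> \<exists>\<Gamma> L'. finite \<Gamma> \<and> P \<Gamma> L' \<and> wadge_eq \<Sigma> L \<Gamma> L'"
  shows "\<exists>\<Gamma> L'. finite \<Gamma> \<and> P \<Gamma> L' \<and> wadge_eq \<Sigma> L \<Gamma> L'"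
proof (cases "omega_words \<Sigma> = {}")
  case True
  then have "\<Sigma> = {}" by (auto simp: omega_words_def)
  then have "wadge_eq \<Sigma> L {} {}"
    by (auto simp: wadge_eq_def wadge_le_def cantor_continuous_def omega_words_def)
  then show ?thesis using empty by blast
next
  case ne: False
  show ?thesis
  proof (cases "\<forall>n. alt (omega_words \<Sigma>) L True n (\<lambda>_. 0) 0")
    case True
    then have "alt (omega_words \<Sigma>) L True n x 0" for n x
      using alt_cong[of 0 x "\<lambda>_. 0" "omega_words \<Sigma>" L True n] by blast
    then show ?thesis by (rule inf)
  next
    case False
    then show ?thesis using finite_level_wadge_eq[OF ne] parity finite_atMost by meson
  qed
qed

lemma rCL1_imp_rBCL4:
  assumes "rCL1 \<Sigma> L"
  shows "\<exists>\<Gamma> L'. finite \<Gamma> \<and> rBCL4 \<Gamma> L' \<and> wadge_eq \<Sigma> L \<Gamma> L'"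
proof (rule wadge_equivalent_member[OF rBCL4_parity_lang empty_language(2)])
  assume inf: "\<And>n x. alt (omega_words \<Sigma>) L True n x 0"
  obtain M where M: "valid_ca 1 M" "alph M = \<Sigma>" "L = ca_lang 1 M" using assms unfolding rCL1_def by blast
  have "finite (alph M)" using M(1) by (simp add: valid_ca_def)
  then obtain z where "z \<notin> alph M" using ex_new_if_finite[OF infinite_UNIV_nat] by blast
  then interpret counter_to_blind M z using M(1) by unfold_locales
  have "finite \<Gamma>" using fin by (simp add: \<Gamma>_def)
  then show "\<exists>\<Gamma> L'. finite \<Gamma> \<and> rBCL4 \<Gamma> L' \<and> wadge_eq \<Sigma> L \<Gamma> L'"
    using wadge_eq_B[unfolded M(2) M(3)[symmetric], OF inf] rBCL4_B by blast
qed

lemma rBCL4_imp_rCL1: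
  assumes "rBCL4 \<Sigma> L"
  shows "\<exists>\<Gamma> L'. finite \<Gamma> \<and> rCL1 \<Gamma> L' \<and> wadge_eq \<Sigma> L \<Gamma> L'"
proof (rule wadge_equivalent_member[OF rCL1_parity_lang empty_language(1)])
  assume inf: "\<And>n x. alt (omega_words \<Sigma>) L True n x 0"
  obtain M where M: "valid_ca 4 M" "alph M = \<Sigma>" "L = ca_lang 4 M" using assms unfolding rBCL4_def by blast
  have fin: "finite (alph M)" using M(1) by (simp add: valid_ca_def)
  obtain z where z: "z \<notin> alph M" using ex_new_if_finite[OF infinite_UNIV_nat fin] by blast
  obtain S where "S \<notin> insert z (alph M)" using ex_new_if_finite[OF infinite_UNIV_nat, of "insert z (alph M)"] fin by blast
  then interpret counters_to_one M z S using M(1) z by unfold_locales auto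
  have "finite \<Gamma>" using fin by (simp add: \<Gamma>_def)
  then show "\<exists>\<Gamma> L'. finite \<Gamma> \<and> rCL1 \<Gamma> L' \<and> wadge_eq \<Sigma> L \<Gamma> L'"
    using wadge_eq_B[unfolded M(2) M(3)[symmetric], OF inf] rCL1_B by blast
qed

theorem mainTheorem1:
  shows "(\<forall>\<Sigma> L. finite \<Sigma> \<and> L \<in> cantor_borel \<Sigma> \<and> rCL1 \<Sigma> L \<longrightarrow>
            (\<exists>\<Gamma> L'. finite \<Gamma> \<and> rBCL4 \<Gamma> L' \<and> wadge_eq \<Sigma> L \<Gamma> L'))
       \<and> (\<forall>\<Sigma> L. finite \<Sigma> \<and> L \<in> cantor_borel \<Sigma> \<and> rBCL4 \<Sigma> L \<longrightarrow>
            (\<exists>\<Gamma> L'. finite \<Gamma> \<and> rCL1 \<Gamma> L' \<and> wadge_eq \<Sigma> L \<Gamma> L'))"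
  using rCL1_imp_rBCL4 rBCL4_imp_rCL1 by blast

end
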